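(* Let $0\le l<u<\infty$, $\sigma>0$, $x\in[l,u]$, $\theta_0\in\mathbb{R}$ and $\rho>0$, and let $f:[l,u]\to\mathbb{R}$ be a known measurable function. Assume: (i) there is a constant $M>0$ such that $|f(x_1)-f(x_2)|\le M|x_1-x_2|$ for all $x_1,x_2\in[l,u]$; (ii) $f$ is not identically $0$ on $[l,u]$; (iii) the parameter space is $\Theta=\{\theta:|\theta-\theta_0|\le\rho\}$, where $\theta_0$ is the true parameter. Let $X=\{X_t\}_{t\ge0}$ be the solution of the reflected stochastic differential equation $$\mathrm{d}X_t=\theta_0 f(X_t)\,\mathrm{d}t+\sigma\,\mathrm{d}W_t+\mathrm{d}L_t-\mathrm{d}R_t,\qquad X_0=x,$$ with reflecting barriers $l$ and $u$. Let $\hat\theta_T=\arg\max_{\theta\in\Theta}\ell_T(\theta)$ be the maximum likelihood estimator of $\theta_0$ based on the continuous observation of $X$ on $[0,T]$, where $$\ell_T(\theta)=\frac1T\left(\frac{\theta}{\sigma^2}\int_0^T f(X_t)\big(\mathrm{d}X_t-\mathrm{d}L_t+\mathrm{d}R_t\big)-\frac{\theta^2}{2\sigma^2}\int_0^T f^2(X_t)\,\mathrm{d}t\right).$$ Let $$F=\int_l^u f^2(y)\,\pi_{l,u}(y)\,\mathrm{d}y,\qquad \pi_{l,u}(y)=\frac{\exp\left(-\frac{2\theta_0}{\sigma^2}\int_l^y f(r)\,\mathrm{d}r\right)}{\int_l^u\exp\left(-\frac{2\theta_0}{\sigma^2}\int_l^z f(r)\,\mathrm{d}r\right)\mathrm{d}z}.$$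 Then $\sqrt{T}(\hat\theta_T-\theta_0)$ converges in distribution to $\mathcal{N}(0,\sigma^2F^{-1})$ as $T\to\infty$.
   Context: $(\Omega,\mathcal{F},\mathbb{P},\{\mathcal{F}_t\}_{t\ge0})$ is a filtered probability space and $W$ is a one-dimensional standard Brownian motion adapted to $\{\mathcal{F}_t\}$. $X$ is the unique strong solution of the reflected equation; $L$ and $R$ are the minimal continuous increasing processes with $L_0=R_0=0$ such that $X_t\in[l,u]$ for all $t\ge0$; they increase only when $X$ hits $l$ and $u$ respectively, i.e. $\int_0^\infty I_{\{X_t>l\}}\,\mathrm{d}L_t=0$ and $\int_0^\infty I_{\{X_t<u\}}\,\mathrm{d}R_t=0$, where $I$ denotes the indicator. The function $\pi_{l,u}$ defined in the claim is the one given as the density of the unique invariant probability measure of $X$. The function $\ell_T$ is the log-likelihood divided by $T$, and the maximum likelihood estimator is represented explicitly as $$\hat\theta_T=\frac{\int_0^Tf(X_t)(\mathrm{d}X_t-\mathrm{d}L_t+\mathrm{d}R_t)}{\int_0^Tf^2(X_t)\,\mathrm{d}t}.$$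
   Formalization: The exponent in π_{l,u} is taken with a plus sign, exp(+(2θ₀/σ²)∫f), which is the invariant density for drift +θ₀f; the printed minus sign makes the claim false, e.g. for l=0, u=1, σ=θ₀=1, f(y)=y. *)

theory Defs
  imports "HOL-Probability.Probability"
begin

section \<open>Convergence in distribution along a filter\<close>

text \<open>This is \<^const>\<open>weak_conv_m\<close> with a general filter in place of \<^const>\<open>sequentially\<close>, so that
  the time horizon can tend to infinity through the reals.\<close>

definition weak_conv_filter :: "('i \<Rightarrow> real measure) \<Rightarrow> real measure \<Rightarrow> 'i filter \<Rightarrow> bool"
  where "weak_conv_filter Ms N G \<longleftrightarrow>
    (\<forall>x. isCont (cdf N) x \<longrightarrow> ((\<lambda>i. cdf (Ms i) x) \<longlongrightarrow> cdf N x) G)"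

definition normal_distribution :: "real \<Rightarrow> real \<Rightarrow> real measure"
  where "normal_distribution \<mu> v = density lborel (normal_density \<mu> (sqrt v))"


section \<open>Filtrations and Brownian motion\<close>

text \<open>Time is a real number; only the values at times \<open>t \<ge> 0\<close> are ever constrained or used.\<close>

definition filtration_on :: "'a measure \<Rightarrow> (real \<Rightarrow> 'a measure) \<Rightarrow> bool"
  where "filtration_on M F \<longleftrightarrow>
    (\<forall>t\<ge>0. subalgebra M (F t)) \<and> (\<forall>s t. 0 \<le> s \<and> s \<le> t \<longrightarrow> subalgebra (F t) (F s))"

definition adapted_to :: "(real \<Rightarrow> 'a measure) \<Rightarrow> (real \<Rightarrow> 'a \<Rightarrow> real) \<Rightarrow> bool"
  where "adapted_to F Z \<longleftrightarrow> (\<forall>t\<ge>0. Z t \<in> borel_measurable (F t))"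

definition standard_brownian_motion ::
    "'a measure \<Rightarrow> (real \<Rightarrow> 'a measure) \<Rightarrow> (real \<Rightarrow> 'a \<Rightarrow> real) \<Rightarrow> bool"
  where "standard_brownian_motion M F W \<longleftrightarrow>
    adapted_to F W \<and>
    (AE \<omega> in M. W 0 \<omega> = 0 \<and> continuous_on {0..} (\<lambda>t. W t \<omega>)) \<and>
    (\<forall>s t. 0 \<le> s \<and> s < t \<longrightarrow>
      distributed M lborel (\<lambda>\<omega>. W t \<omega> - W s \<omega>) (normal_density 0 (sqrt (t - s))) \<and>
      prob_space.indep_set M (sets (F s))
        (sets (vimage_algebra (space M) (\<lambda>\<omega>. W t \<omega> - W s \<omega>) borel)))"


section \<open>The stochastic integral\<close>

definition time_partition :: "real \<Rightarrow> real list \<Rightarrow> bool"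
  where "time_partition T ts \<longleftrightarrow> ts \<noteq> [] \<and> sorted ts \<and> hd ts = 0 \<and> last ts = T"

definition mesh_less :: "real \<Rightarrow> real list \<Rightarrow> bool"
  where "mesh_less \<delta> ts \<longleftrightarrow> (\<forall>i. Suc i < length ts \<longrightarrow> ts ! Suc i - ts ! i < \<delta>)"

definition left_sum ::
    "(real \<Rightarrow> 'a \<Rightarrow> real) \<Rightarrow> (real \<Rightarrow> 'a \<Rightarrow> real) \<Rightarrow> real list \<Rightarrow> 'a \<Rightarrow> real"
  where "left_sum H Y ts \<omega> =
    (\<Sum>i<length ts - 1. H (ts ! i) \<omega> * (Y (ts ! Suc i) \<omega> - Y (ts ! i) \<omega>))"

text \<open>For a continuous adapted integrand \<open>H\<close> and a continuous semimartingale \<open>Y\<close>, the Ito integral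
  \<open>\<integral>\<^sub>0\<^sup>T H dY\<close> is the limit in probability of the left-endpoint sums as the mesh of the
  (deterministic) partition tends to \<open>0\<close>; it is determined up to a null set.
  The outer measure agrees with \<open>M\<close> on events. It is used because the measure of a non-measurable
  set is \<open>0\<close> by convention, which would make the condition hold spuriously: below, \<open>H\<close> is of the
  form \<open>f \<circ> X\<close> with \<open>f\<close> unspecified outside the interval in which \<open>X\<close> lives almost surely.\<close>

definition has_stoch_integral ::
    "'a measure \<Rightarrow> (real \<Rightarrow> 'a \<Rightarrow> real) \<Rightarrow> (real \<Rightarrow> 'a \<Rightarrow> real) \<Rightarrow> real \<Rightarrow> ('a \<Rightarrow> real) \<Rightarrow> bool"
  where "has_stoch_integral M H Y T J \<longleftrightarrow>
    J \<in> borel_measurable M \<and>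
    (\<forall>\<epsilon>>0. \<forall>\<eta>>0. \<exists>\<delta>>0. \<forall>ts. time_partition T ts \<and> mesh_less \<delta> ts \<longrightarrow>
      outer_measure_of M {\<omega> \<in> space M. \<epsilon> \<le> \<bar>left_sum H Y ts \<omega> - J \<omega>\<bar>} < ennreal \<eta>)"

definition stoch_integral ::
    "'a measure \<Rightarrow> (real \<Rightarrow> 'a \<Rightarrow> real) \<Rightarrow> (real \<Rightarrow> 'a \<Rightarrow> real) \<Rightarrow> real \<Rightarrow> 'a \<Rightarrow> real"
  where "stoch_integral M H Y T = (SOME J. has_stoch_integral M H Y T J)"


section \<open>The reflected equation\<close>

text \<open>\<open>\<integral>\<^sub>0\<^sup>\<infinity> 1{t \<in> A} dG\<^sub>t\<close> for a continuous increasing \<open>G\<close> on \<open>[0, \<infinity>)\<close>. Since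
  \<^const>\<open>interval_measure\<close> expects a function on the whole line, \<open>G\<close> is extended to negative times
  by the constant \<open>G 0\<close>, which adds no mass.\<close>

definition stieltjes_mass :: "(real \<Rightarrow> real) \<Rightarrow> real set \<Rightarrow> ennreal"
  where "stieltjes_mass G A =
    (\<integral>\<^sup>+t. indicator (A \<inter> {0..}) t \<partial>interval_measure (\<lambda>t. G (max 0 t)))"

definition increasing_from_zero :: "(real \<Rightarrow> real) \<Rightarrow> bool"
  where "increasing_from_zero G \<longleftrightarrow> G 0 = 0 \<and> continuous_on {0..} G \<and> mono_on {0..} G"

text \<open>Minimality of the pushing processes is expressed, as usual for the Skorokhod problem, by the
  requirement that each of them increases only while \<open>X\<close> sits at the corresponding barrier.\<close>

definition reflected_sde_solution ::
    "'a measure \<Rightarrow> (real \<Rightarrow> 'a measure) \<Rightarrow> (real \<Rightarrow> 'a \<Rightarrow> real) \<Rightarrow>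
      real \<Rightarrow> real \<Rightarrow> (real \<Rightarrow> real) \<Rightarrow> real \<Rightarrow> real \<Rightarrow>
      (real \<Rightarrow> 'a \<Rightarrow> real) \<Rightarrow> (real \<Rightarrow> 'a \<Rightarrow> real) \<Rightarrow> (real \<Rightarrow> 'a \<Rightarrow> real) \<Rightarrow> bool"
  where "reflected_sde_solution M F W l u b \<sigma> x X L R \<longleftrightarrow>
    adapted_to F X \<and> adapted_to F L \<and> adapted_to F R \<and>
    (AE \<omega> in M.
      continuous_on {0..} (\<lambda>t. X t \<omega>) \<and>
      (\<forall>t\<ge>0. X t \<omega> \<in> {l..u}) \<and>
      (\<forall>t\<ge>0. X t \<omega> = x + (LINT s:{0..t}|lborel. b (X s \<omega>)) + \<sigma> * W t \<omega> + L t \<omega> - R t \<omega>) \<and>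
      increasing_from_zero (\<lambda>t. L t \<omega>) \<and>
      increasing_from_zero (\<lambda>t. R t \<omega>) \<and>
      stieltjes_mass (\<lambda>t. L t \<omega>) {t. X t \<omega> > l} = 0 \<and>
      stieltjes_mass (\<lambda>t. R t \<omega>) {t. X t \<omega> < u} = 0)"


section \<open>Likelihood and invariant density\<close>

definition log_likelihood_rate ::
    "'a measure \<Rightarrow> (real \<Rightarrow> real) \<Rightarrow> real \<Rightarrow>
      (real \<Rightarrow> 'a \<Rightarrow> real) \<Rightarrow> (real \<Rightarrow> 'a \<Rightarrow> real) \<Rightarrow> (real \<Rightarrow> 'a \<Rightarrow> real) \<Rightarrow>
      real \<Rightarrow> 'a \<Rightarrow> real \<Rightarrow> real"
  where "log_likelihood_rate M f \<sigma> X L R T \<omega> \<theta> =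
    1 / T * (\<theta> / \<sigma>\<^sup>2 *
        stoch_integral M (\<lambda>t \<omega>. f (X t \<omega>)) (\<lambda>t \<omega>. X t \<omega> - L t \<omega> + R t \<omega>) T \<omega>
      - \<theta>\<^sup>2 / (2 * \<sigma>\<^sup>2) * (LINT t:{0..T}|lborel. (f (X t \<omega>))\<^sup>2))"

text \<open>The density of the invariant probability measure of the reflected diffusion with drift
  \<open>\<theta>\<^sub>0 * f\<close> and diffusion coefficient \<open>\<sigma>\<close>. Beware of the sign in the exponent: for the drift
  \<open>+\<theta>\<^sub>0 * f\<close> the zero-flux equation \<open>\<sigma>\<^sup>2/2 * p' = \<theta>\<^sub>0 * f * p\<close> forces a plus sign (lemma
  \<open>reflected_density_zero_flux\<close> below). The formula is sometimes printed with a minus sign, which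
  belongs to the drift \<open>-\<theta>\<^sub>0 * f\<close>.\<close>

definition speed_weight :: "(real \<Rightarrow> real) \<Rightarrow> real \<Rightarrow> real \<Rightarrow> real \<Rightarrow> real \<Rightarrow> real"
  where "speed_weight f \<theta>0 \<sigma> l y = exp (2 * \<theta>0 / \<sigma>\<^sup>2 * (LINT r:{l..y}|lborel. f r))"

definition reflected_density ::
    "(real \<Rightarrow> real) \<Rightarrow> real \<Rightarrow> real \<Rightarrow> real \<Rightarrow> real \<Rightarrow> real \<Rightarrow> real"
  where "reflected_density f \<theta>0 \<sigma> l u y =
    speed_weight f \<theta>0 \<sigma> l y / (LINT z:{l..u}|lborel. speed_weight f \<theta>0 \<sigma> l z)"

definition limit_information :: "(real \<Rightarrow> real) \<Rightarrow> real \<Rightarrow> real \<Rightarrow> real \<Rightarrow> real \<Rightarrow> real"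
  where "limit_information f \<theta>0 \<sigma> l u =
    (LINT y:{l..u}|lborel. (f y)\<^sup>2 * reflected_density f \<theta>0 \<sigma> l u y)"

lemma reflected_density_zero_flux:
  assumes f: "continuous_on {l..u} f" and y: "y \<in> {l..u}" and \<sigma>: "\<sigma> \<noteq> 0"
  shows "((\<lambda>z. \<sigma>\<^sup>2 / 2 * reflected_density f \<theta>0 \<sigma> l u z) has_real_derivative
    \<theta>0 * f y * reflected_density f \<theta>0 \<sigma> l u y) (at y within {l..u})"
proof -
  have "((\<lambda>z. integral {l..z} f) has_real_derivative f y) (at y within {l..u})"
    using integral_has_real_derivative[OF f y] .
  moreover have "integral {l..z} f = (LINT r:{l..z}|lborel. f r)" if "z \<in> {l..u}" for z
  proof -
    have "continuous_on {l..z} f"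
      using that by (intro continuous_on_subset[OF f]) auto
    then have "set_integrable lborel {l..z} f"
      by (rule borel_integrable_atLeastAtMost')
    then show ?thesis
      by (simp add: set_borel_integral_eq_integral(2))
  qed
  ultimately have d: "((\<lambda>z. LINT r:{l..z}|lborel. f r) has_real_derivative f y) (at y within {l..u})"
    using y by (auto elim!: has_field_derivative_transform_within[where d = 1])
  define D where "D = (LINT z:{l..u}|lborel. speed_weight f \<theta>0 \<sigma> l z)"
  define w where "w = (\<lambda>z. speed_weight f \<theta>0 \<sigma> l z)"
  have "(w has_real_derivative w y * (2 * \<theta>0 / \<sigma>\<^sup>2 * f y)) (at y within {l..u})"
    unfolding w_def speed_weight_def using \<sigma>
    by (auto intro!: derivative_eq_intros d simp: field_simps power4_eq_xxxx power2_eq_square)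
  then have "((\<lambda>z. \<sigma>\<^sup>2 / 2 * (w z / D)) has_real_derivative
      \<sigma>\<^sup>2 / 2 * (w y * (2 * \<theta>0 / \<sigma>\<^sup>2 * f y) / D)) (at y within {l..u})"
    by (intro DERIV_cmult DERIV_cdivide)
  moreover have "\<sigma>\<^sup>2 / 2 * (w y * (2 * \<theta>0 / \<sigma>\<^sup>2 * f y) / D) = \<theta>0 * f y * (w y / D)"
    using \<sigma> by simp
  ultimately show ?thesis
    by (simp add: reflected_density_def w_def D_def)
qed

end

theory Submission
  imports Defs
begin

text \<open>Write \<open>I\<^sub>T\<close> for the Ito integral of \<open>f(X)\<close> against \<open>W\<close>, and \<open>A\<^sub>T\<close> for the integral of
  \<open>f(X)\<^sup>2\<close> over \<open>[0, T]\<close>. The drift-corrected observation satisfies \<open>d(X - L + R) = \<theta>0 f(X) dt + \<sigma> dW\<close>, so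
  the unconstrained maximiser of the likelihood is \<open>\<theta>0 + \<sigma> I\<^sub>T / A\<^sub>T\<close>, and the estimator is its projection
  onto the parameter interval. Solving the Neumann problem \<open>\<sigma>\<^sup>2/2 g'' + \<theta>0 f g' = f\<^sup>2 - J\<close>,
  \<open>g'(l) = g'(u) = 0\<close>, where \<open>J\<close> is the limit information, and expanding \<open>g(X)\<close> by Ito's formula shows
  that \<open>A\<^sub>T / T\<close> tends to \<open>J\<close> in mean square; the boundary terms vanish because \<open>g'\<close> does. Finally
  \<open>E exp(i \<kappa> I\<^sub>T + \<kappa>\<^sup>2 A\<^sub>T / 2) = 1\<close>, and replacing \<open>A\<^sub>T\<close> by its deterministic limit \<open>J T\<close> here
  gives the Gaussian limit of \<open>I\<^sub>T / sqrt T\<close>. The stochastic integrals are mean-square limits of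
  left-endpoint sums, so each of these identities only has to be checked for sums.\<close>

section \<open>Normal distributions and mean-square convergence\<close>

text \<open>The limit is taken for each threshold \<open>z\<close> separately. For
  \<open>\<bar>z\<bar> < \<rho> * sqrt T\<close> the projection onto the parameter interval is
  invisible, and \<open>sqrt T * (\<theta>hat T - \<theta>0) \<le> z\<close> becomes, after
  multiplication by the positive random denominator, an inequality affine in the score and the
  information. The quotient disappears before any limit is taken, at the price of a comparison
  variable that depends on \<open>z\<close>. Its characteristic function is under control because
  \<open>A / T\<close> stays below a deterministic constant: exponentials of \<open>A / T\<close>
  and of \<open>J\<close> then differ by at most a constant times
  \<open>\<bar>A / T - J\<bar>\<close>, whose mean tends to 0. Two obstacles shape the rest. Path
  properties hold almost surely, with a random modulus of continuity, while the stochastic integral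
  asks for a deterministic mesh; dominated convergence along a sequence of hypothetical
  counterexamples bridges this. And \<open>stoch_integral\<close> is an arbitrary choice among
  almost surely equal limits, so computations use measurable versions built from a truncated process
  and are transferred by uniqueness.\<close>

lemma real_distribution_normal_distribution:
  assumes "v > 0" shows "real_distribution (normal_distribution m v)"
proof -
  interpret prob_space "normal_distribution m v"
    unfolding normal_distribution_def using assms by (intro prob_space_normal_density) simp
  show ?thesis
    by unfold_locales (simp_all add: normal_distribution_def)
qed

text \<open>The law is the image of the standard normal law under multiplication by
  \<open>sqrt v\<close>, which reduces the claim to the standard characteristic function.\<close>

lemma char_normal_distribution:
  assumes v: "v > 0"
  shows "char (normal_distribution 0 v) t = exp (- (t\<^sup>2 * v) / 2)"
proof -
  interpret prob_space std_normal_distribution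
    by (rule prob_space_normal_density) simp
  have "distributed std_normal_distribution lborel (\<lambda>x. x) std_normal_density"
    unfolding distributed_def by (auto simp: distr_id2)
  then have "distributed std_normal_distribution lborel (\<lambda>x. 0 + sqrt v * x)
      (normal_density (0 + sqrt v * 0) (\<bar>sqrt v\<bar> * 1))"
    using v by (intro normal_density_affine) auto
  then have *: "normal_distribution 0 v = distr std_normal_distribution borel (\<lambda>x. sqrt v * x)"
    using v distr_cong[OF refl sets_lborel refl, of std_normal_distribution "\<lambda>x. sqrt v * x"]
    unfolding distributed_def normal_distribution_def by simp
  have "char (normal_distribution 0 v) t = char std_normal_distribution (t * sqrt v)"
    unfolding * char_def by (subst integral_distr) (auto simp: mult.assoc)
  also have "\<dots> = exp (- (t\<^sup>2 * v) / 2)"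
    using v by (simp add: char_std_normal_distribution power_mult_distrib exp_of_real)
  finally show ?thesis .
qed

section \<open>Square-integrable random variables\<close>

context prob_space
begin

lemma integrable_bounded:
  fixes Z :: "'a \<Rightarrow> real"
  shows "Z \<in> borel_measurable M \<Longrightarrow> (\<And>\<omega>. \<bar>Z \<omega>\<bar> \<le> C) \<Longrightarrow> integrable M Z"
  by (rule integrable_const_bound[of _ C]) auto

lemma integrable_mult_square:
  fixes X Y :: "'a \<Rightarrow> real"
  assumes "X \<in> borel_measurable M" "Y \<in> borel_measurable M"
    "integrable M (\<lambda>\<omega>. (X \<omega>)\<^sup>2)" "integrable M (\<lambda>\<omega>. (Y \<omega>)\<^sup>2)"
  shows "integrable M (\<lambda>\<omega>. X \<omega> * Y \<omega>)"
proof (rule Bochner_Integration.integrable_bound)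
  show "integrable M (\<lambda>\<omega>. (X \<omega>)\<^sup>2 + (Y \<omega>)\<^sup>2)" using assms by simp
  show "AE \<omega> in M. norm (X \<omega> * Y \<omega>) \<le> norm ((X \<omega>)\<^sup>2 + (Y \<omega>)\<^sup>2)"
  proof (intro AE_I2)
    fix \<omega>
    have "2 * (\<bar>X \<omega>\<bar> * \<bar>Y \<omega>\<bar>) \<le> (X \<omega>)\<^sup>2 + (Y \<omega>)\<^sup>2"
      using sum_squares_bound[of "\<bar>X \<omega>\<bar>" "\<bar>Y \<omega>\<bar>"] by simp
    then have "\<bar>X \<omega>\<bar> * \<bar>Y \<omega>\<bar> \<le> (X \<omega>)\<^sup>2 + (Y \<omega>)\<^sup>2"
      using mult_nonneg_nonneg[of "\<bar>X \<omega>\<bar>" "\<bar>Y \<omega>\<bar>"] by linarith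
    then show "norm (X \<omega> * Y \<omega>) \<le> norm ((X \<omega>)\<^sup>2 + (Y \<omega>)\<^sup>2)"
      by (simp add: abs_mult)
  qed
qed (use assms in auto)

text \<open>Young's inequality \<open>\<bar>X\<bar> \<le> X\<^sup>2 / (2 * c) + c / 2\<close>, in
  which both terms on the right have mean at most \<open>c / 2\<close>.\<close>

lemma L1_le_L2:
  fixes X :: "'a \<Rightarrow> real"
  assumes X: "X \<in> borel_measurable M" "integrable M (\<lambda>\<omega>. (X \<omega>)\<^sup>2)"
    and le: "expectation (\<lambda>\<omega>. (X \<omega>)\<^sup>2) \<le> c\<^sup>2" and c: "0 < c"
  shows "integrable M X" "expectation (\<lambda>\<omega>. \<bar>X \<omega>\<bar>) \<le> c"
proof -
  show X1: "integrable M X"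
    using square_integrable_imp_integrable[OF X] by simp
  have "expectation (\<lambda>\<omega>. \<bar>X \<omega>\<bar>) \<le> expectation (\<lambda>\<omega>. (X \<omega>)\<^sup>2 / (2 * c) + c / 2)"
  proof (rule integral_mono)
    fix \<omega>
    have "2 * c * \<bar>X \<omega>\<bar> \<le> (X \<omega>)\<^sup>2 + c * c"
      using sum_squares_bound[of c "\<bar>X \<omega>\<bar>"] by (simp add: power2_eq_square)
    then show "\<bar>X \<omega>\<bar> \<le> (X \<omega>)\<^sup>2 / (2 * c) + c / 2"
      using c by (simp add: field_simps)
  qed (use X X1 in auto)
  also have "\<dots> = expectation (\<lambda>\<omega>. (X \<omega>)\<^sup>2) / (2 * c) + c / 2"
    using X prob_space by simp
  also have "\<dots> \<le> c\<^sup>2 / (2 * c) + c / 2"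
    using le c by (intro add_right_mono divide_right_mono) auto
  also have "\<dots> = c"
    using c by (simp add: power2_eq_square)
  finally show "expectation (\<lambda>\<omega>. \<bar>X \<omega>\<bar>) \<le> c" .
qed

text \<open>The Riesz-Fischer argument: along a fast subsequence the increments are summable in
  mean, hence almost surely absolutely summable. Only the pointwise limit is asserted; mean-square
  convergence is recovered afterwards from Fatou's lemma.\<close>

lemma L2_Cauchy_AE_subseq:
  fixes S :: "nat \<Rightarrow> 'a \<Rightarrow> real"
  assumes S: "\<And>n. S n \<in> borel_measurable M" "\<And>n. integrable M (\<lambda>\<omega>. (S n \<omega>)\<^sup>2)"
    and Cauchy: "\<And>\<epsilon>. 0 < \<epsilon> \<Longrightarrow> \<exists>N. \<forall>m\<ge>N. \<forall>n\<ge>N. expectation (\<lambda>\<omega>. (S m \<omega> - S n \<omega>)\<^sup>2) \<le> \<epsilon>"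
  shows "\<exists>J r. strict_mono r \<and> J \<in> borel_measurable M \<and> (AE \<omega> in M. (\<lambda>k. S (r k) \<omega>) \<longlonglongrightarrow> J \<omega>)"
proof -
  have "\<exists>N. \<forall>m\<ge>N. \<forall>n\<ge>N. expectation (\<lambda>\<omega>. (S m \<omega> - S n \<omega>)\<^sup>2) \<le> (1/4) ^ k" for k :: nat
    by (rule Cauchy) simp
  then obtain N where N: "\<And>k m n. N k \<le> m \<Longrightarrow> N k \<le> n \<Longrightarrow> expectation (\<lambda>\<omega>. (S m \<omega> - S n \<omega>)\<^sup>2) \<le> (1/4) ^ k"
    by metis
  \<comment> \<open>The summand \<open>k\<close> makes \<open>r\<close> strictly increasing, and the
    sum keeps \<open>r k\<close> at least \<open>N k\<close>. The rate \<open>(1/4) ^ k\<close> for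
    the squares leaves the summable rate \<open>(1/2) ^ k\<close> for the first moments.\<close>
  define r where "r k = k + (\<Sum>i\<le>k. N i)" for k
  have r: "strict_mono r"
    unfolding r_def by (rule strict_monoI_Suc) simp
  have Nr: "N k \<le> r k" for k
    using member_le_sum[of k "{..k}" N] unfolding r_def by simp
  define D where "D k \<omega> = S (r (Suc k)) \<omega> - S (r k) \<omega>" for k \<omega>
  have D [measurable]: "D k \<in> borel_measurable M" for k
    unfolding D_def using S by measurable
  have D2: "integrable M (\<lambda>\<omega>. (D k \<omega>)\<^sup>2)" for k
  proof -
    have "(\<lambda>\<omega>. (D k \<omega>)\<^sup>2) = (\<lambda>\<omega>. (S (r (Suc k)) \<omega>)\<^sup>2 + (S (r k) \<omega>)\<^sup>2 - 2 * (S (r (Suc k)) \<omega> * S (r k) \<omega>))"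
      by (rule ext) (simp add: D_def power2_eq_square algebra_simps)
    then show ?thesis
      using S integrable_mult_square[OF S(1) S(1) S(2) S(2)] by simp
  qed
  have Dsq: "expectation (\<lambda>\<omega>. (D k \<omega>)\<^sup>2) \<le> ((1/2) ^ k)\<^sup>2" for k
  proof -
    have "N k \<le> r (Suc k)" using Nr[of k] strict_monoD[OF r, of k "Suc k"] by simp
    then have "expectation (\<lambda>\<omega>. (D k \<omega>)\<^sup>2) \<le> (1/4) ^ k"
      unfolding D_def using Nr by (intro N)
    then show ?thesis by (simp add: power_mult_distrib[symmetric] power2_eq_square)
  qed
  have D1: "integrable M (D k)" "expectation (\<lambda>\<omega>. \<bar>D k \<omega>\<bar>) \<le> (1/2) ^ k" for k
    by (rule L1_le_L2[OF D D2 Dsq], simp)+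
  have "(\<integral>\<^sup>+\<omega>. (\<Sum>k. ennreal \<bar>D k \<omega>\<bar>) \<partial>M) = (\<Sum>k. \<integral>\<^sup>+\<omega>. ennreal \<bar>D k \<omega>\<bar> \<partial>M)"
    by (rule nn_integral_suminf) measurable
  also have "\<dots> \<le> (\<Sum>k. ennreal ((1/2) ^ k))"
  proof (rule suminf_le)
    fix k
    have "(\<integral>\<^sup>+\<omega>. ennreal \<bar>D k \<omega>\<bar> \<partial>M) = ennreal (expectation (\<lambda>\<omega>. \<bar>D k \<omega>\<bar>))"
      using D1 by (intro nn_integral_eq_integral) auto
    then show "(\<integral>\<^sup>+\<omega>. ennreal \<bar>D k \<omega>\<bar> \<partial>M) \<le> ennreal ((1/2) ^ k)"
      using D1 by (simp add: ennreal_leI)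
  qed auto
  also have "\<dots> < \<infinity>"
    by (subst suminf_ennreal2) (auto intro: summable_geometric simp del: power_divide)
  finally have fin: "(\<integral>\<^sup>+\<omega>. (\<Sum>k. ennreal \<bar>D k \<omega>\<bar>) \<partial>M) \<noteq> \<infinity>" by simp
  have "AE \<omega> in M. (\<Sum>k. ennreal \<bar>D k \<omega>\<bar>) \<noteq> \<infinity>"
    by (rule nn_integral_PInf_AE[OF _ fin]) measurable
  then have "AE \<omega> in M. convergent (\<lambda>k. S (r k) \<omega>)"
  proof eventually_elim
    fix \<omega> assume "(\<Sum>k. ennreal \<bar>D k \<omega>\<bar>) \<noteq> \<infinity>"
    then have "summable (\<lambda>k. \<bar>D k \<omega>\<bar>)"
      by (intro summable_suminf_not_top) auto
    then have "summable (\<lambda>k. D k \<omega>)"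
      by (rule summable_rabs_cancel)
    then have "convergent (\<lambda>n. \<Sum>k<n. D k \<omega>)"
      by (simp add: summable_iff_convergent)
    then have "convergent (\<lambda>n. S (r n) \<omega> - S (r 0) \<omega>)"
      unfolding D_def sum_lessThan_telescope[of "\<lambda>k. S (r k) \<omega>"] .
    from convergent_add[OF this convergent_const[of "S (r 0) \<omega>"]]
    show "convergent (\<lambda>k. S (r k) \<omega>)" by simp
  qed
  then have "AE \<omega> in M. (\<lambda>k. S (r k) \<omega>) \<longlonglongrightarrow> lim (\<lambda>k. S (r k) \<omega>)"
    by eventually_elim (simp add: convergent_LIMSEQ_iff)
  moreover have "(\<lambda>\<omega>. lim (\<lambda>k. S (r k) \<omega>)) \<in> borel_measurable M"
    using S by (intro borel_measurable_lim_metric) auto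
  ultimately show ?thesis
    using r by blast
qed

text \<open>Fatou's lemma for squares. Applied to differences it turns the Cauchy property of sums
  into mean-square convergence; applied to discrete martingales it bounds the second moment of their
  limit.\<close>

lemma L2_bound_of_AE_limit:
  fixes S :: "nat \<Rightarrow> 'a \<Rightarrow> real"
  assumes S: "\<And>k. S k \<in> borel_measurable M" "\<And>k. integrable M (\<lambda>\<omega>. (S k \<omega>)\<^sup>2)"
    and J: "J \<in> borel_measurable M" and lim: "AE \<omega> in M. (\<lambda>k. S k \<omega>) \<longlonglongrightarrow> J \<omega>"
    and B: "\<forall>\<^sub>F k in sequentially. expectation (\<lambda>\<omega>. (S k \<omega>)\<^sup>2) \<le> B"
  shows "integrable M (\<lambda>\<omega>. (J \<omega>)\<^sup>2)" "expectation (\<lambda>\<omega>. (J \<omega>)\<^sup>2) \<le> B"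
proof -
  \<comment> \<open>\<open>ennreal\<close> sends negative numbers to 0, so the final bound can be
    read back in the reals only for a nonnegative \<open>B\<close>.\<close>
  have B0: "0 \<le> B"
  proof -
    obtain k where "expectation (\<lambda>\<omega>. (S k \<omega>)\<^sup>2) \<le> B"
      using B eventually_sequentially by auto
    moreover have "0 \<le> expectation (\<lambda>\<omega>. (S k \<omega>)\<^sup>2)" by simp
    ultimately show ?thesis by linarith
  qed
  have "(\<integral>\<^sup>+\<omega>. ennreal ((J \<omega>)\<^sup>2) \<partial>M) = (\<integral>\<^sup>+\<omega>. liminf (\<lambda>k. ennreal ((S k \<omega>)\<^sup>2)) \<partial>M)"
  proof (rule nn_integral_cong_AE)
    show "AE \<omega> in M. ennreal ((J \<omega>)\<^sup>2) = liminf (\<lambda>k. ennreal ((S k \<omega>)\<^sup>2))"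
      using lim
    proof eventually_elim
      case (elim \<omega>)
      then have "(\<lambda>k. ennreal ((S k \<omega>)\<^sup>2)) \<longlonglongrightarrow> ennreal ((J \<omega>)\<^sup>2)"
        by (intro tendsto_intros)
      then show ?case
        by (rule lim_imp_Liminf[OF trivial_limit_sequentially, symmetric])
    qed
  qed
  also have "\<dots> \<le> liminf (\<lambda>k. \<integral>\<^sup>+\<omega>. ennreal ((S k \<omega>)\<^sup>2) \<partial>M)"
    using S by (intro nn_integral_liminf) auto
  also have "\<dots> \<le> ennreal B"
  proof -
    have "\<forall>\<^sub>F k in sequentially. (\<integral>\<^sup>+\<omega>. ennreal ((S k \<omega>)\<^sup>2) \<partial>M) \<le> ennreal B"
      using B by eventually_elim (simp add: nn_integral_eq_integral[OF S(2)] ennreal_leI)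
    then show ?thesis
      by (rule Liminf_le[OF trivial_limit_sequentially])
  qed
  finally have *: "(\<integral>\<^sup>+\<omega>. ennreal ((J \<omega>)\<^sup>2) \<partial>M) \<le> ennreal B" .
  show int: "integrable M (\<lambda>\<omega>. (J \<omega>)\<^sup>2)"
    using J order.strict_trans1[OF *, of top] by (auto intro!: integrableI_nonneg)
  show "expectation (\<lambda>\<omega>. (J \<omega>)\<^sup>2) \<le> B"
    using * B0 by (subst (asm) nn_integral_eq_integral[OF int]) auto
qed

lemma L2_convergence_AE_subseq:
  fixes Y :: "nat \<Rightarrow> 'a \<Rightarrow> real"
  assumes Y: "\<And>n. Y n \<in> borel_measurable M" "\<And>n. integrable M (\<lambda>\<omega>. (Y n \<omega>)\<^sup>2)"
    and lim: "(\<lambda>n. expectation (\<lambda>\<omega>. (Y n \<omega>)\<^sup>2)) \<longlonglongrightarrow> 0"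
  obtains r where "strict_mono r" "AE \<omega> in M. (\<lambda>n. Y (r n) \<omega>) \<longlonglongrightarrow> 0"
proof -
  obtain r where r: "strict_mono r" "AE \<omega> in M. (\<lambda>n. (Y (r n) \<omega>)\<^sup>2) \<longlonglongrightarrow> 0"
    using tendsto_L1_AE_subseq[of M "\<lambda>n \<omega>. (Y n \<omega>)\<^sup>2"] Y lim by auto
  from r(2) have "AE \<omega> in M. (\<lambda>n. Y (r n) \<omega>) \<longlonglongrightarrow> 0"
  proof eventually_elim
    case (elim \<omega>)
    then have "(\<lambda>n. sqrt ((Y (r n) \<omega>)\<^sup>2)) \<longlonglongrightarrow> sqrt 0"
      by (rule tendsto_real_sqrt)
    then show ?case
      by (simp add: tendsto_rabs_zero_iff)
  qed
  with r(1) show thesis by (rule that)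
qed

end

section \<open>Left-endpoint sums along grids\<close>

text \<open>Indexing by natural numbers makes sums over steps telescope; values beyond index
  \<open>n\<close> are unconstrained. Repeated points are allowed, as in the sorted lists of
  \<open>time_partition\<close>, so every such list yields a grid.\<close>

definition grid :: "real \<Rightarrow> real \<Rightarrow> nat \<Rightarrow> (nat \<Rightarrow> real) \<Rightarrow> bool"
  where "grid T \<delta> n t \<longleftrightarrow> t 0 = 0 \<and> t n = T \<and> (\<forall>i<n. t i \<le> t (Suc i) \<and> t (Suc i) - t i < \<delta>)"

definition uniform_grid :: "real \<Rightarrow> nat \<Rightarrow> nat \<Rightarrow> real"
  where "uniform_grid T n i = real i * T / real n"

definition grid_sum ::
    "(real \<Rightarrow> 'a \<Rightarrow> real) \<Rightarrow> (real \<Rightarrow> 'a \<Rightarrow> real) \<Rightarrow> nat \<Rightarrow> (nat \<Rightarrow> real) \<Rightarrow> 'a \<Rightarrow> real"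
  where "grid_sum H Y n t \<omega> = (\<Sum>i<n. H (t i) \<omega> * (Y (t (Suc i)) \<omega> - Y (t i) \<omega>))"

lemma grid_mono:
  assumes "grid T \<delta> n t" "i \<le> j" "j \<le> n" shows "t i \<le> t j"
  using assms(2,3)
proof (induction rule: dec_induct)
  case (step k)
  then show ?case using assms(1) unfolding grid_def by (meson less_eq_Suc_le order_trans Suc_leD)
qed simp

lemma grid_range:
  assumes "grid T \<delta> n t" "i \<le> n" shows "0 \<le> t i" "t i \<le> T"
  using grid_mono[OF assms(1), of 0 i] grid_mono[OF assms(1), of i n] assms
  by (auto simp: grid_def)

lemma grid_step:
  assumes "grid T \<delta> n t" "i < n" shows "t i \<le> t (Suc i)" "t (Suc i) - t i < \<delta>"
  using assms by (auto simp: grid_def)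

lemma grid_sum_increments: "grid T \<delta> n t \<Longrightarrow> (\<Sum>i<n. t (Suc i) - t i) = T"
  by (simp add: sum_lessThan_telescope grid_def)

lemma grid_uniform_grid:
  assumes "0 < T" "0 < n" "T / real n < \<delta>"
  shows "grid T \<delta> n (uniform_grid T n)"
  using assms unfolding grid_def uniform_grid_def by (auto simp: field_simps)

lemma eventually_grid_uniform_grid:
  assumes "0 < T" "0 < \<delta>"
  shows "\<forall>\<^sub>F n in sequentially. grid T \<delta> n (uniform_grid T n)"
proof -
  have "(\<lambda>n. T / real n) \<longlonglongrightarrow> 0"
    by (rule lim_const_over_n)
  then have "\<forall>\<^sub>F n in sequentially. T / real n < \<delta>"
    using assms by (simp add: order_tendsto_iff)
  then show ?thesis
    using eventually_gt_at_top[of 0] by eventually_elim (use assms grid_uniform_grid in auto)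
qed

text \<open>The mesh bound in \<open>grid\<close> is strict and excludes \<open>T / Suc n\<close>
  itself, hence the factor 2; \<open>Suc n\<close> avoids the grid without steps.\<close>

lemma grid_uniform_grid_Suc:
  "0 < T \<Longrightarrow> grid T (2 * T / real (Suc n)) (Suc n) (uniform_grid T (Suc n))"
  by (intro grid_uniform_grid) (auto simp: field_simps intro!: add_pos_nonneg)

lemma eventually_grid_uniform_grid_Suc:
  "0 < T \<Longrightarrow> 0 < \<delta> \<Longrightarrow> \<forall>\<^sub>F n in sequentially. grid T \<delta> (Suc n) (uniform_grid T (Suc n))"
  by (rule eventually_sequentially_Suc[THEN iffD2, OF eventually_grid_uniform_grid])

text \<open>The length of the intersection of \<open>[a, b]\<close> and \<open>[c, d]\<close>, that
  is, the covariance of the Brownian increments over these intervals. It lets two unrelated grids be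
  compared without a common refinement.\<close>

definition overlap :: "real \<Rightarrow> real \<Rightarrow> real \<Rightarrow> real \<Rightarrow> real"
  where "overlap a b c d = max 0 (min b d - max a c)"

lemma overlap_nonneg: "0 \<le> overlap a b c d"
  by (simp add: overlap_def)

lemma overlap_commute: "overlap a b c d = overlap c d a b"
  by (simp add: overlap_def min.commute max.commute)

text \<open>The overlap is the increment over \<open>[c, d]\<close> of the clamping map onto
  \<open>[a, b]\<close>; in this form sums over a second grid telescope.\<close>

lemma overlap_eq_diff:
  "a \<le> b \<Longrightarrow> c \<le> d \<Longrightarrow> overlap a b c d = max a (min b d) - max a (min b c)"
  unfolding overlap_def by linarith

lemma sum_overlap:
  assumes g: "grid T \<delta> n t" and "0 \<le> a" "a \<le> b" "b \<le> T"
  shows "(\<Sum>j<n. overlap a b (t j) (t (Suc j))) = b - a"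
proof -
  have "(\<Sum>j<n. overlap a b (t j) (t (Suc j))) =
      (\<Sum>j<n. max a (min b (t (Suc j))) - max a (min b (t j)))"
    using assms grid_step[OF g] by (intro sum.cong refl overlap_eq_diff) auto
  also have "\<dots> = max a (min b (t n)) - max a (min b (t 0))"
    by (rule sum_lessThan_telescope)
  also have "\<dots> = b - a"
    using assms by (auto simp: grid_def)
  finally show ?thesis .
qed

text \<open>Distinct steps of one grid meet in at most a point, so only the diagonal
  survives.\<close>

lemma sum_overlap_self:
  fixes e :: "nat \<Rightarrow> nat \<Rightarrow> real"
  assumes g: "grid T \<delta> n t" and i: "i < n"
  shows "(\<Sum>k<n. e i k * overlap (t i) (t (Suc i)) (t k) (t (Suc k))) = e i i * (t (Suc i) - t i)"
proof -
  have 0: "overlap (t i) (t (Suc i)) (t k) (t (Suc k)) = 0" if "k < n" "k \<noteq> i" for k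
  proof (cases "i < k")
    case True
    then show ?thesis
      using grid_mono[OF g, of "Suc i" k] that by (auto simp: overlap_def)
  next
    case False
    then show ?thesis
      using grid_mono[OF g, of "Suc k" i] that i by (auto simp: overlap_def)
  qed
  have "(\<Sum>k<n. e i k * overlap (t i) (t (Suc i)) (t k) (t (Suc k))) =
      (\<Sum>k\<in>{i}. e i k * overlap (t i) (t (Suc i)) (t k) (t (Suc k)))"
    using i 0 by (intro sum.mono_neutral_right) auto
  then show ?thesis
    using grid_step[OF g i] by (simp add: overlap_def)
qed

lemma overlap_pos_imp_close:
  "overlap a b c d \<noteq> 0 \<Longrightarrow> b - a < \<delta> \<Longrightarrow> d - c < \<delta> \<Longrightarrow> \<bar>a - c\<bar> < \<delta>"
  unfolding overlap_def by linarith

text \<open>The limit is over all grids of small mesh, not along one sequence. Integrability is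
  demanded separately because a nonintegrable square has Bochner integral 0 and would meet the bound
  spuriously.\<close>

definition mean_square_integral ::
    "'a measure \<Rightarrow> (real \<Rightarrow> 'a \<Rightarrow> real) \<Rightarrow> (real \<Rightarrow> 'a \<Rightarrow> real) \<Rightarrow> real \<Rightarrow> ('a \<Rightarrow> real) \<Rightarrow> bool"
  where "mean_square_integral M H Y T I \<longleftrightarrow> I \<in> borel_measurable M \<and>
    (\<forall>\<epsilon>>0. \<exists>\<delta>>0. \<forall>n t. grid T \<delta> n t \<longrightarrow> integrable M (\<lambda>\<omega>. (grid_sum H Y n t \<omega> - I \<omega>)\<^sup>2) \<and>
      (LINT \<omega>|M. (grid_sum H Y n t \<omega> - I \<omega>)\<^sup>2) \<le> \<epsilon>)"

lemma mean_square_integralD: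
  assumes "mean_square_integral M H Y T I"
  shows "I \<in> borel_measurable M"
    and "0 < \<epsilon> \<Longrightarrow> \<exists>\<delta>>0. \<forall>n t. grid T \<delta> n t \<longrightarrow> integrable M (\<lambda>\<omega>. (grid_sum H Y n t \<omega> - I \<omega>)\<^sup>2) \<and>
      (LINT \<omega>|M. (grid_sum H Y n t \<omega> - I \<omega>)\<^sup>2) \<le> \<epsilon>"
  using assms unfolding mean_square_integral_def by blast+

section \<open>Pathwise estimates on a compact time interval\<close>

lemma uniformly_small_increments:
  fixes \<phi> :: "real \<Rightarrow> real"
  assumes "continuous_on {a..b} \<phi>" "0 < \<epsilon>"
  shows "\<exists>\<delta>>0. \<forall>s\<in>{a..b}. \<forall>t\<in>{a..b}. \<bar>s - t\<bar> < \<delta> \<longrightarrow> \<bar>\<phi> s - \<phi> t\<bar> \<le> \<epsilon>"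
proof -
  have "uniformly_continuous_on {a..b} \<phi>"
    using assms by (intro compact_uniformly_continuous) auto
  then obtain \<delta> where "\<delta> > 0" "\<And>s t. s \<in> {a..b} \<Longrightarrow> t \<in> {a..b} \<Longrightarrow> dist t s < \<delta> \<Longrightarrow> dist (\<phi> t) (\<phi> s) < \<epsilon>"
    using \<open>0 < \<epsilon>\<close> unfolding uniformly_continuous_on_def by metis
  then show ?thesis
    by (intro exI[of _ \<delta>]) (fastforce simp: dist_real_def abs_minus_commute)
qed

lemma continuous_on_interval_bounded:
  fixes \<phi> :: "real \<Rightarrow> real"
  assumes "continuous_on {a..b} \<phi>"
  shows "\<exists>B>0. \<forall>s\<in>{a..b}. \<bar>\<phi> s\<bar> \<le> B"
proof -
  have "bounded (\<phi> ` {a..b})"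
    using assms by (intro compact_imp_bounded compact_continuous_image) auto
  then show ?thesis
    unfolding bounded_pos by auto
qed

text \<open>On each step the sum freezes the integrand at the left end point. With
  \<open>\<bar>\<psi>\<bar> \<le> B\<close> and an oscillation of \<open>\<phi>\<close> of at most
  \<open>\<epsilon> / (B * T)\<close>, the error is at most \<open>\<epsilon> / T\<close> times the
  step length, and the step lengths add up to \<open>T\<close>.\<close>

lemma grid_sum_tendsto_integral:
  fixes \<phi> \<psi> V :: "real \<Rightarrow> real"
  assumes \<phi>: "continuous_on {0..T} \<phi>" and \<psi>: "continuous_on {0..T} \<psi>"
    and V: "\<And>a b. 0 \<le> a \<Longrightarrow> a \<le> b \<Longrightarrow> b \<le> T \<Longrightarrow> V b - V a = integral {a..b} \<psi>"
    and T: "0 < T" and \<epsilon>: "0 < \<epsilon>"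
  shows "\<exists>\<delta>>0. \<forall>n t. grid T \<delta> n t \<longrightarrow>
    \<bar>(\<Sum>i<n. \<phi> (t i) * (V (t (Suc i)) - V (t i))) - integral {0..T} (\<lambda>s. \<phi> s * \<psi> s)\<bar> \<le> \<epsilon>"
proof -
  obtain B where B: "B > 0" "\<And>s. s \<in> {0..T} \<Longrightarrow> \<bar>\<psi> s\<bar> \<le> B"
    using continuous_on_interval_bounded[OF \<psi>] by auto
  obtain \<delta> where \<delta>: "\<delta> > 0" "\<And>s t. s \<in> {0..T} \<Longrightarrow> t \<in> {0..T} \<Longrightarrow> \<bar>s - t\<bar> < \<delta> \<Longrightarrow> \<bar>\<phi> s - \<phi> t\<bar> \<le> \<epsilon> / (B * T)"
    using uniformly_small_increments[OF \<phi>, of "\<epsilon> / (B * T)"] \<epsilon> B T by auto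
  define G where "G b = integral {0..b} (\<lambda>s. \<phi> s * \<psi> s)" for b
  have cont: "continuous_on {a..b} (\<lambda>s. \<phi> s * \<psi> s)" "continuous_on {a..b} \<psi>"
    if "0 \<le> a" "b \<le> T" for a b
    using that by (auto intro!: continuous_intros intro: continuous_on_subset[OF \<phi>] continuous_on_subset[OF \<psi>])
  have step: "\<bar>\<phi> a * (V b - V a) - (G b - G a)\<bar> \<le> \<epsilon> / T * (b - a)"
    if ab: "0 \<le> a" "a \<le> b" "b \<le> T" "b - a < \<delta>" for a b
  proof -
    note int = cont[OF ab(1,3), THEN integrable_continuous_interval]
    have "G a + integral {a..b} (\<lambda>s. \<phi> s * \<psi> s) = G b"
      unfolding G_def using ab cont[of 0 b]
      by (intro Henstock_Kurzweil_Integration.integral_combine integrable_continuous_interval) auto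
    then have "\<phi> a * (V b - V a) - (G b - G a) = integral {a..b} (\<lambda>s. \<phi> a * \<psi> s) - integral {a..b} (\<lambda>s. \<phi> s * \<psi> s)"
      using V[OF ab(1-3)] by simp
    also have "\<dots> = integral {a..b} (\<lambda>s. \<phi> a * \<psi> s - \<phi> s * \<psi> s)"
      using int by (intro Henstock_Kurzweil_Integration.integral_diff[symmetric]) (auto intro: integrable_on_mult_right)
    also have "\<bar>\<dots>\<bar> \<le> integral {a..b} (\<lambda>s. \<epsilon> / T)"
      unfolding real_norm_def[symmetric]
    proof (rule integral_norm_bound_integral)
      fix s assume s: "s \<in> {a..b}"
      have "\<bar>\<phi> a - \<phi> s\<bar> * \<bar>\<psi> s\<bar> \<le> \<epsilon> / (B * T) * B"
        using s ab B \<delta> \<epsilon> T by (intro mult_mono) auto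
      then show "norm (\<phi> a * \<psi> s - \<phi> s * \<psi> s) \<le> \<epsilon> / T"
        using B by (simp add: left_diff_distrib[symmetric] abs_mult)
    qed (use int in \<open>auto intro!: Henstock_Kurzweil_Integration.integrable_diff intro: integrable_on_mult_right\<close>)
    also have "\<dots> = \<epsilon> / T * (b - a)" using ab by simp
    finally show ?thesis .
  qed
  have "\<bar>(\<Sum>i<n. \<phi> (t i) * (V (t (Suc i)) - V (t i))) - integral {0..T} (\<lambda>s. \<phi> s * \<psi> s)\<bar> \<le> \<epsilon>"
    if g: "grid T \<delta> n t" for n t
  proof -
    have "integral {0..T} (\<lambda>s. \<phi> s * \<psi> s) = (\<Sum>i<n. G (t (Suc i)) - G (t i))"
      using g unfolding sum_lessThan_telescope[of "\<lambda>i. G (t i)"] by (simp add: grid_def G_def)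
    then have "\<bar>(\<Sum>i<n. \<phi> (t i) * (V (t (Suc i)) - V (t i))) - integral {0..T} (\<lambda>s. \<phi> s * \<psi> s)\<bar> =
        \<bar>\<Sum>i<n. \<phi> (t i) * (V (t (Suc i)) - V (t i)) - (G (t (Suc i)) - G (t i))\<bar>"
      by (simp only: sum_subtractf)
    also have "\<dots> \<le> (\<Sum>i<n. \<epsilon> / T * (t (Suc i) - t i))"
      using grid_range[OF g] grid_step[OF g] by (intro order_trans[OF sum_abs] sum_mono step) auto
    also have "\<dots> = \<epsilon>"
      unfolding sum_distrib_left[symmetric] grid_sum_increments[OF g] using T by simp
    finally show ?thesis .
  qed
  with \<delta>(1) show ?thesis by blast
qed

section \<open>Brownian increments\<close>

locale brownian_filtration = prob_space M for M :: "'a measure" +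
  fixes F :: "real \<Rightarrow> 'a measure" and W :: "real \<Rightarrow> 'a \<Rightarrow> real"
  assumes filtration: "filtration_on M F"
    and brownian: "standard_brownian_motion M F W"
begin

definition dW :: "real \<Rightarrow> real \<Rightarrow> 'a \<Rightarrow> real"
  where "dW s t \<omega> = W t \<omega> - W s \<omega>"

lemma filtration_measurable:
  "0 \<le> s \<Longrightarrow> Z \<in> measurable (F s) N \<Longrightarrow> Z \<in> measurable M N"
  using filtration measurable_from_subalg unfolding filtration_on_def by blast

lemma filtration_mono:
  "0 \<le> s \<Longrightarrow> s \<le> t \<Longrightarrow> Z \<in> measurable (F s) N \<Longrightarrow> Z \<in> measurable (F t) N"
  using filtration measurable_from_subalg unfolding filtration_on_def by blast

lemma space_F: "0 \<le> s \<Longrightarrow> space (F s) = space M"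
  using filtration unfolding filtration_on_def subalgebra_def by blast

lemma W_measurable: "0 \<le> t \<Longrightarrow> W t \<in> borel_measurable (F t)"
  using brownian unfolding standard_brownian_motion_def adapted_to_def by blast

lemma W_measurable_M [measurable]: "0 \<le> t \<Longrightarrow> W t \<in> borel_measurable M"
  using W_measurable filtration_measurable by blast

lemma dW_measurable: "0 \<le> s \<Longrightarrow> s \<le> t \<Longrightarrow> dW s t \<in> borel_measurable (F t)"
  unfolding dW_def using W_measurable filtration_mono[OF _ _ W_measurable, of s t]
  by (intro borel_measurable_diff) auto

lemma dW_measurable_M [measurable]:
  "0 \<le> s \<Longrightarrow> 0 \<le> t \<Longrightarrow> dW s t \<in> borel_measurable M"
  unfolding dW_def by measurable

lemma dW_distributed:
  "0 \<le> s \<Longrightarrow> s < t \<Longrightarrow> distributed M lborel (dW s t) (normal_density 0 (sqrt (t - s)))"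
  using brownian unfolding standard_brownian_motion_def dW_def by blast

lemma indep_set_dW:
  assumes "0 \<le> s" "s < t"
  shows "indep_set (sets (F s)) (sets (vimage_algebra (space M) (dW s t) borel))"
  using brownian assms unfolding standard_brownian_motion_def dW_def by blast

lemma indep_var_dW:
  fixes Z :: "'a \<Rightarrow> real"
  assumes st: "0 \<le> s" "s < t"
    and Z: "Z \<in> borel_measurable (F s)" and \<phi>: "\<phi> \<in> borel_measurable borel"
  shows "indep_var borel Z borel (\<lambda>\<omega>. \<phi> (dW s t \<omega>))"
proof -
  have 1: "sigma_sets (space M) {Z -` A \<inter> space M | A. A \<in> sets borel} \<subseteq> sets (F s)"
    using measurable_sets[OF Z]
    by (subst (1 2) space_F[OF st(1), symmetric]) (auto intro!: sets.sigma_sets_subset)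
  have 2: "sigma_sets (space M) {dW s t -` A \<inter> space M | A. A \<in> sets borel}
      \<subseteq> sets (vimage_algebra (space M) (dW s t) borel)"
    by (subst sets_vimage_algebra) auto
  have "indep_set (sigma_sets (space M) {Z -` A \<inter> space M | A. A \<in> sets borel})
     (sigma_sets (space M) {dW s t -` A \<inter> space M | A. A \<in> sets borel})"
    using indep_set_dW[OF st] unfolding indep_set_def
    by (rule indep_sets_mono_sets) (use 1 2 in \<open>auto split: bool.split\<close>)
  then have "indep_var borel Z borel (dW s t)"
    unfolding indep_var_eq using st filtration_measurable[OF st(1) Z] by auto
  from indep_var_compose[OF this measurable_ident \<phi>] show ?thesis
    by (simp add: comp_def id_def)
qed

text \<open>The sample point itself is taken as a random element of \<open>F s\<close>, so
  independence of \<open>F s\<close> and the increment becomes a product law, to be checked on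
  rectangles.\<close>

lemma distr_pair_dW:
  assumes st: "0 \<le> s" "s < t"
  shows "distr M (F s) (\<lambda>\<omega>. \<omega>) \<Otimes>\<^sub>M distr M borel (dW s t) =
    distr M (F s \<Otimes>\<^sub>M borel) (\<lambda>\<omega>. (\<omega>, dW s t \<omega>))"
proof -
  have id [measurable]: "(\<lambda>\<omega>. \<omega>) \<in> measurable M (F s)"
    using filtration_measurable[OF st(1) measurable_ident] by (simp add: id_def)
  have dw [measurable]: "dW s t \<in> borel_measurable M"
    using st by auto
  interpret P: prob_space "distr M (F s) (\<lambda>\<omega>. \<omega>)"
    using id by (rule prob_space_distr)
  interpret Q: prob_space "distr M borel (dW s t)"
    using dw by (rule prob_space_distr)
  show ?thesis
  proof (rule pair_measure_eqI)
    fix A B assume A: "A \<in> sets (distr M (F s) (\<lambda>\<omega>. \<omega>))" and B: "B \<in> sets (distr M borel (dW s t))"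
    have A': "A \<in> sets (F s)" "A \<inter> space M = A"
      using A sets.sets_into_space[of A "F s"] st by (auto simp: space_F)
    have "dW s t -` B \<inter> space M \<in> sets (vimage_algebra (space M) (dW s t) borel)"
      using B by (auto simp: sets_vimage_algebra)
    then have "prob (A \<inter> (dW s t -` B \<inter> space M)) = prob A * prob (dW s t -` B \<inter> space M)"
      using A' indep_set_dW[OF st] by (intro indep_setD) auto
    moreover have "(\<lambda>\<omega>. (\<omega>, dW s t \<omega>)) -` (A \<times> B) \<inter> space M = A \<inter> (dW s t -` B \<inter> space M)"
      using A' by auto
    ultimately show "emeasure (distr M (F s) (\<lambda>\<omega>. \<omega>)) A * emeasure (distr M borel (dW s t)) B =
        emeasure (distr M (F s \<Otimes>\<^sub>M borel) (\<lambda>\<omega>. (\<omega>, dW s t \<omega>))) (A \<times> B)"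
      using A B A' by (simp add: emeasure_distr emeasure_eq_measure ennreal_mult')
  qed (auto simp: P.sigma_finite_measure_axioms Q.sigma_finite_measure_axioms intro!: sets_pair_measure_cong)
qed

text \<open>Fubini for this product law plays the role of conditioning on \<open>F s\<close>: the
  past is frozen and the Gaussian increment is integrated out.\<close>

lemma expectation_freeze:
  fixes g :: "'a \<times> real \<Rightarrow> complex"
  assumes st: "0 \<le> s" "s < t"
    and g: "g \<in> borel_measurable (F s \<Otimes>\<^sub>M borel)" and B: "\<And>p. norm (g p) \<le> B"
  shows "expectation (\<lambda>\<omega>. g (\<omega>, dW s t \<omega>)) =
    expectation (\<lambda>\<omega>. \<integral>w. g (\<omega>, w) \<partial>normal_distribution 0 (t - s))"
proof -
  have id: "(\<lambda>\<omega>. \<omega>) \<in> measurable M (F s)"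
    using filtration_measurable[OF st(1) measurable_ident] by (simp add: id_def)
  have dw: "dW s t \<in> borel_measurable M"
    using st by auto
  interpret P: prob_space "distr M (F s) (\<lambda>\<omega>. \<omega>)"
    using id by (rule prob_space_distr)
  interpret Q: prob_space "distr M borel (dW s t)"
    using dw by (rule prob_space_distr)
  interpret PQ: pair_prob_space "distr M (F s) (\<lambda>\<omega>. \<omega>)" "distr M borel (dW s t)" ..
  have N: "distr M borel (dW s t) = normal_distribution 0 (t - s)"
    using dW_distributed[OF st] distr_cong[OF refl sets_lborel refl, of M "dW s t"]
    unfolding distributed_def normal_distribution_def by simp
  note eq = distr_pair_dW[OF st]
  have int: "integrable (distr M (F s) (\<lambda>\<omega>. \<omega>) \<Otimes>\<^sub>M distr M borel (dW s t)) g"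
    by (rule PQ.integrable_const_bound[of _ B]) (use g B in auto)
  have "expectation (\<lambda>\<omega>. g (\<omega>, dW s t \<omega>)) =
      integral\<^sup>L (distr M (F s) (\<lambda>\<omega>. \<omega>) \<Otimes>\<^sub>M distr M borel (dW s t)) g"
    unfolding eq using id dw g by (subst integral_distr) auto
  also have "\<dots> = (\<integral>\<omega>. \<integral>w. g (\<omega>, w) \<partial>distr M borel (dW s t) \<partial>distr M (F s) (\<lambda>\<omega>. \<omega>))"
    by (rule PQ.integral_fst'[OF int, symmetric])
  also have "\<dots> = expectation (\<lambda>\<omega>. \<integral>w. g (\<omega>, w) \<partial>distr M borel (dW s t))"
    using id g by (subst integral_distr) (auto intro!: Q.borel_measurable_lebesgue_integral simp: split_beta')
  finally show ?thesis
    unfolding N .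
qed

text \<open>The increments of the exponential martingale of \<open>\<integral> H dW\<close> with \<open>H\<close> constant on \<open>[s, t]\<close>.\<close>

lemma exponential_martingale_step:
  assumes st: "0 \<le> s" "s \<le> t"
    and Z: "Z \<in> borel_measurable (F s)" and B: "\<And>\<omega>. norm (Z \<omega>) \<le> B"
    and H: "H \<in> borel_measurable (F s)" and C: "\<And>\<omega>. \<bar>H \<omega>\<bar> \<le> C"
  shows "expectation (\<lambda>\<omega>. Z \<omega> * exp (\<i> * of_real (\<kappa> * H \<omega> * dW s t \<omega>) +
      of_real (\<kappa>\<^sup>2 / 2 * (H \<omega>)\<^sup>2 * (t - s)))) = expectation Z"
proof (cases "s = t")
  case True
  then show ?thesis by (simp add: dW_def)
next
  case False
  then have st': "0 \<le> s" "s < t" using st by auto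
  define c where "c = (\<lambda>\<omega>. exp (complex_of_real (\<kappa>\<^sup>2 / 2 * (H \<omega>)\<^sup>2 * (t - s))))"
  \<comment> \<open>With the past frozen, only the last factor depends on the increment; its mean is
    the Gaussian characteristic function at \<open>\<kappa> * H \<omega>\<close>, which the
    compensator \<open>c \<omega>\<close> cancels.\<close>
  define g where "g = (\<lambda>(\<omega>, w). (Z \<omega> * c \<omega>) * iexp (\<kappa> * H \<omega> * w))"
  have g: "g \<in> borel_measurable (F s \<Otimes>\<^sub>M borel)"
    using Z H unfolding g_def c_def by measurable
  have "norm (g p) \<le> B * exp (\<kappa>\<^sup>2 / 2 * C\<^sup>2 * (t - s))" for p
  proof -
    obtain \<omega> w where p: "p = (\<omega>, w)" by force
    have "(H \<omega>)\<^sup>2 \<le> C\<^sup>2"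
      using C[of \<omega>] by (simp add: abs_le_square_iff[symmetric])
    then have "norm (c \<omega>) \<le> exp (\<kappa>\<^sup>2 / 2 * C\<^sup>2 * (t - s))"
      unfolding c_def using st by (auto intro!: mult_right_mono mult_left_mono)
    moreover have "norm (g p) = norm (Z \<omega>) * norm (c \<omega>)"
      by (simp add: g_def p norm_mult)
    moreover have "0 \<le> B"
      using norm_ge_zero[of "Z undefined"] B[of undefined] by linarith
    ultimately show ?thesis
      using B[of \<omega>] by (auto intro!: mult_mono)
  qed
  then have "expectation (\<lambda>\<omega>. g (\<omega>, dW s t \<omega>)) =
      expectation (\<lambda>\<omega>. \<integral>w. g (\<omega>, w) \<partial>normal_distribution 0 (t - s))"
    by (rule expectation_freeze[OF st' g])
  also have "(\<lambda>\<omega>. \<integral>w. g (\<omega>, w) \<partial>normal_distribution 0 (t - s)) = Z"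
  proof
    fix \<omega>
    have "(\<integral>w. g (\<omega>, w) \<partial>normal_distribution 0 (t - s)) =
        Z \<omega> * c \<omega> * char (normal_distribution 0 (t - s)) (\<kappa> * H \<omega>)"
      by (simp add: g_def char_def)
    also have "\<dots> = Z \<omega> * (c \<omega> * exp (complex_of_real (- (\<kappa>\<^sup>2 / 2 * (H \<omega>)\<^sup>2 * (t - s)))))"
      using st' by (simp add: char_normal_distribution power_mult_distrib exp_of_real mult.assoc flip: exp_of_real)
    also have "c \<omega> * exp (complex_of_real (- (\<kappa>\<^sup>2 / 2 * (H \<omega>)\<^sup>2 * (t - s)))) = 1"
      unfolding c_def exp_add[symmetric] by simp
    finally have "(\<integral>w. g (\<omega>, w) \<partial>normal_distribution 0 (t - s)) = Z \<omega> * 1" .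
    then show "(\<integral>w. g (\<omega>, w) \<partial>normal_distribution 0 (t - s)) = Z \<omega>" by simp
  qed
  finally show ?thesis
    by (simp add: g_def c_def exp_add mult.assoc mult.commute mult.left_commute)
qed

section \<open>Moments and covariances of Brownian increments\<close>

lemma dW_power_has_integral:
  assumes st: "0 \<le> s" "s \<le> t"
  shows "has_bochner_integral M (\<lambda>\<omega>. dW s t \<omega> ^ (2 * k)) (fact (2 * k) / (2 ^ k * fact k) * (t - s) ^ k)"
    and "has_bochner_integral M (\<lambda>\<omega>. dW s t \<omega> ^ (2 * k + 1)) 0"
proof -
  have *: "has_bochner_integral M (\<lambda>\<omega>. dW s t \<omega> ^ (2 * k)) (fact (2 * k) / (2 ^ k * fact k) * (t - s) ^ k) \<and>
    has_bochner_integral M (\<lambda>\<omega>. dW s t \<omega> ^ (2 * k + 1)) 0"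
  proof (cases "s = t")
    \<comment> \<open>A vanishing increment is treated apart, because the Gaussian law is assumed
      only for \<open>s < t\<close>; its power with exponent 0 is still 1.\<close>
    case True
    have "has_bochner_integral M (\<lambda>\<omega>. 1::real) 1" "has_bochner_integral M (\<lambda>\<omega>. 0::real) 0"
      using prob_space by (auto simp: has_bochner_integral_iff)
    then show ?thesis
      using True by (cases "k = 0") (simp_all add: dW_def power_0_left)
  next
    case False
    then have st': "0 \<le> s" "s < t" using st by auto
    have d: "density lborel (\<lambda>x. ennreal (normal_density 0 (sqrt (t - s)) x)) = distr M lborel (dW s t)"
      using dW_distributed[OF st'] by (simp add: distributed_def)
    have m: "has_bochner_integral M (\<lambda>\<omega>. dW s t \<omega> ^ j) c"
      if "has_bochner_integral lborel (\<lambda>x. normal_density 0 (sqrt (t - s)) x * x ^ j) c" for j c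
    proof -
      have "has_bochner_integral (distr M lborel (dW s t)) (\<lambda>x. x ^ j) c"
        unfolding d[symmetric] using that
        by (intro has_bochner_integral_density) auto
      then show ?thesis
        using st' integrable_distr_eq[of "dW s t" M lborel "\<lambda>x. x ^ j"]
          integral_distr[of "dW s t" M lborel "\<lambda>x. x ^ j"]
        by (simp add: has_bochner_integral_iff)
    qed
    have "0 < sqrt (t - s)" using st' by simp
    from normal_moment_even[OF this, of 0 k] normal_moment_odd[OF this, of 0 k]
    show ?thesis
      using st' by (intro conjI m) (auto simp: power_divide field_simps)
  qed
  show "has_bochner_integral M (\<lambda>\<omega>. dW s t \<omega> ^ (2 * k)) (fact (2 * k) / (2 ^ k * fact k) * (t - s) ^ k)"
    "has_bochner_integral M (\<lambda>\<omega>. dW s t \<omega> ^ (2 * k + 1)) 0"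
    using * by blast+
qed

text \<open>The last item is the variance of a squared Gaussian increment,
  \<open>3 h^2 - 2 h^2 + h^2 = 2 h^2\<close> with \<open>h = t - s\<close>; it governs the error in
  the quadratic variation.\<close>

lemma dW_moments:
  assumes "0 \<le> s" "s \<le> t"
  shows "integrable M (dW s t)" "expectation (dW s t) = 0"
    and "integrable M (\<lambda>\<omega>. (dW s t \<omega>)\<^sup>2)" "expectation (\<lambda>\<omega>. (dW s t \<omega>)\<^sup>2) = t - s"
    and "integrable M (\<lambda>\<omega>. ((dW s t \<omega>)\<^sup>2 - (t - s))\<^sup>2)"
    and "expectation (\<lambda>\<omega>. ((dW s t \<omega>)\<^sup>2 - (t - s))\<^sup>2) = 2 * (t - s)\<^sup>2"
proof -
  note m = dW_power_has_integral[OF assms]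
  show 1: "integrable M (dW s t)" "expectation (dW s t) = 0"
    using m(2)[of 0] by (auto simp: has_bochner_integral_iff)
  show 2: "integrable M (\<lambda>\<omega>. (dW s t \<omega>)\<^sup>2)" "expectation (\<lambda>\<omega>. (dW s t \<omega>)\<^sup>2) = t - s"
    using m(1)[of 1] by (auto simp: has_bochner_integral_iff)
  have 4: "integrable M (\<lambda>\<omega>. dW s t \<omega> ^ 4)" "expectation (\<lambda>\<omega>. dW s t \<omega> ^ 4) = 3 * (t - s)\<^sup>2"
    using m(1)[of 2] by (auto simp: has_bochner_integral_iff fact_numeral)
  have eq: "(\<lambda>\<omega>. ((dW s t \<omega>)\<^sup>2 - (t - s))\<^sup>2) =
      (\<lambda>\<omega>. dW s t \<omega> ^ 4 - 2 * (t - s) * (dW s t \<omega>)\<^sup>2 + (t - s)\<^sup>2)"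
    by (rule ext) (simp add: power2_eq_square power4_eq_xxxx algebra_simps)
  show "integrable M (\<lambda>\<omega>. ((dW s t \<omega>)\<^sup>2 - (t - s))\<^sup>2)"
    unfolding eq using 2 4 by (intro Bochner_Integration.integrable_add Bochner_Integration.integrable_diff) auto
  show "expectation (\<lambda>\<omega>. ((dW s t \<omega>)\<^sup>2 - (t - s))\<^sup>2) = 2 * (t - s)\<^sup>2"
    unfolding eq using 2 4 prob_space by (simp add: power2_eq_square)
qed

lemma expectation_mult_dW:
  fixes Z :: "'a \<Rightarrow> real"
  assumes st: "0 \<le> s" "s \<le> t" and Z: "Z \<in> borel_measurable (F s)" "integrable M Z"
    and \<phi>: "\<phi> \<in> borel_measurable borel" "integrable M (\<lambda>\<omega>. \<phi> (dW s t \<omega>))"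
  shows "integrable M (\<lambda>\<omega>. Z \<omega> * \<phi> (dW s t \<omega>))"
    and "expectation (\<lambda>\<omega>. Z \<omega> * \<phi> (dW s t \<omega>)) = expectation Z * expectation (\<lambda>\<omega>. \<phi> (dW s t \<omega>))"
proof -
  have *: "integrable M (\<lambda>\<omega>. Z \<omega> * \<phi> (dW s t \<omega>)) \<and>
    expectation (\<lambda>\<omega>. Z \<omega> * \<phi> (dW s t \<omega>)) = expectation Z * expectation (\<lambda>\<omega>. \<phi> (dW s t \<omega>))"
  proof (cases "s = t")
    case True
    then show ?thesis using Z prob_space by (simp add: dW_def)
  next
    case False
    then have "s < t" using st by simp
    from indep_var_dW[OF st(1) this Z(1) \<phi>(1)] show ?thesis
      using Z \<phi> indep_var_integrable indep_var_lebesgue_integral by blast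
  qed
  show "integrable M (\<lambda>\<omega>. Z \<omega> * \<phi> (dW s t \<omega>))"
    "expectation (\<lambda>\<omega>. Z \<omega> * \<phi> (dW s t \<omega>)) = expectation Z * expectation (\<lambda>\<omega>. \<phi> (dW s t \<omega>))"
    using * by blast+
qed

lemma expectation_mult_dW1:
  fixes Z :: "'a \<Rightarrow> real"
  assumes "0 \<le> s" "s \<le> t" "Z \<in> borel_measurable (F s)" "integrable M Z"
  shows "integrable M (\<lambda>\<omega>. Z \<omega> * dW s t \<omega>)" "expectation (\<lambda>\<omega>. Z \<omega> * dW s t \<omega>) = 0"
  using expectation_mult_dW[OF assms, of "\<lambda>x. x"] dW_moments[OF assms(1,2)] by auto

lemma integrable_mult_dW_dW:
  fixes Z :: "'a \<Rightarrow> real"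
  assumes "0 \<le> a" "a \<le> b" "0 \<le> c" "c \<le> d" and Z: "Z \<in> borel_measurable M" "\<And>\<omega>. \<bar>Z \<omega>\<bar> \<le> C"
  shows "integrable M (\<lambda>\<omega>. Z \<omega> * dW a b \<omega> * dW c d \<omega>)"
proof -
  have "integrable M (\<lambda>\<omega>. dW a b \<omega> * dW c d \<omega>)"
    using assms dW_moments by (intro integrable_mult_square) auto
  then have "integrable M (\<lambda>\<omega>. C * (dW a b \<omega> * dW c d \<omega>))" by simp
  then show ?thesis
  proof (rule Bochner_Integration.integrable_bound)
    have "\<bar>Z \<omega>\<bar> * \<bar>dW a b \<omega> * dW c d \<omega>\<bar> \<le> \<bar>C\<bar> * \<bar>dW a b \<omega> * dW c d \<omega>\<bar>" for \<omega>
      using Z(2)[of \<omega>] by (intro mult_right_mono) auto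
    then show "AE \<omega> in M. norm (Z \<omega> * dW a b \<omega> * dW c d \<omega>) \<le> norm (C * (dW a b \<omega> * dW c d \<omega>))"
      by (simp add: abs_mult mult.assoc)
  qed (use assms in auto)
qed

text \<open>\<open>Z * dW a b\<close> is known at time \<open>c\<close>, and the later increment is
  independent of \<open>F c\<close> with mean 0.\<close>

lemma expectation_dW_dW_disjoint:
  fixes Z :: "'a \<Rightarrow> real"
  assumes abcd: "0 \<le> a" "a \<le> b" "b \<le> c" "c \<le> d"
    and Z: "Z \<in> borel_measurable (F c)" "\<And>\<omega>. \<bar>Z \<omega>\<bar> \<le> C"
  shows "expectation (\<lambda>\<omega>. Z \<omega> * dW a b \<omega> * dW c d \<omega>) = 0"
proof (rule expectation_mult_dW1(2))
  have c: "0 \<le> c" using abcd by simp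
  have "Z \<in> borel_measurable M" using filtration_measurable[OF c Z(1)] .
  then have "integrable M Z" using integrable_bounded Z by blast
  have Zi: "integrable M (\<lambda>\<omega>. (Z \<omega>)\<^sup>2)"
  proof (rule integrable_bounded[of _ "C\<^sup>2"])
    show "\<bar>(Z \<omega>)\<^sup>2\<bar> \<le> C\<^sup>2" for \<omega>
      using Z(2)[of \<omega>] by (simp add: abs_le_square_iff[symmetric])
  qed (use \<open>Z \<in> borel_measurable M\<close> in measurable)
  show "integrable M (\<lambda>\<omega>. Z \<omega> * dW a b \<omega>)"
    using \<open>Z \<in> borel_measurable M\<close> Zi abcd dW_moments by (intro integrable_mult_square) auto
  show "(\<lambda>\<omega>. Z \<omega> * dW a b \<omega>) \<in> borel_measurable (F c)"
    using Z filtration_mono[OF _ _ dW_measurable[of a b]] abcd by auto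
qed (use abcd in auto)

lemma expectation_dW_square:
  fixes Z :: "'a \<Rightarrow> real"
  assumes "0 \<le> s" "s \<le> t" and Z: "Z \<in> borel_measurable (F s)" "\<And>\<omega>. \<bar>Z \<omega>\<bar> \<le> C"
  shows "expectation (\<lambda>\<omega>. Z \<omega> * dW s t \<omega> * dW s t \<omega>) = expectation Z * (t - s)"
proof -
  have "integrable M Z"
    using integrable_bounded filtration_measurable[OF assms(1) Z(1)] Z(2) by blast
  from expectation_mult_dW(2)[OF assms(1-3) this, of "\<lambda>x. x\<^sup>2"] dW_moments(3,4)[OF assms(1,2)]
  show ?thesis by (simp add: power2_eq_square mult.assoc)
qed

text \<open>Both increments are cut at \<open>c\<close> and at \<open>m = min b d\<close>. Products
  of disjoint pieces have mean 0, and the common piece \<open>[c, m]\<close> contributes its length.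
  Since \<open>a \<le> c\<close>, the factor \<open>Z\<close> has to be known only at the later of
  the two left end points, as a product of two integrands is.\<close>

lemma expectation_overlap_aux:
  fixes Z :: "'a \<Rightarrow> real"
  assumes abcd: "0 \<le> a" "a \<le> b" "a \<le> c" "c \<le> d"
    and Z: "Z \<in> borel_measurable (F c)" and C: "\<And>\<omega>. \<bar>Z \<omega>\<bar> \<le> C"
  shows "expectation (\<lambda>\<omega>. Z \<omega> * dW a b \<omega> * dW c d \<omega>) = expectation Z * overlap a b c d"
proof (cases "b \<le> c")
  case True
  then show ?thesis
    using expectation_dW_dW_disjoint[OF abcd(1,2) True abcd(4) Z C] abcd
    by (simp add: overlap_def)
next
  case cb: False
  have ZF: "Z \<in> borel_measurable (F r)" if "c \<le> r" for r
    using filtration_mono[OF _ that Z] abcd by auto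
  have ZM: "Z \<in> borel_measurable M" using filtration_measurable[OF _ Z] abcd by auto
  note int = integrable_mult_dW_dW[OF _ _ _ _ ZM C]
  define m where "m = min b d"
  have m: "c \<le> m" "m \<le> b" "m \<le> d" using cb abcd by (auto simp: m_def)
  have "(\<lambda>\<omega>. Z \<omega> * dW a b \<omega> * dW c d \<omega>) = (\<lambda>\<omega>. Z \<omega> * dW a c \<omega> * dW c d \<omega> + Z \<omega> * dW c m \<omega> * dW c m \<omega>
     + Z \<omega> * dW c m \<omega> * dW m d \<omega> + Z \<omega> * dW m b \<omega> * dW c d \<omega>)"
    by (rule ext) (simp add: dW_def algebra_simps)
  moreover have "expectation (\<lambda>\<omega>. Z \<omega> * dW a c \<omega> * dW c d \<omega>) = 0"
    using abcd by (intro expectation_dW_dW_disjoint[OF _ _ _ _ Z C]) auto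
  moreover have "expectation (\<lambda>\<omega>. Z \<omega> * dW c m \<omega> * dW c m \<omega>) = expectation Z * (m - c)"
    using abcd m by (intro expectation_dW_square[OF _ _ Z C]) auto
  moreover have "expectation (\<lambda>\<omega>. Z \<omega> * dW c m \<omega> * dW m d \<omega>) = 0"
    using abcd m by (intro expectation_dW_dW_disjoint[OF _ _ _ _ _ C] ZF) auto
  \<comment> \<open>Either \<open>m = b\<close> and the first increment is 0, or
    \<open>m = d\<close> and it lies after \<open>[c, d]\<close>.\<close>
  moreover have "expectation (\<lambda>\<omega>. Z \<omega> * dW m b \<omega> * dW c d \<omega>) = 0"
  proof (cases "b \<le> d")
    case True
    then have "m = b" by (simp add: m_def)
    then show ?thesis by (simp add: dW_def)
  next
    case False
    then have "m = d" by (simp add: m_def)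
    then have "expectation (\<lambda>\<omega>. Z \<omega> * dW c d \<omega> * dW m b \<omega>) = 0"
      using abcd m by (intro expectation_dW_dW_disjoint[OF _ _ _ _ _ C] ZF) auto
    then show ?thesis by (simp add: mult.assoc mult.commute mult.left_commute)
  qed
  moreover have "overlap a b c d = m - c"
    using m abcd by (simp add: overlap_def m_def)
  ultimately show ?thesis
    using abcd m cb by (simp add: int)
qed

lemma expectation_overlap:
  fixes X Y :: "'a \<Rightarrow> real"
  assumes abcd: "0 \<le> a" "a \<le> b" "0 \<le> c" "c \<le> d"
    and X: "X \<in> borel_measurable (F a)" "\<And>\<omega>. \<bar>X \<omega>\<bar> \<le> C"
    and Y: "Y \<in> borel_measurable (F c)" "\<And>\<omega>. \<bar>Y \<omega>\<bar> \<le> C'"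
  shows "expectation (\<lambda>\<omega>. (X \<omega> * dW a b \<omega>) * (Y \<omega> * dW c d \<omega>)) =
    expectation (\<lambda>\<omega>. X \<omega> * Y \<omega>) * overlap a b c d"
proof -
  have bd: "\<bar>X \<omega> * Y \<omega>\<bar> \<le> C * C'" for \<omega>
    unfolding abs_mult using X(2)[of \<omega>] Y(2)[of \<omega>] by (intro mult_mono) auto
  show ?thesis
  proof (cases "a \<le> c")
    case True
    have "(\<lambda>\<omega>. X \<omega> * Y \<omega>) \<in> borel_measurable (F c)"
      using filtration_mono[OF abcd(1) True X(1)] Y by auto
    from expectation_overlap_aux[OF abcd(1,2) True abcd(4) this bd] show ?thesis
      by (simp add: mult.assoc mult.commute mult.left_commute)
  next
    case False
    then have ca: "c \<le> a" by simp
    have "(\<lambda>\<omega>. X \<omega> * Y \<omega>) \<in> borel_measurable (F a)"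
      using filtration_mono[OF abcd(3) ca Y(1)] X by auto
    from expectation_overlap_aux[OF abcd(3,4) ca abcd(2) this bd] show ?thesis
      by (simp add: mult.assoc mult.commute mult.left_commute overlap_commute)
  qed
qed

end

section \<open>The Ito integral of a bounded integrand\<close>

text \<open>The integrand is a parameter because the locale is used for \<open>f\<close>,
  \<open>g\<close>, \<open>g1\<close> and \<open>g2\<close> along the truncated process and for the
  constant 1. The bound holds everywhere, so moments exist without exceptional sets; only path
  continuity is almost sure.\<close>

locale bounded_integrand = brownian_filtration +
  fixes H :: "real \<Rightarrow> 'a \<Rightarrow> real" and C :: real
  assumes adapted: "\<And>t. 0 \<le> t \<Longrightarrow> H t \<in> borel_measurable (F t)"
    and bounded: "\<And>t \<omega>. \<bar>H t \<omega>\<bar> \<le> C"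
    and continuous_paths: "AE \<omega> in M. continuous_on {0..} (\<lambda>t. H t \<omega>)"
begin

lemma H_measurable [measurable]: "0 \<le> t \<Longrightarrow> H t \<in> borel_measurable M"
  using adapted filtration_measurable by blast

lemma C_nonneg: "0 \<le> C"
  using bounded[of 0 undefined] by linarith

lemma H_mult_bounded: "\<bar>H s \<omega> * H t \<omega>\<bar> \<le> C * C"
  unfolding abs_mult using bounded by (intro mult_mono C_nonneg) auto

lemma integrable_H_mult: "0 \<le> s \<Longrightarrow> 0 \<le> t \<Longrightarrow> integrable M (\<lambda>\<omega>. H s \<omega> * H t \<omega>)"
  by (rule integrable_bounded[OF _ H_mult_bounded]) measurable

abbreviation S :: "nat \<Rightarrow> (nat \<Rightarrow> real) \<Rightarrow> 'a \<Rightarrow> real"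
  where "S \<equiv> grid_sum H W"

lemma S_eq: "S n t \<omega> = (\<Sum>i<n. H (t i) \<omega> * dW (t i) (t (Suc i)) \<omega>)"
  by (simp add: grid_sum_def dW_def)

lemma S_measurable [measurable]: "grid T \<delta> n t \<Longrightarrow> S n t \<in> borel_measurable M"
  unfolding grid_sum_def by (intro borel_measurable_sum borel_measurable_times borel_measurable_diff)
    (auto simp: grid_range)

text \<open>Ito's isometry in polarised form and for two different grids; the overlaps are the
  covariances of all pairs of increments.\<close>

lemma S_mult:
  assumes t: "grid T \<delta> n t" and s: "grid T \<delta>' m s"
  shows "integrable M (\<lambda>\<omega>. S n t \<omega> * S m s \<omega>)"
    and "expectation (\<lambda>\<omega>. S n t \<omega> * S m s \<omega>) =
      (\<Sum>i<n. \<Sum>j<m. expectation (\<lambda>\<omega>. H (t i) \<omega> * H (s j) \<omega>) * overlap (t i) (t (Suc i)) (s j) (s (Suc j)))"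
proof -
  have eq: "(\<lambda>\<omega>. S n t \<omega> * S m s \<omega>) = (\<lambda>\<omega>. \<Sum>i<n. \<Sum>j<m.
      (H (t i) \<omega> * dW (t i) (t (Suc i)) \<omega>) * (H (s j) \<omega> * dW (s j) (s (Suc j)) \<omega>))"
    by (rule ext) (simp add: S_eq sum_product)
  have int: "integrable M (\<lambda>\<omega>. (H (t i) \<omega> * dW (t i) (t (Suc i)) \<omega>) * (H (s j) \<omega> * dW (s j) (s (Suc j)) \<omega>))"
    if "i < n" "j < m" for i j
  proof -
    have "integrable M (\<lambda>\<omega>. (H (t i) \<omega> * H (s j) \<omega>) * dW (t i) (t (Suc i)) \<omega> * dW (s j) (s (Suc j)) \<omega>)"
      using that grid_range[OF t] grid_range[OF s] grid_step[OF t] grid_step[OF s]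
      by (intro integrable_mult_dW_dW[OF _ _ _ _ _ H_mult_bounded]) auto
    then show ?thesis by (simp add: mult.assoc mult.commute mult.left_commute)
  qed
  show "integrable M (\<lambda>\<omega>. S n t \<omega> * S m s \<omega>)"
    unfolding eq using int by (intro Bochner_Integration.integrable_sum) auto
  have "expectation (\<lambda>\<omega>. (H (t i) \<omega> * dW (t i) (t (Suc i)) \<omega>) * (H (s j) \<omega> * dW (s j) (s (Suc j)) \<omega>)) =
      expectation (\<lambda>\<omega>. H (t i) \<omega> * H (s j) \<omega>) * overlap (t i) (t (Suc i)) (s j) (s (Suc j))"
    if "i < n" "j < m" for i j
    using that grid_range[OF t] grid_range[OF s] grid_step[OF t] grid_step[OF s]
    by (intro expectation_overlap[OF _ _ _ _ adapted bounded adapted bounded]) auto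
  note ov = this
  have "expectation (\<lambda>\<omega>. S n t \<omega> * S m s \<omega>) = (\<Sum>i<n. expectation (\<lambda>\<omega>. \<Sum>j<m.
      (H (t i) \<omega> * dW (t i) (t (Suc i)) \<omega>) * (H (s j) \<omega> * dW (s j) (s (Suc j)) \<omega>)))"
    unfolding eq using int
    by (intro Bochner_Integration.integral_sum Bochner_Integration.integrable_sum) auto
  also have "\<dots> = (\<Sum>i<n. \<Sum>j<m. expectation (\<lambda>\<omega>.
      (H (t i) \<omega> * dW (t i) (t (Suc i)) \<omega>) * (H (s j) \<omega> * dW (s j) (s (Suc j)) \<omega>)))"
    using int by (intro sum.cong refl Bochner_Integration.integral_sum) auto
  finally show "expectation (\<lambda>\<omega>. S n t \<omega> * S m s \<omega>) =
      (\<Sum>i<n. \<Sum>j<m. expectation (\<lambda>\<omega>. H (t i) \<omega> * H (s j) \<omega>) * overlap (t i) (t (Suc i)) (s j) (s (Suc j)))"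
    using ov by simp
qed

lemma S_square:
  assumes t: "grid T \<delta> n t"
  shows "integrable M (\<lambda>\<omega>. (S n t \<omega>)\<^sup>2)"
    and "expectation (\<lambda>\<omega>. (S n t \<omega>)\<^sup>2) = (\<Sum>i<n. expectation (\<lambda>\<omega>. H (t i) \<omega> * H (t i) \<omega>) * (t (Suc i) - t i))"
    and "expectation (\<lambda>\<omega>. (S n t \<omega>)\<^sup>2) \<le> C\<^sup>2 * T"
proof -
  show "integrable M (\<lambda>\<omega>. (S n t \<omega>)\<^sup>2)"
    using S_mult(1)[OF t t] by (simp add: power2_eq_square)
  show eq: "expectation (\<lambda>\<omega>. (S n t \<omega>)\<^sup>2) = (\<Sum>i<n. expectation (\<lambda>\<omega>. H (t i) \<omega> * H (t i) \<omega>) * (t (Suc i) - t i))"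
    using S_mult(2)[OF t t] sum_overlap_self[OF t, of _ "\<lambda>i k. expectation (\<lambda>\<omega>. H (t i) \<omega> * H (t k) \<omega>)"]
    by (simp add: power2_eq_square)
  also have "\<dots> \<le> (\<Sum>i<n. C\<^sup>2 * (t (Suc i) - t i))"
  proof (intro sum_mono mult_right_mono)
    fix i assume i: "i \<in> {..<n}"
    show "expectation (\<lambda>\<omega>. H (t i) \<omega> * H (t i) \<omega>) \<le> C\<^sup>2"
    proof (rule integral_le_const)
      show "AE \<omega> in M. H (t i) \<omega> * H (t i) \<omega> \<le> C\<^sup>2"
        using H_mult_bounded by (auto simp: power2_eq_square abs_le_iff)
    qed (use i grid_range[OF t] integrable_H_mult in auto)
    show "0 \<le> t (Suc i) - t i" using i grid_step[OF t] by auto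
  qed
  also have "\<dots> = C\<^sup>2 * T"
    using grid_sum_increments[OF t] by (simp add: sum_distrib_left[symmetric])
  finally show "expectation (\<lambda>\<omega>. (S n t \<omega>)\<^sup>2) \<le> C\<^sup>2 * T" .
qed

text \<open>The overlaps of a step with the other grid add up to its length, so the two diagonal
  isometry terms can be spread over the same double sum as the mixed term, and the square completes
  pair by pair.\<close>

lemma S_diff_square:
  assumes t: "grid T \<delta> n t" and s: "grid T \<delta>' m s"
  shows "integrable M (\<lambda>\<omega>. (S n t \<omega> - S m s \<omega>)\<^sup>2)"
    and "expectation (\<lambda>\<omega>. (S n t \<omega> - S m s \<omega>)\<^sup>2) = (\<Sum>i<n. \<Sum>j<m.
      expectation (\<lambda>\<omega>. (H (t i) \<omega> - H (s j) \<omega>)\<^sup>2) * overlap (t i) (t (Suc i)) (s j) (s (Suc j)))"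
proof -
  define e where "e a b = expectation (\<lambda>\<omega>. H a \<omega> * H b \<omega>)" for a b
  define ov where "ov i j = overlap (t i) (t (Suc i)) (s j) (s (Suc j))" for i j
  have eq: "(\<lambda>\<omega>. (S n t \<omega> - S m s \<omega>)\<^sup>2) =
      (\<lambda>\<omega>. (S n t \<omega>)\<^sup>2 + (S m s \<omega>)\<^sup>2 - 2 * (S n t \<omega> * S m s \<omega>))"
    by (rule ext) (simp add: power2_eq_square algebra_simps)
  show "integrable M (\<lambda>\<omega>. (S n t \<omega> - S m s \<omega>)\<^sup>2)"
    unfolding eq using S_mult(1)[OF t s] S_square(1)[OF t] S_square(1)[OF s] by simp
  have e: "expectation (\<lambda>\<omega>. (H a \<omega> - H b \<omega>)\<^sup>2) = e a a + e b b - 2 * e a b" if "0 \<le> a" "0 \<le> b" for a b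
  proof -
    have "(\<lambda>\<omega>. (H a \<omega> - H b \<omega>)\<^sup>2) = (\<lambda>\<omega>. H a \<omega> * H a \<omega> + H b \<omega> * H b \<omega> - 2 * (H a \<omega> * H b \<omega>))"
      by (rule ext) (simp add: power2_eq_square algebra_simps)
    then show ?thesis
      using that integrable_H_mult by (simp add: e_def)
  qed
  have 1: "(\<Sum>i<n. e (t i) (t i) * (t (Suc i) - t i)) = (\<Sum>i<n. \<Sum>j<m. e (t i) (t i) * ov i j)"
    using sum_overlap[OF s] grid_range[OF t] grid_step[OF t]
    by (intro sum.cong refl) (simp add: sum_distrib_left[symmetric] ov_def)
  have "(\<Sum>j<m. e (s j) (s j) * (s (Suc j) - s j)) = (\<Sum>j<m. \<Sum>i<n. e (s j) (s j) * ov i j)"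
    using sum_overlap[OF t] grid_range[OF s] grid_step[OF s]
    by (intro sum.cong refl) (simp add: sum_distrib_left[symmetric] ov_def overlap_commute[of "t _"])
  also have "\<dots> = (\<Sum>i<n. \<Sum>j<m. e (s j) (s j) * ov i j)"
    by (rule sum.swap)
  finally have 2: "(\<Sum>j<m. e (s j) (s j) * (s (Suc j) - s j)) = (\<Sum>i<n. \<Sum>j<m. e (s j) (s j) * ov i j)" .
  have "expectation (\<lambda>\<omega>. (S n t \<omega> - S m s \<omega>)\<^sup>2) =
      (\<Sum>i<n. \<Sum>j<m. e (t i) (t i) * ov i j) + (\<Sum>i<n. \<Sum>j<m. e (s j) (s j) * ov i j)
      - 2 * (\<Sum>i<n. \<Sum>j<m. e (t i) (s j) * ov i j)"
    unfolding eq 1[symmetric] 2[symmetric]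
    using S_mult[OF t s] S_square[OF t] S_square[OF s] by (simp add: e_def ov_def)
  also have "\<dots> = (\<Sum>i<n. \<Sum>j<m. (e (t i) (t i) + e (s j) (s j) - 2 * e (t i) (s j)) * ov i j)"
    by (simp add: sum.distrib sum_subtractf sum_distrib_left algebra_simps)
  also have "\<dots> = (\<Sum>i<n. \<Sum>j<m. expectation (\<lambda>\<omega>. (H (t i) \<omega> - H (s j) \<omega>)\<^sup>2) * ov i j)"
    using grid_range[OF t] grid_range[OF s] by (intro sum.cong refl) (simp add: e)
  finally show "expectation (\<lambda>\<omega>. (S n t \<omega> - S m s \<omega>)\<^sup>2) = (\<Sum>i<n. \<Sum>j<m.
      expectation (\<lambda>\<omega>. (H (t i) \<omega> - H (s j) \<omega>)\<^sup>2) * overlap (t i) (t (Suc i)) (s j) (s (Suc j)))"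
    by (simp add: ov_def)
qed

text \<open>Paths are uniformly continuous with a random modulus. Along a sequence of
  counterexamples this is harmless: the pathwise differences tend to 0, and dominated convergence
  applies with the bound \<open>(2 * C)\<^sup>2\<close>.\<close>

lemma mean_square_continuous:
  assumes "0 < \<epsilon>"
  shows "\<exists>\<delta>>0. \<forall>s\<in>{0..T}. \<forall>t\<in>{0..T}. \<bar>s - t\<bar> < \<delta> \<longrightarrow> expectation (\<lambda>\<omega>. (H s \<omega> - H t \<omega>)\<^sup>2) \<le> \<epsilon>"
proof (rule ccontr)
  assume "\<not> ?thesis"
  then have "\<forall>n. \<exists>s t. s \<in> {0..T} \<and> t \<in> {0..T} \<and> \<bar>s - t\<bar> < inverse (real (Suc n)) \<and>
      \<not> expectation (\<lambda>\<omega>. (H s \<omega> - H t \<omega>)\<^sup>2) \<le> \<epsilon>"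
    by (metis inverse_positive_iff_positive of_nat_0_less_iff zero_less_Suc)
  then obtain s t where st: "\<And>n. s n \<in> {0..T}" "\<And>n. t n \<in> {0..T}"
      "\<And>n. \<bar>s n - t n\<bar> < inverse (real (Suc n))"
    and big: "\<And>n. \<epsilon> < expectation (\<lambda>\<omega>. (H (s n) \<omega> - H (t n) \<omega>)\<^sup>2)"
    unfolding not_le by metis
  have d0: "(\<lambda>n. dist (s n) (t n)) \<longlonglongrightarrow> 0"
  proof (rule tendsto_sandwich[OF _ _ tendsto_const LIMSEQ_inverse_real_of_nat])
    show "\<forall>\<^sub>F n in sequentially. dist (s n) (t n) \<le> inverse (real (Suc n))"
      using st(3) by (intro always_eventually) (auto simp: dist_real_def less_imp_le)
  qed auto
  have "(\<lambda>n. expectation (\<lambda>\<omega>. (H (s n) \<omega> - H (t n) \<omega>)\<^sup>2)) \<longlonglongrightarrow> expectation (\<lambda>\<omega>. 0)"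
  proof (rule integral_dominated_convergence[where w="\<lambda>_. (2 * C)\<^sup>2"])
    show "AE \<omega> in M. (\<lambda>n. (H (s n) \<omega> - H (t n) \<omega>)\<^sup>2) \<longlonglongrightarrow> 0"
      using continuous_paths
    proof eventually_elim
      case (elim \<omega>)
      have "uniformly_continuous_on {0..T} (\<lambda>t. H t \<omega>)"
        by (rule compact_uniformly_continuous) (auto intro: continuous_on_subset[OF elim])
      then have "(\<lambda>n. dist (H (s n) \<omega>) (H (t n) \<omega>)) \<longlonglongrightarrow> 0"
        using st d0 unfolding uniformly_continuous_on_sequentially by blast
      then have "(\<lambda>n. (dist (H (s n) \<omega>) (H (t n) \<omega>))\<^sup>2) \<longlonglongrightarrow> 0\<^sup>2"
        by (intro tendsto_power)
      then show ?case by (simp add: dist_real_def)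
    qed
    have "\<bar>H (s n) \<omega> - H (t n) \<omega>\<bar> \<le> \<bar>2 * C\<bar>" for n \<omega>
      using bounded[of "s n" \<omega>] bounded[of "t n" \<omega>] by linarith
    then show "AE \<omega> in M. norm ((H (s n) \<omega> - H (t n) \<omega>)\<^sup>2) \<le> (2 * C)\<^sup>2" for n
      by (simp add: abs_le_square_iff)
  qed (use st in auto)
  then have "\<forall>\<^sub>F n in sequentially. expectation (\<lambda>\<omega>. (H (s n) \<omega> - H (t n) \<omega>)\<^sup>2) < \<epsilon>"
    using \<open>0 < \<epsilon>\<close> by (simp add: order_tendsto_iff)
  then show False
    using big by (auto simp: eventually_sequentially not_less[symmetric] dest: less_asym)
qed

text \<open>Only overlapping pairs of steps count, and their left end points are less than
  \<open>\<delta>\<close> apart. All overlaps add up to \<open>T\<close>, so a mean-square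
  oscillation of at most \<open>\<epsilon> / T\<close> suffices.\<close>

lemma S_Cauchy:
  assumes \<epsilon>: "0 < \<epsilon>" and T: "0 < T"
  shows "\<exists>\<delta>>0. \<forall>n t m s. grid T \<delta> n t \<and> grid T \<delta> m s \<longrightarrow> expectation (\<lambda>\<omega>. (S n t \<omega> - S m s \<omega>)\<^sup>2) \<le> \<epsilon>"
proof -
  obtain \<delta> where \<delta>: "\<delta> > 0" and small: "\<And>s t. s \<in> {0..T} \<Longrightarrow> t \<in> {0..T} \<Longrightarrow> \<bar>s - t\<bar> < \<delta> \<Longrightarrow>
      expectation (\<lambda>\<omega>. (H s \<omega> - H t \<omega>)\<^sup>2) \<le> \<epsilon> / T"
    using mean_square_continuous[of "\<epsilon> / T" T] \<epsilon> T by auto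
  have "expectation (\<lambda>\<omega>. (S n t \<omega> - S m s \<omega>)\<^sup>2) \<le> \<epsilon>" if t: "grid T \<delta> n t" and s: "grid T \<delta> m s" for n t m s
  proof -
    have "expectation (\<lambda>\<omega>. (S n t \<omega> - S m s \<omega>)\<^sup>2) = (\<Sum>i<n. \<Sum>j<m.
        expectation (\<lambda>\<omega>. (H (t i) \<omega> - H (s j) \<omega>)\<^sup>2) * overlap (t i) (t (Suc i)) (s j) (s (Suc j)))"
      by (rule S_diff_square[OF t s])
    also have "\<dots> \<le> (\<Sum>i<n. \<Sum>j<m. \<epsilon> / T * overlap (t i) (t (Suc i)) (s j) (s (Suc j)))"
    proof (intro sum_mono)
      fix i j assume ij: "i \<in> {..<n}" "j \<in> {..<m}"
      show "expectation (\<lambda>\<omega>. (H (t i) \<omega> - H (s j) \<omega>)\<^sup>2) * overlap (t i) (t (Suc i)) (s j) (s (Suc j))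
          \<le> \<epsilon> / T * overlap (t i) (t (Suc i)) (s j) (s (Suc j))"
      proof (cases "overlap (t i) (t (Suc i)) (s j) (s (Suc j)) = 0")
        case False
        have "\<bar>t i - s j\<bar> < \<delta>"
          using ij grid_step[OF t] grid_step[OF s] by (intro overlap_pos_imp_close[OF False]) auto
        then show ?thesis
          using ij grid_range[OF t] grid_range[OF s] by (intro mult_right_mono small overlap_nonneg) auto
      qed simp
    qed
    also have "\<dots> = (\<Sum>i<n. \<epsilon> / T * (t (Suc i) - t i))"
      using sum_overlap[OF s] grid_range[OF t] grid_step[OF t]
      by (intro sum.cong refl) (simp add: sum_distrib_left[symmetric] del: times_divide_eq_left)
    also have "\<dots> = \<epsilon>"
      using grid_sum_increments[OF t] T
      by (simp only: sum_distrib_left[symmetric]) simp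
    finally show ?thesis .
  qed
  with \<delta> show ?thesis by blast
qed

text \<open>The limit is constructed from uniform grids, but the Cauchy estimate compares arbitrary
  ones; letting one of the two grids run through the subsequence and applying Fatou extends the
  convergence to all fine grids.\<close>

lemma mean_square_integral_exists:
  assumes T: "0 < T"
  obtains I where "mean_square_integral M H W T I"
proof -
  define u where "u n = uniform_grid T (Suc n)" for n
  have ug: "grid T (2 * T / real (Suc n)) (Suc n) (u n)" for n
    unfolding u_def by (rule grid_uniform_grid_Suc[OF T])
  have eg: "\<forall>\<^sub>F n in sequentially. grid T \<delta> (Suc n) (u n)" if "0 < \<delta>" for \<delta>
    unfolding u_def by (rule eventually_grid_uniform_grid_Suc[OF T that])
  have "\<exists>J r. strict_mono r \<and> J \<in> borel_measurable M \<and>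
      (AE \<omega> in M. (\<lambda>k. S (Suc (r k)) (u (r k)) \<omega>) \<longlonglongrightarrow> J \<omega>)"
  proof (rule L2_Cauchy_AE_subseq[of "\<lambda>n. S (Suc n) (u n)"])
    fix \<epsilon> :: real assume "0 < \<epsilon>"
    then obtain \<delta> where "\<delta> > 0" and \<delta>: "\<And>n t m s. grid T \<delta> n t \<Longrightarrow> grid T \<delta> m s \<Longrightarrow>
        expectation (\<lambda>\<omega>. (S n t \<omega> - S m s \<omega>)\<^sup>2) \<le> \<epsilon>"
      using S_Cauchy T by metis
    from eg[OF \<open>\<delta> > 0\<close>] obtain N where "\<And>n. n \<ge> N \<Longrightarrow> grid T \<delta> (Suc n) (u n)"
      by (auto simp: eventually_sequentially)
    then show "\<exists>N. \<forall>m\<ge>N. \<forall>n\<ge>N. expectation (\<lambda>\<omega>. (S (Suc m) (u m) \<omega> - S (Suc n) (u n) \<omega>)\<^sup>2) \<le> \<epsilon>"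
      using \<delta> by blast
  qed (use S_measurable[OF ug] S_square(1)[OF ug] in auto)
  then obtain I r where r: "strict_mono r" and I [measurable]: "I \<in> borel_measurable M"
    and lim: "AE \<omega> in M. (\<lambda>k. S (Suc (r k)) (u (r k)) \<omega>) \<longlonglongrightarrow> I \<omega>"
    by blast
  show ?thesis
  proof (rule that[of I], unfold mean_square_integral_def, intro conjI allI impI)
    show "I \<in> borel_measurable M" by (rule I)
    fix \<epsilon> :: real assume "0 < \<epsilon>"
    then obtain \<delta> where "\<delta> > 0" and \<delta>: "\<And>n t m s. grid T \<delta> n t \<Longrightarrow> grid T \<delta> m s \<Longrightarrow>
        expectation (\<lambda>\<omega>. (S n t \<omega> - S m s \<omega>)\<^sup>2) \<le> \<epsilon>"
      using S_Cauchy T by metis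
    have "integrable M (\<lambda>\<omega>. (S n t \<omega> - I \<omega>)\<^sup>2) \<and> expectation (\<lambda>\<omega>. (S n t \<omega> - I \<omega>)\<^sup>2) \<le> \<epsilon>"
      if t: "grid T \<delta> n t" for n t
    proof -
      note [measurable] = S_measurable[OF t] S_measurable[OF ug]
      have D: "(\<lambda>\<omega>. S n t \<omega> - S (Suc (r k)) (u (r k)) \<omega>) \<in> borel_measurable M" for k
        by measurable
      have D2: "integrable M (\<lambda>\<omega>. (S n t \<omega> - S (Suc (r k)) (u (r k)) \<omega>)\<^sup>2)" for k
        by (rule S_diff_square(1)[OF t ug])
      have l: "AE \<omega> in M. (\<lambda>k. S n t \<omega> - S (Suc (r k)) (u (r k)) \<omega>) \<longlonglongrightarrow> S n t \<omega> - I \<omega>"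
        using lim by eventually_elim (intro tendsto_intros)
      have "\<forall>\<^sub>F k in sequentially. grid T \<delta> (Suc (r k)) (u (r k))"
        using eventually_subseq[OF r eg[OF \<open>\<delta> > 0\<close>]] .
      then have "\<forall>\<^sub>F k in sequentially. expectation (\<lambda>\<omega>. (S n t \<omega> - S (Suc (r k)) (u (r k)) \<omega>)\<^sup>2) \<le> \<epsilon>"
        by eventually_elim (rule \<delta>[OF t])
      from L2_bound_of_AE_limit[OF D D2 _ l this] show ?thesis by auto
    qed
    with \<open>\<delta> > 0\<close> show "\<exists>\<delta>>0. \<forall>n t. grid T \<delta> n t \<longrightarrow>
        integrable M (\<lambda>\<omega>. (S n t \<omega> - I \<omega>)\<^sup>2) \<and> expectation (\<lambda>\<omega>. (S n t \<omega> - I \<omega>)\<^sup>2) \<le> \<epsilon>"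
      by blast
  qed
qed

text \<open>Each step multiplies by a factor whose mean given the past is 1. The discrete square
  integral is bounded for a fixed grid, and this keeps the complex exponential bounded.\<close>

lemma grid_exponential_martingale:
  assumes t: "grid T \<delta> n t"
  shows "expectation (\<lambda>\<omega>. exp (\<i> * of_real (\<kappa> * S n t \<omega>) +
    of_real (\<kappa>\<^sup>2 / 2 * (\<Sum>i<n. (H (t i) \<omega>)\<^sup>2 * (t (Suc i) - t i))))) = 1"
proof -
  define Z where "Z k \<omega> = exp (\<i> * of_real (\<kappa> * S k t \<omega>) +
    of_real (\<kappa>\<^sup>2 / 2 * (\<Sum>i<k. (H (t i) \<omega>)\<^sup>2 * (t (Suc i) - t i))))" for k \<omega>
  have H2: "(H s \<omega>)\<^sup>2 \<le> C\<^sup>2" for s \<omega>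
    using bounded[of s \<omega>] by (simp add: abs_le_square_iff[symmetric])
  have Zb: "norm (Z k \<omega>) \<le> exp (\<kappa>\<^sup>2 / 2 * (\<Sum>i<k. C\<^sup>2 * (t (Suc i) - t i)))" if "k \<le> n" for k \<omega>
    unfolding Z_def using that grid_step[OF t]
    by (auto intro!: mult_left_mono sum_mono mult_right_mono H2)
  have "expectation (Z k) = 1" if "k \<le> n" for k
    using that
  proof (induction k)
    case 0
    then show ?case using prob_space by (simp add: Z_def grid_sum_def)
  next
    case (Suc k)
    then have k: "k < n" by simp
    have Zm: "Z k \<in> borel_measurable (F (t k))"
    proof -
      have [measurable]: "H (t i) \<in> borel_measurable (F (t k))" "W (t i) \<in> borel_measurable (F (t k))" if "i \<le> k" for i
        using that k grid_range[OF t, of i] grid_mono[OF t, of i k]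
        by (auto intro!: filtration_mono[OF _ _ adapted] filtration_mono[OF _ _ W_measurable])
      have "S k t \<in> borel_measurable (F (t k))"
        unfolding grid_sum_def by (intro borel_measurable_sum borel_measurable_times borel_measurable_diff) auto
      moreover have "(\<lambda>\<omega>. \<Sum>i<k. (H (t i) \<omega>)\<^sup>2 * (t (Suc i) - t i)) \<in> borel_measurable (F (t k))"
        by (intro borel_measurable_sum borel_measurable_times borel_measurable_power) auto
      ultimately show ?thesis
        unfolding Z_def by measurable
    qed
    have "Z (Suc k) = (\<lambda>\<omega>. Z k \<omega> * exp (\<i> * of_real (\<kappa> * H (t k) \<omega> * dW (t k) (t (Suc k)) \<omega>) +
        of_real (\<kappa>\<^sup>2 / 2 * (H (t k) \<omega>)\<^sup>2 * (t (Suc k) - t k))))"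
      by (rule ext) (simp add: Z_def grid_sum_def dW_def exp_add[symmetric] distrib_left add.assoc
        add.commute add.left_commute mult.assoc)
    then have "expectation (Z (Suc k)) = expectation (Z k)"
      using exponential_martingale_step[OF _ _ Zm Zb adapted bounded, of "t (Suc k)" \<kappa>]
        grid_range[OF t, of k] grid_step[OF t k] k by simp
    then show ?case using Suc by simp
  qed
  from this[of n] show ?thesis unfolding Z_def[abs_def] by simp
qed

section \<open>Quadratic variation, time integrals and the exponential martingale\<close>

definition qv_error :: "nat \<Rightarrow> (nat \<Rightarrow> real) \<Rightarrow> 'a \<Rightarrow> real"
  where "qv_error n t \<omega> = (\<Sum>i<n. H (t i) \<omega> * ((dW (t i) (t (Suc i)) \<omega>)\<^sup>2 - (t (Suc i) - t i)))"

text \<open>The centred squares are martingale differences, so cross terms vanish and second moments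
  add. A step of length \<open>h\<close> contributes at most
  \<open>2 * C\<^sup>2 * h\<^sup>2\<close>, and the squared lengths sum to at most
  \<open>\<delta> * T\<close>.\<close>

lemma quadratic_variation_L2:
  assumes t: "grid T \<delta> n t"
  shows "qv_error n t \<in> borel_measurable M"
    and "integrable M (\<lambda>\<omega>. (qv_error n t \<omega>)\<^sup>2)"
    and "expectation (\<lambda>\<omega>. (qv_error n t \<omega>)\<^sup>2)
      \<le> 2 * C\<^sup>2 * \<delta> * T"
proof -
  define h where "h i = t (Suc i) - t i" for i
  define Z where "Z k \<omega> = (\<Sum>i<k. H (t i) \<omega> * ((dW (t i) (t (Suc i)) \<omega>)\<^sup>2 - h i))" for k \<omega>
  have Zm: "Z k \<in> borel_measurable (F (t k))" if "k \<le> n" for k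
  proof -
    have "H (t i) \<in> borel_measurable (F (t k))" "dW (t i) (t (Suc i)) \<in> borel_measurable (F (t k))" if "i < k" for i
      using that \<open>k \<le> n\<close> grid_range[OF t, of i] grid_range[OF t, of "Suc i"] grid_mono[OF t, of i k]
        grid_mono[OF t, of "Suc i" k] grid_step[OF t, of i]
      by (auto intro!: filtration_mono[OF _ _ adapted] filtration_mono[OF _ _ dW_measurable])
    then show ?thesis
      unfolding Z_def by (intro borel_measurable_sum borel_measurable_times borel_measurable_diff
          borel_measurable_power) auto
  qed
  have H2: "(H s \<omega>)\<^sup>2 \<le> C\<^sup>2" for s \<omega>
    using bounded[of s \<omega>] by (simp add: abs_le_square_iff[symmetric])
  have "integrable M (\<lambda>\<omega>. (Z k \<omega>)\<^sup>2) \<and> expectation (\<lambda>\<omega>. (Z k \<omega>)\<^sup>2) \<le> (\<Sum>i<k. 2 * C\<^sup>2 * (h i)\<^sup>2)" if "k \<le> n" for k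
    using that
  proof (induction k)
    case 0
    then show ?case by (simp add: Z_def)
  next
    case (Suc k)
    then have k: "k < n" by simp
    define \<psi> where "\<psi> y = y\<^sup>2 - h k" for y
    have \<psi>[measurable]: "\<psi> \<in> borel_measurable borel" unfolding \<psi>_def by measurable
    define d where "d = dW (t k) (t (Suc k))"
    have tk: "0 \<le> t k" "t k \<le> t (Suc k)"
      using grid_range[OF t, of k] grid_step[OF t k] k by auto
    note m = dW_moments[OF tk, folded d_def, folded h_def]
    have ZkM: "Z k \<in> borel_measurable M"
      using filtration_measurable[OF tk(1) Zm] k by simp
    have IH: "integrable M (\<lambda>\<omega>. (Z k \<omega>)\<^sup>2)" "expectation (\<lambda>\<omega>. (Z k \<omega>)\<^sup>2) \<le> (\<Sum>i<k. 2 * C\<^sup>2 * (h i)\<^sup>2)"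
      using Suc by auto
    have H2i: "integrable M (\<lambda>\<omega>. (H (t k) \<omega>)\<^sup>2)"
      using integrable_H_mult[OF tk(1) tk(1)] by (simp add: power2_eq_square)
    have eq: "(\<lambda>\<omega>. (Z (Suc k) \<omega>)\<^sup>2) = (\<lambda>\<omega>. (Z k \<omega>)\<^sup>2 + 2 * ((Z k \<omega> * H (t k) \<omega>) * \<psi> (d \<omega>))
        + (H (t k) \<omega>)\<^sup>2 * (\<psi> (d \<omega>))\<^sup>2)"
      by (rule ext) (simp add: Z_def \<psi>_def d_def power2_eq_square algebra_simps)
    have "integrable M (\<lambda>\<omega>. Z k \<omega> * H (t k) \<omega>)"
      using IH H2i tk ZkM by (intro integrable_mult_square) auto
    moreover have "(\<lambda>\<omega>. Z k \<omega> * H (t k) \<omega>) \<in> borel_measurable (F (t k))"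
      using Zm k adapted tk by auto
    moreover have \<psi>i: "integrable M (\<lambda>\<omega>. \<psi> (d \<omega>))" "expectation (\<lambda>\<omega>. \<psi> (d \<omega>)) = 0"
      using m prob_space by (simp_all add: \<psi>_def)
    ultimately have 1: "integrable M (\<lambda>\<omega>. (Z k \<omega> * H (t k) \<omega>) * \<psi> (d \<omega>))"
      "expectation (\<lambda>\<omega>. (Z k \<omega> * H (t k) \<omega>) * \<psi> (d \<omega>)) = 0"
      using expectation_mult_dW[OF tk _ _ \<psi>, of "\<lambda>\<omega>. Z k \<omega> * H (t k) \<omega>", folded d_def] by auto
    have \<psi>2: "integrable M (\<lambda>\<omega>. (\<psi> (d \<omega>))\<^sup>2)" "expectation (\<lambda>\<omega>. (\<psi> (d \<omega>))\<^sup>2) = 2 * (h k)\<^sup>2"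
      using m by (simp_all add: \<psi>_def)
    have "(\<lambda>\<omega>. (H (t k) \<omega>)\<^sup>2) \<in> borel_measurable (F (t k))"
      using adapted[OF tk(1)] by auto
    then have 2: "integrable M (\<lambda>\<omega>. (H (t k) \<omega>)\<^sup>2 * (\<psi> (d \<omega>))\<^sup>2)"
      "expectation (\<lambda>\<omega>. (H (t k) \<omega>)\<^sup>2 * (\<psi> (d \<omega>))\<^sup>2) = expectation (\<lambda>\<omega>. (H (t k) \<omega>)\<^sup>2) * (2 * (h k)\<^sup>2)"
      using expectation_mult_dW[OF tk _ H2i, of "\<lambda>y. (\<psi> y)\<^sup>2", folded d_def] \<psi>2 by auto
    have "expectation (\<lambda>\<omega>. (H (t k) \<omega>)\<^sup>2) \<le> C\<^sup>2"
      using H2 H2i by (intro integral_le_const) auto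
    then have "expectation (\<lambda>\<omega>. (H (t k) \<omega>)\<^sup>2) * (2 * (h k)\<^sup>2) \<le> C\<^sup>2 * (2 * (h k)\<^sup>2)"
      by (intro mult_right_mono) auto
    then show ?case
      unfolding eq using IH 1 2 by simp
  qed
  note Z = this[of n, simplified]
  show "integrable M (\<lambda>\<omega>. (qv_error n t \<omega>)\<^sup>2)"
    using Z by (simp add: Z_def h_def qv_error_def)
  show "qv_error n t \<in> borel_measurable M"
    using filtration_measurable[OF _ Zm[of n]] grid_range[OF t, of n] unfolding Z_def h_def qv_error_def[abs_def] by auto
  have "(\<Sum>i<n. 2 * C\<^sup>2 * (h i)\<^sup>2) \<le> (\<Sum>i<n. 2 * C\<^sup>2 * (\<delta> * h i))"
    unfolding power2_eq_square h_def using grid_step[OF t]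
    by (intro sum_mono mult_left_mono mult_right_mono) (auto intro: less_imp_le)
  also have "\<dots> = 2 * C\<^sup>2 * \<delta> * T"
    unfolding h_def sum_distrib_left[symmetric] grid_sum_increments[OF t] by simp
  finally show "expectation (\<lambda>\<omega>. (qv_error n t \<omega>)\<^sup>2)
      \<le> 2 * C\<^sup>2 * \<delta> * T"
    using Z by (simp add: Z_def h_def qv_error_def)
qed

lemma riemann_sums_converge:
  assumes T: "0 < T" and k: "continuous_on UNIV (k :: real \<Rightarrow> real)"
  shows "AE \<omega> in M. (\<lambda>n. \<Sum>i<Suc n. k (H (uniform_grid T (Suc n) i) \<omega>) *
      (uniform_grid T (Suc n) (Suc i) - uniform_grid T (Suc n) i)) \<longlonglongrightarrow> (LINT s:{0..T}|lborel. k (H s \<omega>))"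
  using continuous_paths
proof eventually_elim
  case (elim \<omega>)
  have c: "continuous_on {0..T} (\<lambda>s. k (H s \<omega>))"
    by (intro continuous_on_compose2[OF k] continuous_on_subset[OF elim]) auto
  have eq: "(LINT s:{0..T}|lborel. k (H s \<omega>)) = integral {0..T} (\<lambda>s. k (H s \<omega>) * 1)"
    by (simp add: set_borel_integral_eq_integral(2)[OF borel_integrable_atLeastAtMost'[OF c]])
  show ?case
    unfolding LIMSEQ_def dist_real_def eventually_sequentially[symmetric] eq
  proof (intro allI impI)
    fix \<epsilon> :: real assume \<epsilon>: "0 < \<epsilon>"
    obtain \<delta> where \<delta>: "\<delta> > 0" "\<And>n t. grid T \<delta> n t \<Longrightarrow>
        \<bar>(\<Sum>i<n. k (H (t i) \<omega>) * (t (Suc i) - t i)) - integral {0..T} (\<lambda>s. k (H s \<omega>) * 1)\<bar> \<le> \<epsilon> / 2"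
      using grid_sum_tendsto_integral[OF c, of "\<lambda>_. 1" "\<lambda>s. s" "\<epsilon> / 2"] T \<epsilon> by auto
    have "\<forall>\<^sub>F n in sequentially. grid T \<delta> (Suc n) (uniform_grid T (Suc n))"
      using eventually_grid_uniform_grid[OF T \<delta>(1)] by (rule eventually_sequentially_Suc[THEN iffD2])
    then show "\<forall>\<^sub>F n in sequentially. \<bar>(\<Sum>i<Suc n. k (H (uniform_grid T (Suc n) i) \<omega>) *
        (uniform_grid T (Suc n) (Suc i) - uniform_grid T (Suc n) i)) - integral {0..T} (\<lambda>s. k (H s \<omega>) * 1)\<bar> < \<epsilon>"
    proof eventually_elim
      case (elim n)
      from \<delta>(2)[OF this] show ?case using \<epsilon> by linarith
    qed
  qed
qed

text \<open>Off the almost sure event of continuous paths the time integral need not depend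
  measurably on \<open>\<omega>\<close>; the limit of the Riemann sums is measurable everywhere and
  equals it almost surely.\<close>

lemma time_integral_measurable_version:
  assumes T: "0 < T" and k: "continuous_on UNIV (k :: real \<Rightarrow> real)"
  obtains A where "A \<in> borel_measurable M" "AE \<omega> in M. A \<omega> = (LINT s:{0..T}|lborel. k (H s \<omega>))"
proof
  have [measurable]: "k \<in> borel_measurable borel"
    using k by (rule borel_measurable_continuous_onI)
  have [simp]: "0 \<le> uniform_grid T n i" for n i
    using T by (simp add: uniform_grid_def)
  let ?s = "\<lambda>n \<omega>. \<Sum>i<Suc n. k (H (uniform_grid T (Suc n) i) \<omega>) *
      (uniform_grid T (Suc n) (Suc i) - uniform_grid T (Suc n) i)"
  show "(\<lambda>\<omega>. lim (\<lambda>n. ?s n \<omega>)) \<in> borel_measurable M"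
    by (intro borel_measurable_lim_metric borel_measurable_sum borel_measurable_times)
      (auto intro!: measurable_compose[OF H_measurable])
  show "AE \<omega> in M. lim (\<lambda>n. ?s n \<omega>) = (LINT s:{0..T}|lborel. k (H s \<omega>))"
    using riemann_sums_converge[OF T k] by eventually_elim (rule limI)
qed

text \<open>Sums and discrete square integrals converge almost surely along a subsequence of uniform
  grids. The modulus of the exponential involves only the bounded compensator, so dominated
  convergence carries the identity to the limit.\<close>

lemma exponential_martingale:
  assumes T: "0 < T" and I: "mean_square_integral M H W T I"
    and A: "A \<in> borel_measurable M" "AE \<omega> in M. A \<omega> = (LINT s:{0..T}|lborel. (H s \<omega>)\<^sup>2)"
  shows "expectation (\<lambda>\<omega>. exp (\<i> * of_real (\<kappa> * I \<omega>) + of_real (\<kappa>\<^sup>2 / 2 * A \<omega>))) = 1"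
proof -
  note conv = mean_square_integralD(2)[OF I] and I = mean_square_integralD(1)[OF I]
  define u where "u n = uniform_grid T (Suc n)" for n
  have ug: "grid T (2 * T / real (Suc n)) (Suc n) (u n)" for n
    unfolding u_def by (rule grid_uniform_grid_Suc[OF T])
  have ev: "\<forall>\<^sub>F n in sequentially. grid T \<delta> (Suc n) (u n)" if "0 < \<delta>" for \<delta>
    unfolding u_def by (rule eventually_grid_uniform_grid_Suc[OF T that])
  \<comment> \<open>\<open>mean_square_integral\<close> gives integrability for fine grids only. A
    coarse sum differs from a fine one by a square-integrable variable, which extends it to every
    \<open>n\<close>.\<close>
  have int: "integrable M (\<lambda>\<omega>. (S (Suc n) (u n) \<omega> - I \<omega>)\<^sup>2)" for n
  proof -
    obtain \<delta> where "\<delta> > 0" and \<delta>: "\<And>n t. grid T \<delta> n t \<Longrightarrow> integrable M (\<lambda>\<omega>. (S n t \<omega> - I \<omega>)\<^sup>2)"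
      using conv[of 1] by auto
    obtain m where m: "grid T \<delta> (Suc m) (u m)"
      using ev[OF \<open>\<delta> > 0\<close>] by (auto simp: eventually_sequentially)
    have S: "S (Suc k) (u k) \<in> borel_measurable M" for k by (rule S_measurable[OF ug])
    have 1: "integrable M (\<lambda>\<omega>. (S (Suc n) (u n) \<omega> - S (Suc m) (u m) \<omega>)\<^sup>2)"
      by (rule S_diff_square(1)[OF ug ug])
    have 2: "integrable M (\<lambda>\<omega>. (S (Suc n) (u n) \<omega> - S (Suc m) (u m) \<omega>) * (S (Suc m) (u m) \<omega> - I \<omega>))"
      using 1 \<delta>[OF m] S I by (intro integrable_mult_square) auto
    have "(\<lambda>\<omega>. (S (Suc n) (u n) \<omega> - I \<omega>)\<^sup>2) = (\<lambda>\<omega>. (S (Suc n) (u n) \<omega> - S (Suc m) (u m) \<omega>)\<^sup>2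
        + 2 * ((S (Suc n) (u n) \<omega> - S (Suc m) (u m) \<omega>) * (S (Suc m) (u m) \<omega> - I \<omega>)) + (S (Suc m) (u m) \<omega> - I \<omega>)\<^sup>2)"
      by (rule ext) (simp add: power2_eq_square algebra_simps)
    then show ?thesis using 1 2 \<delta>[OF m] by simp
  qed
  have "(\<lambda>n. expectation (\<lambda>\<omega>. (S (Suc n) (u n) \<omega> - I \<omega>)\<^sup>2)) \<longlonglongrightarrow> 0"
  proof (rule order_tendstoI)
    fix a :: real assume "0 < a"
    then obtain \<delta> where "\<delta> > 0" and \<delta>: "\<And>n t. grid T \<delta> n t \<Longrightarrow> expectation (\<lambda>\<omega>. (S n t \<omega> - I \<omega>)\<^sup>2) \<le> a / 2"
      using conv[of "a / 2"] by auto
    from ev[OF this(1)] show "\<forall>\<^sub>F n in sequentially. expectation (\<lambda>\<omega>. (S (Suc n) (u n) \<omega> - I \<omega>)\<^sup>2) < a"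
    proof eventually_elim
      case (elim n)
      from \<delta>[OF this] show ?case using \<open>0 < a\<close> by linarith
    qed
  next
    fix a :: real assume "a < 0"
    moreover have "0 \<le> expectation (\<lambda>\<omega>. (S (Suc n) (u n) \<omega> - I \<omega>)\<^sup>2)" for n by simp
    ultimately show "\<forall>\<^sub>F n in sequentially. a < expectation (\<lambda>\<omega>. (S (Suc n) (u n) \<omega> - I \<omega>)\<^sup>2)"
      by (intro always_eventually allI) (rule less_le_trans)
  qed
  then obtain r where r: "strict_mono r" "AE \<omega> in M. (\<lambda>n. S (Suc (r n)) (u (r n)) \<omega> - I \<omega>) \<longlonglongrightarrow> 0"
    using L2_convergence_AE_subseq[of "\<lambda>n \<omega>. S (Suc n) (u n) \<omega> - I \<omega>"] S_measurable[OF ug] I int by auto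
  define q where "q n \<omega> = (\<Sum>i<Suc n. (H (u n i) \<omega>)\<^sup>2 * (u n (Suc i) - u n i))" for n \<omega>
  have u0: "0 \<le> u n i" for n i
    using T by (simp add: u_def uniform_grid_def)
  have qm: "q n \<in> borel_measurable M" for n
    unfolding q_def by (intro borel_measurable_sum borel_measurable_times borel_measurable_power)
      (auto simp: u0)
  have q: "AE \<omega> in M. (\<lambda>n. q n \<omega>) \<longlonglongrightarrow> A \<omega>"
  proof -
    have "continuous_on UNIV (\<lambda>y::real. y\<^sup>2)" by (intro continuous_intros)
    from riemann_sums_converge[OF T this] A(2) show ?thesis
      unfolding q_def u_def by eventually_elim simp
  qed
  have qb: "q n \<omega> \<le> C\<^sup>2 * T" for n \<omega>
  proof -
    have "(H s \<omega>)\<^sup>2 \<le> C\<^sup>2" for s using bounded[of s \<omega>] by (simp add: abs_le_square_iff[symmetric])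
    then have "q n \<omega> \<le> (\<Sum>i<Suc n. C\<^sup>2 * (u n (Suc i) - u n i))"
      unfolding q_def using grid_step[OF ug] by (intro sum_mono mult_right_mono) auto
    then show ?thesis
      unfolding sum_distrib_left[symmetric] grid_sum_increments[OF ug] .
  qed
  define E where "E n \<omega> = exp (\<i> * of_real (\<kappa> * S (Suc n) (u n) \<omega>) + of_real (\<kappa>\<^sup>2 / 2 * q n \<omega>))" for n \<omega>
  have "(\<lambda>n. expectation (E (r n))) \<longlonglongrightarrow>
      expectation (\<lambda>\<omega>. exp (\<i> * of_real (\<kappa> * I \<omega>) + of_real (\<kappa>\<^sup>2 / 2 * A \<omega>)))"
  proof (rule integral_dominated_convergence[where w="\<lambda>_. exp (\<kappa>\<^sup>2 / 2 * (C\<^sup>2 * T))"])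
    show "AE \<omega> in M. (\<lambda>n. E (r n) \<omega>) \<longlonglongrightarrow> exp (\<i> * of_real (\<kappa> * I \<omega>) + of_real (\<kappa>\<^sup>2 / 2 * A \<omega>))"
      using r(2) q
    proof eventually_elim
      case (elim \<omega>)
      have "(\<lambda>n. S (Suc (r n)) (u (r n)) \<omega>) \<longlonglongrightarrow> I \<omega>"
        using elim(1) by (simp add: LIM_zero_iff)
      moreover have "(\<lambda>n. q (r n) \<omega>) \<longlonglongrightarrow> A \<omega>"
        using LIMSEQ_subseq_LIMSEQ[OF elim(2) r(1)] by (simp add: comp_def)
      ultimately show ?case
        unfolding E_def by (intro tendsto_intros)
    qed
    show "AE \<omega> in M. norm (E (r n) \<omega>) \<le> exp (\<kappa>\<^sup>2 / 2 * (C\<^sup>2 * T))" for n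
      unfolding E_def using qb by (auto intro!: mult_left_mono)
    show "E (r n) \<in> borel_measurable M" for n
      unfolding E_def using S_measurable[OF ug] qm by measurable
  qed (use I A in measurable)
  moreover have "expectation (E n) = 1" for n
    using grid_exponential_martingale[OF ug] unfolding E_def[abs_def] q_def .
  ultimately show ?thesis
    by (simp add: LIMSEQ_const_iff)
qed

end

section \<open>A pathwise discrete Ito formula\<close>

text \<open>If \<open>A\<close> contained \<open>[a, b]\<close>, the half-open interval
  \<open>{a<..b}\<close> would carry the mass \<open>G b - G a > 0\<close> inside \<open>A\<close>.
  In this form the support condition on \<open>L\<close> and \<open>R\<close> is used: growth on an
  interval forces a visit to the barrier there.\<close>

lemma stieltjes_mass_zero_imp_touch:
  assumes G: "increasing_from_zero G" and m: "stieltjes_mass G A = 0"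
    and ab: "0 \<le> a" "a \<le> b" "G a < G b"
  shows "\<exists>s\<in>{a..b}. s \<notin> A"
proof (rule ccontr)
  assume "\<not> ?thesis"
  then have sub: "{a<..b} \<subseteq> A \<inter> {0..}" using ab by auto
  define G' where "G' t = G (max 0 t)" for t
  have mono: "G' s \<le> G' t" if "s \<le> t" for s t
    using G that unfolding increasing_from_zero_def G'_def by (auto intro: mono_onD)
  have "continuous_on UNIV G'"
    using G unfolding increasing_from_zero_def G'_def
    by (auto intro!: continuous_on_compose2[of "{0..}" G] continuous_intros)
  then have rc: "continuous (at_right t) G'" for t
    by (auto simp: continuous_on_eq_continuous_within intro: continuous_within_subset)
  have "emeasure (interval_measure G') {a<..b} = (\<integral>\<^sup>+t. indicator {a<..b} t \<partial>interval_measure G')"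
    by simp
  also have "\<dots> \<le> stieltjes_mass G A"
    unfolding stieltjes_mass_def G'_def[abs_def, symmetric] using sub
    by (intro nn_integral_mono) (auto simp: indicator_def)
  finally have "ennreal (G' b - G' a) = 0"
    using m emeasure_interval_measure_Ioc[OF ab(2) mono rc] by simp
  then show False
    using ab by (auto simp: G'_def max_absorb2 ennreal_eq_0_iff)
qed

text \<open>Lagrange's remainder, with the intermediate point kept within
  \<open>\<bar>z - y\<bar>\<close> of \<open>y\<close>, so that uniform continuity can later replace
  \<open>g2 \<xi>\<close> by \<open>g2 y\<close>.\<close>

lemma second_order_Taylor:
  fixes g g1 g2 :: "real \<Rightarrow> real"
  assumes g: "\<And>y. y \<in> {l..u} \<Longrightarrow> (g has_real_derivative g1 y) (at y)"
    and g1: "\<And>y. y \<in> {l..u} \<Longrightarrow> (g1 has_real_derivative g2 y) (at y)"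
    and yz: "y \<in> {l..u}" "z \<in> {l..u}"
  shows "\<exists>\<xi>\<in>{l..u}. \<bar>\<xi> - y\<bar> \<le> \<bar>z - y\<bar> \<and> g z = g y + g1 y * (z - y) + g2 \<xi> / 2 * (z - y)\<^sup>2"
proof (cases "z = y")
  case True
  then show ?thesis using yz by auto
next
  case False
  define d where "d = (\<lambda>m::nat. if m = 0 then g else if m = 1 then g1 else g2)"
  have "\<exists>\<xi>. (if z < y then z < \<xi> \<and> \<xi> < y else y < \<xi> \<and> \<xi> < z) \<and>
      g z = (\<Sum>m<2. d m y / fact m * (z - y) ^ m) + d 2 \<xi> / fact 2 * (z - y)\<^sup>2"
    by (rule Taylor[of 2 d g l u]) (use False yz g g1 in \<open>auto simp: d_def less_2_cases_iff\<close>)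
  then obtain \<xi> where "if z < y then z < \<xi> \<and> \<xi> < y else y < \<xi> \<and> \<xi> < z"
    and "g z = g y + g1 y * (z - y) + g2 \<xi> / 2 * (z - y)\<^sup>2"
    by (auto simp: d_def numeral_2_eq_2)
  then show ?thesis
    using yz by (intro bexI[of _ \<xi>]) (auto split: if_splits)
qed

text \<open>One step of the discrete Ito formula: \<open>p\<close>, \<open>q\<close> are values of \<open>g'\<close>, \<open>g''\<close> at the left end
  point, \<open>r\<close> is the value of \<open>g''\<close> at an intermediate point, and \<open>v\<close>, \<open>w\<close>, \<open>a\<close>, \<open>c\<close> are the
  increments of the drift, of \<open>W\<close> and of the two pushing processes.\<close>

lemma ito_step_bound:
  fixes K \<sigma> \<eta> h x v w a c p q r \<beta> :: real
  assumes x: "x = v + \<sigma> * w + a - c" and \<eta>: "0 \<le> \<eta>" "\<eta> \<le> 1" and h: "0 \<le> h" and \<sigma>: "0 \<le> \<sigma>"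
    and ac: "0 \<le> a" "0 \<le> c" and K: "\<bar>p\<bar> \<le> K" "\<bar>q\<bar> \<le> K"
    and v: "\<bar>v\<bar> \<le> K * h" "\<bar>v - \<beta> * h\<bar> \<le> \<eta> * h" and rq: "\<bar>r - q\<bar> \<le> \<eta>"
    and pa: "0 < a \<Longrightarrow> \<bar>p\<bar> \<le> \<eta>" and pc: "0 < c \<Longrightarrow> \<bar>p\<bar> \<le> \<eta>"
    and small: "\<bar>x\<bar> \<le> \<eta>" "\<bar>w\<bar> \<le> \<eta>" "\<bar>x - \<sigma> * w\<bar> \<le> \<eta>"
  shows "\<bar>p * x + r / 2 * x\<^sup>2 - \<beta> * p * h - \<sigma> * p * w - \<sigma>\<^sup>2 / 2 * q * w\<^sup>2\<bar>
    \<le> \<eta> * (K * h + a + c + \<sigma>\<^sup>2 * w\<^sup>2 + (1 + K * (1 + \<sigma>)) * (K * h + a + c))"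
proof -
  define s where "s = K * h + a + c"
  \<comment> \<open>\<open>y\<close> collects the drift and the pushing terms. The difference
    \<open>x\<^sup>2 - (\<sigma> * w)\<^sup>2\<close> factors as
    \<open>y * (x + \<sigma> * w)\<close>, an increment of bounded variation times a factor of order
    \<open>\<eta>\<close>.\<close>
  define y where "y = x - \<sigma> * w"
  have K0: "0 \<le> K" using K(1) by linarith
  have y: "\<bar>y\<bar> \<le> s" "\<bar>y\<bar> \<le> \<eta>"
    using x v ac small by (auto simp: y_def s_def)
  have s0: "0 \<le> s" using y by linarith
  have "p * x + r / 2 * x\<^sup>2 - \<beta> * p * h - \<sigma> * p * w - \<sigma>\<^sup>2 / 2 * q * w\<^sup>2 =
      p * (v - \<beta> * h) + p * a + - (p * c) + (r - q) / 2 * x\<^sup>2 + q / 2 * (y * (x + \<sigma> * w))"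
    unfolding y_def by (simp add: x power2_eq_square field_simps)
  moreover have "\<bar>p * (v - \<beta> * h)\<bar> \<le> K * (\<eta> * h)"
    unfolding abs_mult using K v K0 by (intro mult_mono) auto
  moreover have "\<bar>p * a\<bar> \<le> \<eta> * a"
    using pa ac by (cases "a = 0") (auto simp: abs_mult intro!: mult_right_mono)
  moreover have "\<bar>- (p * c)\<bar> \<le> \<eta> * c"
    using pc ac by (cases "c = 0") (auto simp: abs_mult intro!: mult_right_mono)
  moreover have "\<bar>(r - q) / 2 * x\<^sup>2\<bar> \<le> \<eta> * (\<sigma>\<^sup>2 * w\<^sup>2 + s)"
  proof -
    have "x\<^sup>2 \<le> 2 * (\<sigma> * w)\<^sup>2 + 2 * y\<^sup>2"
      using sum_squares_bound[of "\<sigma> * w" y] by (simp add: y_def power2_eq_square algebra_simps)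
    moreover have "y\<^sup>2 \<le> s * 1"
      unfolding power2_eq_square using y \<eta> s0 mult_mono[of "\<bar>y\<bar>" s "\<bar>y\<bar>" 1] by (simp add: abs_mult[symmetric])
    ultimately have "x\<^sup>2 / 2 \<le> \<sigma>\<^sup>2 * w\<^sup>2 + s"
      by (simp add: power_mult_distrib)
    then have "\<bar>r - q\<bar> * (x\<^sup>2 / 2) \<le> \<eta> * (\<sigma>\<^sup>2 * w\<^sup>2 + s)"
      using rq \<eta> by (intro mult_mono) auto
    then show ?thesis by (simp add: abs_mult)
  qed
  moreover have "\<bar>q / 2 * (y * (x + \<sigma> * w))\<bar> \<le> K * (s * (\<eta> * (1 + \<sigma>)))"
  proof -
    have "\<bar>\<sigma> * w\<bar> \<le> \<sigma> * \<eta>"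
      using small \<sigma> by (simp add: abs_mult mult_left_mono)
    then have "\<bar>x + \<sigma> * w\<bar> \<le> \<eta> * (1 + \<sigma>)"
      using small by (simp add: algebra_simps)
    then have "\<bar>y\<bar> * \<bar>x + \<sigma> * w\<bar> \<le> s * (\<eta> * (1 + \<sigma>))"
      using y s0 by (intro mult_mono) auto
    moreover have "\<bar>q / 2\<bar> \<le> K" using K(2) by auto
    ultimately have "\<bar>q / 2\<bar> * (\<bar>y\<bar> * \<bar>x + \<sigma> * w\<bar>) \<le> K * (s * (\<eta> * (1 + \<sigma>)))"
      using K0 by (intro mult_mono[of "\<bar>q / 2\<bar>"]) auto
    then show ?thesis
      by (simp only: abs_mult)
  qed
  ultimately have "\<bar>p * x + r / 2 * x\<^sup>2 - \<beta> * p * h - \<sigma> * p * w - \<sigma>\<^sup>2 / 2 * q * w\<^sup>2\<bar> \<le>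
      K * (\<eta> * h) + \<eta> * a + \<eta> * c + \<eta> * (\<sigma>\<^sup>2 * w\<^sup>2 + s) + K * (s * (\<eta> * (1 + \<sigma>)))"
    by linarith
  also have "\<dots> = \<eta> * (K * h + a + c + \<sigma>\<^sup>2 * w\<^sup>2 + (1 + K * (1 + \<sigma>)) * s)"
    by (simp add: algebra_simps)
  finally show ?thesis unfolding s_def .
qed

text \<open>No probability enters: the roughness of \<open>W\<close> is limited only by the bound
  \<open>Q\<close> on its squared increments, which quadratic variation supplies later. A step on
  which \<open>L\<close> or \<open>R\<close> grows contains a visit to a barrier, where
  \<open>g1\<close> vanishes; by continuity \<open>g1\<close> is at most \<open>\<eta>\<close> in
  modulus at its left end, so the pushing terms contribute at most \<open>\<eta>\<close> times the
  total push.\<close>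

lemma pathwise_discrete_ito:
  fixes X W L R V b g g1 g2 :: "real \<Rightarrow> real"
  assumes T: "0 < T" and \<sigma>: "0 \<le> \<sigma>" and Q: "0 \<le> Q"
    and X: "continuous_on {0..T} X" "\<And>s. s \<in> {0..T} \<Longrightarrow> X s \<in> {l..u}" and W: "continuous_on {0..T} W"
    and b: "continuous_on {l..u} b"
    and V: "\<And>s t. 0 \<le> s \<Longrightarrow> s \<le> t \<Longrightarrow> t \<le> T \<Longrightarrow> V t - V s = integral {s..t} (\<lambda>r. b (X r))"
    and eq: "\<And>s t. 0 \<le> s \<Longrightarrow> s \<le> t \<Longrightarrow> t \<le> T \<Longrightarrow>
        X t - X s = V t - V s + \<sigma> * (W t - W s) + (L t - L s) - (R t - R s)"
    and L: "mono_on {0..T} L" and R: "mono_on {0..T} R"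
    and Lt: "\<And>s t. 0 \<le> s \<Longrightarrow> s \<le> t \<Longrightarrow> t \<le> T \<Longrightarrow> L s < L t \<Longrightarrow> \<exists>r\<in>{s..t}. X r = l"
    and Rt: "\<And>s t. 0 \<le> s \<Longrightarrow> s \<le> t \<Longrightarrow> t \<le> T \<Longrightarrow> R s < R t \<Longrightarrow> \<exists>r\<in>{s..t}. X r = u"
    and g: "\<And>y. y \<in> {l..u} \<Longrightarrow> (g has_real_derivative g1 y) (at y)"
    and g1: "\<And>y. y \<in> {l..u} \<Longrightarrow> (g1 has_real_derivative g2 y) (at y)"
    and g2: "continuous_on {l..u} g2" and g1l: "g1 l = 0" and g1u: "g1 u = 0" and \<epsilon>: "0 < \<epsilon>"
  shows "\<exists>\<delta>>0. \<forall>n t. grid T \<delta> n t \<and> (\<Sum>i<n. (W (t (Suc i)) - W (t i))\<^sup>2) \<le> Q \<longrightarrow>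
    \<bar>g (X T) - g (X 0) - (\<Sum>i<n. b (X (t i)) * g1 (X (t i)) * (t (Suc i) - t i))
      - \<sigma> * (\<Sum>i<n. g1 (X (t i)) * (W (t (Suc i)) - W (t i)))
      - \<sigma>\<^sup>2 / 2 * (\<Sum>i<n. g2 (X (t i)) * (W (t (Suc i)) - W (t i))\<^sup>2)\<bar> \<le> \<epsilon>"
proof -
  have cg1: "continuous_on {l..u} g1"
    using g1 by (intro continuous_at_imp_continuous_on ballI) (blast intro: DERIV_isCont)
  have comp: "continuous_on {0..T} (\<lambda>s. k (X s))" if "continuous_on {l..u} k" for k :: "real \<Rightarrow> real"
    using X by (intro continuous_on_compose2[OF that X(1)]) auto
  obtain K where K: "K > 0" "\<And>y. y \<in> {l..u} \<Longrightarrow> \<bar>b y\<bar> \<le> K" "\<And>y. y \<in> {l..u} \<Longrightarrow> \<bar>g1 y\<bar> \<le> K"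
    "\<And>y. y \<in> {l..u} \<Longrightarrow> \<bar>g2 y\<bar> \<le> K"
  proof -
    obtain K1 where "K1 > 0" "\<forall>y\<in>{l..u}. \<bar>b y\<bar> \<le> K1"
      using continuous_on_interval_bounded[OF b] by blast
    moreover obtain K2 where "K2 > 0" "\<forall>y\<in>{l..u}. \<bar>g1 y\<bar> \<le> K2"
      using continuous_on_interval_bounded[OF cg1] by blast
    moreover obtain K3 where "K3 > 0" "\<forall>y\<in>{l..u}. \<bar>g2 y\<bar> \<le> K3"
      using continuous_on_interval_bounded[OF g2] by blast
    ultimately show ?thesis
      by (intro that[of "K1 + K2 + K3"]) (fastforce intro: add_pos_pos)+
  qed
  define D where "D = (L T - L 0) + (R T - R 0)"
  have D0: "0 \<le> D"
    using mono_onD[OF L, of 0 T] mono_onD[OF R, of 0 T] T by (simp add: D_def)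
  \<comment> \<open>\<open>B\<close> bounds the sum over all steps of the bracket in
    \<open>ito_step_bound\<close>: step lengths add up to \<open>T\<close>, pushes to
    \<open>D\<close>, squared increments of \<open>W\<close> to at most \<open>Q\<close>.\<close>
  define B where "B = K * T + D + \<sigma>\<^sup>2 * Q + (1 + K * (1 + \<sigma>)) * (K * T + D)"
  have B0: "0 \<le> B" unfolding B_def using K \<sigma> T D0 Q by simp
  define \<eta> where "\<eta> = min 1 (\<epsilon> / (B + 1))"
  have \<eta>: "0 < \<eta>" "\<eta> \<le> 1" "\<eta> * B \<le> \<epsilon>"
  proof -
    show "0 < \<eta>" using \<epsilon> B0 by (simp add: \<eta>_def)
    have "\<eta> * B \<le> \<epsilon> / (B + 1) * (B + 1)"
      using \<epsilon> B0 by (intro mult_mono) (auto simp: \<eta>_def)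
    then show "\<eta> * B \<le> \<epsilon>" using B0 by simp
  qed (simp add: \<eta>_def)
  obtain \<gamma> where \<gamma>: "\<gamma> > 0" "\<And>y z. y \<in> {l..u} \<Longrightarrow> z \<in> {l..u} \<Longrightarrow> \<bar>y - z\<bar> < \<gamma> \<Longrightarrow> \<bar>g2 y - g2 z\<bar> \<le> \<eta>"
    using uniformly_small_increments[OF g2 \<eta>(1)] by metis
  \<comment> \<open>Halving \<open>\<gamma>\<close> turns the weak inequality for \<open>X\<close>
    into the strict one required for the oscillation of \<open>g2\<close>.\<close>
  obtain \<delta>1 where \<delta>1: "\<delta>1 > 0" "\<And>s t. s \<in> {0..T} \<Longrightarrow> t \<in> {0..T} \<Longrightarrow> \<bar>s - t\<bar> < \<delta>1 \<Longrightarrow> \<bar>X s - X t\<bar> \<le> min \<eta> (\<gamma> / 2)"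
    using uniformly_small_increments[OF X(1), of "min \<eta> (\<gamma> / 2)"] \<eta>(1) \<gamma>(1) by auto
  obtain \<delta>2 where \<delta>2: "\<delta>2 > 0" "\<And>s t. s \<in> {0..T} \<Longrightarrow> t \<in> {0..T} \<Longrightarrow> \<bar>s - t\<bar> < \<delta>2 \<Longrightarrow> \<bar>W s - W t\<bar> \<le> \<eta>"
    using uniformly_small_increments[OF W \<eta>(1)] by metis
  obtain \<delta>3 where \<delta>3: "\<delta>3 > 0" "\<And>s t. s \<in> {0..T} \<Longrightarrow> t \<in> {0..T} \<Longrightarrow> \<bar>s - t\<bar> < \<delta>3 \<Longrightarrow>
      \<bar>(X s - \<sigma> * W s) - (X t - \<sigma> * W t)\<bar> \<le> \<eta>"
  proof -
    have "continuous_on {0..T} (\<lambda>s. X s - \<sigma> * W s)" by (intro continuous_intros X W)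
    from uniformly_small_increments[OF this \<eta>(1)] that show thesis by metis
  qed
  obtain \<delta>4 where \<delta>4: "\<delta>4 > 0" "\<And>s t. s \<in> {0..T} \<Longrightarrow> t \<in> {0..T} \<Longrightarrow> \<bar>s - t\<bar> < \<delta>4 \<Longrightarrow> \<bar>b (X s) - b (X t)\<bar> \<le> \<eta>"
    using uniformly_small_increments[OF comp[OF b] \<eta>(1)] by metis
  obtain \<delta>5 where \<delta>5: "\<delta>5 > 0" "\<And>s t. s \<in> {0..T} \<Longrightarrow> t \<in> {0..T} \<Longrightarrow> \<bar>s - t\<bar> < \<delta>5 \<Longrightarrow> \<bar>g1 (X s) - g1 (X t)\<bar> \<le> \<eta>"
    using uniformly_small_increments[OF comp[OF cg1] \<eta>(1)] by metis
  define \<delta> where "\<delta> = Min {\<delta>1, \<delta>2, \<delta>3, \<delta>4, \<delta>5}"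
  have \<delta>: "0 < \<delta>" "\<delta> \<le> \<delta>1" "\<delta> \<le> \<delta>2" "\<delta> \<le> \<delta>3" "\<delta> \<le> \<delta>4" "\<delta> \<le> \<delta>5"
    using \<delta>1(1) \<delta>2(1) \<delta>3(1) \<delta>4(1) \<delta>5(1) by (simp_all add: \<delta>_def)
  have step: "\<bar>g (X t) - g (X s) - b (X s) * g1 (X s) * (t - s) - \<sigma> * g1 (X s) * (W t - W s)
      - \<sigma>\<^sup>2 / 2 * g2 (X s) * (W t - W s)\<^sup>2\<bar> \<le> \<eta> * (K * (t - s) + (L t - L s) + (R t - R s)
      + \<sigma>\<^sup>2 * (W t - W s)\<^sup>2 + (1 + K * (1 + \<sigma>)) * (K * (t - s) + (L t - L s) + (R t - R s)))"
    if st: "0 \<le> s" "s \<le> t" "t \<le> T" "t - s < \<delta>" for s t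
  proof -
    have st': "s \<in> {0..T}" "t \<in> {0..T}" using st by auto
    obtain \<xi> where \<xi>: "\<xi> \<in> {l..u}" "\<bar>\<xi> - X s\<bar> \<le> \<bar>X t - X s\<bar>"
      "g (X t) = g (X s) + g1 (X s) * (X t - X s) + g2 \<xi> / 2 * (X t - X s)\<^sup>2"
      using second_order_Taylor[OF g g1 X(2)[OF st'(1)] X(2)[OF st'(2)]] by auto
    have dX: "\<bar>X t - X s\<bar> \<le> \<eta>" "\<bar>X t - X s\<bar> \<le> \<gamma> / 2"
      using \<delta>1(2)[OF st'(2,1)] st \<delta> by auto
    have cb: "continuous_on {s..t} (\<lambda>r. b (X r))"
      using st by (intro continuous_on_subset[OF comp[OF b]]) auto
    have V1: "\<bar>V t - V s\<bar> \<le> K * (t - s)"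
    proof -
      have "norm (integral {s..t} (\<lambda>r. b (X r))) \<le> K * (t - s)"
        using st K X by (intro integral_bound cb) auto
      then show ?thesis using V[OF st(1-3)] by simp
    qed
    have V2: "\<bar>V t - V s - b (X s) * (t - s)\<bar> \<le> \<eta> * (t - s)"
    proof -
      have "integral {s..t} (\<lambda>r. b (X r) - b (X s)) = V t - V s - b (X s) * (t - s)"
        using V[OF st(1-3)] st cb
        by (subst Henstock_Kurzweil_Integration.integral_diff) (auto intro: integrable_continuous_interval)
      moreover have "norm (integral {s..t} (\<lambda>r. b (X r) - b (X s))) \<le> \<eta> * (t - s)"
        using st \<delta>4(2) \<delta> by (intro integral_bound continuous_intros cb) auto
      ultimately show ?thesis by simp
    qed
    have p: "\<bar>g1 (X s)\<bar> \<le> \<eta>" if "r \<in> {s..t}" "X r = l \<or> X r = u" for r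
      using \<delta>5(2)[of s r] that st \<delta> g1l g1u by auto
    have "\<bar>g1 (X s) * (X t - X s) + g2 \<xi> / 2 * (X t - X s)\<^sup>2 - b (X s) * g1 (X s) * (t - s)
        - \<sigma> * g1 (X s) * (W t - W s) - \<sigma>\<^sup>2 / 2 * g2 (X s) * (W t - W s)\<^sup>2\<bar>
      \<le> \<eta> * (K * (t - s) + (L t - L s) + (R t - R s)
      + \<sigma>\<^sup>2 * (W t - W s)\<^sup>2 + (1 + K * (1 + \<sigma>)) * (K * (t - s) + (L t - L s) + (R t - R s)))"
    proof (rule ito_step_bound[OF eq[OF st(1-3)]])
      show "0 \<le> L t - L s" "0 \<le> R t - R s"
        using mono_onD[OF L, of s t] mono_onD[OF R, of s t] st by auto
      show "\<bar>g1 (X s)\<bar> \<le> \<eta>" if "0 < L t - L s"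
        using Lt[OF st(1-3)] that p by auto
      show "\<bar>g1 (X s)\<bar> \<le> \<eta>" if "0 < R t - R s"
        using Rt[OF st(1-3)] that p by auto
      show "\<bar>g2 \<xi> - g2 (X s)\<bar> \<le> \<eta>"
        using \<xi> dX \<gamma> X(2)[OF st'(1)] by (intro \<gamma>(2)) auto
      show "\<bar>X t - X s - \<sigma> * (W t - W s)\<bar> \<le> \<eta>"
        using \<delta>3(2)[OF st'(2,1)] st \<delta> by (simp add: algebra_simps)
      show "\<bar>W t - W s\<bar> \<le> \<eta>"
        using \<delta>2(2)[OF st'(2,1)] st \<delta> by simp
    qed (use \<eta> st \<sigma> K X(2)[OF st'(1)] V1 V2 dX in auto)
    then show ?thesis by (simp add: \<xi>(3))
  qed
  show ?thesis
  proof (intro exI[of _ \<delta>] conjI \<delta>(1) allI impI)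
    fix n t assume *: "grid T \<delta> n t \<and> (\<Sum>i<n. (W (t (Suc i)) - W (t i))\<^sup>2) \<le> Q"
    then have gr: "grid T \<delta> n t" by simp
    have tel: "(\<Sum>i<n. k (t (Suc i)) - k (t i)) = k T - k 0" for k :: "real \<Rightarrow> real"
      using gr unfolding sum_lessThan_telescope[of "\<lambda>i. k (t i)"] by (simp add: grid_def)
    let ?e = "g (X T) - g (X 0) - (\<Sum>i<n. b (X (t i)) * g1 (X (t i)) * (t (Suc i) - t i))
      - \<sigma> * (\<Sum>i<n. g1 (X (t i)) * (W (t (Suc i)) - W (t i)))
      - \<sigma>\<^sup>2 / 2 * (\<Sum>i<n. g2 (X (t i)) * (W (t (Suc i)) - W (t i))\<^sup>2)"
    have "\<bar>?e\<bar> =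
      \<bar>\<Sum>i<n. g (X (t (Suc i))) - g (X (t i)) - b (X (t i)) * g1 (X (t i)) * (t (Suc i) - t i)
        - \<sigma> * g1 (X (t i)) * (W (t (Suc i)) - W (t i))
        - \<sigma>\<^sup>2 / 2 * g2 (X (t i)) * (W (t (Suc i)) - W (t i))\<^sup>2\<bar>"
      unfolding tel[of "\<lambda>s. g (X s)", symmetric] sum_distrib_left mult.assoc sum_subtractf[symmetric] ..
    also have "\<dots> \<le> (\<Sum>i<n. \<eta> * (K * (t (Suc i) - t i) + (L (t (Suc i)) - L (t i)) + (R (t (Suc i)) - R (t i))
      + \<sigma>\<^sup>2 * (W (t (Suc i)) - W (t i))\<^sup>2 + (1 + K * (1 + \<sigma>)) * (K * (t (Suc i) - t i)
      + (L (t (Suc i)) - L (t i)) + (R (t (Suc i)) - R (t i)))))"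
      using grid_range[OF gr] grid_step[OF gr]
      by (intro order_trans[OF sum_abs] sum_mono step) auto
    also have "\<dots> = \<eta> * (K * T + D + \<sigma>\<^sup>2 * (\<Sum>i<n. (W (t (Suc i)) - W (t i))\<^sup>2) + (1 + K * (1 + \<sigma>)) * (K * T + D))"
      unfolding D_def sum.distrib sum_distrib_left[symmetric] tel grid_sum_increments[OF gr] by simp
    also have "\<dots> \<le> \<eta> * B"
      unfolding B_def using * \<eta>(1) by (intro mult_left_mono add_mono order_refl) auto
    finally show "\<bar>?e\<bar> \<le> \<epsilon>"
      using \<eta>(3) by linarith
  qed
qed

section \<open>The Neumann problem\<close>

text \<open>A reversed interval is empty and has integral 0, so the difference of the integrals over
  \<open>{0..z}\<close> and \<open>{z..0}\<close> is an oriented integral for both signs of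
  \<open>z\<close>.\<close>

lemma antiderivative_exists:
  fixes k :: "real \<Rightarrow> real"
  assumes k: "continuous_on UNIV k"
  shows "\<exists>K. \<forall>y. (K has_real_derivative k y) (at y)"
proof (intro exI allI)
  fix y :: real
  define N where "N = \<bar>y\<bar> + 1"
  have N: "y \<in> {-N<..<N}" "0 < N" by (auto simp: N_def)
  have int: "k integrable_on {a..b}" for a b
    by (intro integrable_continuous_interval continuous_on_subset[OF k]) auto
  have "((\<lambda>z. integral {-N..z} k) has_real_derivative k y) (at y within {-N..N})"
    using N by (intro integral_has_real_derivative continuous_on_subset[OF k]) auto
  then have "((\<lambda>z. integral {-N..z} k - integral {-N..0} k) has_real_derivative k y) (at y)"
    using N by (auto simp: at_within_Icc_at intro!: derivative_eq_intros)
  then show "((\<lambda>z. integral {0..z} k - integral {z..0} k) has_real_derivative k y) (at y)"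
  proof (rule has_field_derivative_transform_within_open[of _ _ _ "{-N<..<N}"])
    fix z assume z: "z \<in> {-N<..<N}"
    show "integral {-N..z} k - integral {-N..0} k = integral {0..z} k - integral {z..0} k"
    proof (cases "0 \<le> z")
      case True
      then have "integral {-N..0} k + integral {0..z} k = integral {-N..z} k"
        using N by (intro Henstock_Kurzweil_Integration.integral_combine int) auto
      then show ?thesis using True by (cases "z = 0") auto
    next
      case False
      then have "integral {-N..z} k + integral {z..0} k = integral {-N..0} k"
        using z by (intro Henstock_Kurzweil_Integration.integral_combine int) auto
      then show ?thesis using False by auto
    qed
  qed (use N in auto)
qed

lemma set_lebesgue_integral_antiderivative:
  fixes k :: "real \<Rightarrow> real"
  assumes "a \<le> b" and k: "continuous_on {a..b} k"
    and K: "\<And>y. y \<in> {a..b} \<Longrightarrow> (K has_real_derivative k y) (at y)"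
  shows "(LINT y:{a..b}|lborel. k y) = K b - K a"
proof -
  have "set_integrable lborel {a..b} k"
    using k by (rule borel_integrable_atLeastAtMost')
  then have "(LINT y:{a..b}|lborel. k y) = integral {a..b} k"
    by (rule set_borel_integral_eq_integral(2))
  also have "\<dots> = K b - K a"
    using assms by (intro integral_unique fundamental_theorem_of_calculus)
      (auto simp: has_real_derivative_iff_has_vector_derivative[symmetric] intro: has_field_derivative_at_within)
  finally show ?thesis .
qed

section \<open>Speed density and limit information\<close>

lemma speed_weight_pos: "0 < speed_weight f \<theta>0 \<sigma> l y"
  by (simp add: speed_weight_def)

lemma continuous_on_speed_weight:
  assumes "continuous_on {l..u} f"
  shows "continuous_on {l..u} (speed_weight f \<theta>0 \<sigma> l)"
proof -
  have "continuous_on {l..u} (\<lambda>y. integral {l..y} f)"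
    by (rule indefinite_integral_continuous_1[OF integrable_continuous_interval[OF assms]])
  moreover have "integral {l..y} f = (LINT r:{l..y}|lborel. f r)" if "y \<in> {l..u}" for y
    using that by (intro set_borel_integral_eq_integral(2)[symmetric] borel_integrable_atLeastAtMost'
      continuous_on_subset[OF assms]) auto
  ultimately have "continuous_on {l..u} (\<lambda>y. LINT r:{l..y}|lborel. f r)"
    by (subst continuous_on_cong[OF refl]) (auto intro: sym)
  then show ?thesis
    unfolding speed_weight_def by (intro continuous_intros)
qed

lemma integral_speed_weight_pos:
  assumes "l < u" and f: "continuous_on {l..u} f"
  shows "0 < (LINT z:{l..u}|lborel. speed_weight f \<theta>0 \<sigma> l z)"
proof -
  note w = continuous_on_speed_weight[OF f, of \<theta>0 \<sigma>]
  have eq: "(LINT z:{l..u}|lborel. speed_weight f \<theta>0 \<sigma> l z) = integral {l..u} (speed_weight f \<theta>0 \<sigma> l)"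
    by (intro set_borel_integral_eq_integral(2) borel_integrable_atLeastAtMost' w)
  have "0 \<le> integral {l..u} (speed_weight f \<theta>0 \<sigma> l)"
    by (rule Henstock_Kurzweil_Integration.integral_nonneg)
      (auto intro: integrable_continuous_interval w less_imp_le[OF speed_weight_pos])
  moreover have "integral {l..u} (speed_weight f \<theta>0 \<sigma> l) \<noteq> 0"
  proof
    assume "integral {l..u} (speed_weight f \<theta>0 \<sigma> l) = 0"
    then have "speed_weight f \<theta>0 \<sigma> l l = 0"
      using integral_eq_0_iff[OF w assms(1)] assms(1) less_imp_le[OF speed_weight_pos] by force
    then show False
      using speed_weight_pos[of f \<theta>0 \<sigma> l l] by simp
  qed
  ultimately show ?thesis unfolding eq by simp
qed

lemma limit_information_eq:
  "limit_information f \<theta>0 \<sigma> l u * (LINT z:{l..u}|lborel. speed_weight f \<theta>0 \<sigma> l z) =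
    (LINT y:{l..u}|lborel. (f y)\<^sup>2 * speed_weight f \<theta>0 \<sigma> l y)"
  if "l < u" "continuous_on {l..u} f"
  using integral_speed_weight_pos[OF that, of \<theta>0 \<sigma>]
  unfolding limit_information_def reflected_density_def times_divide_eq_right set_integral_divide_zero
  by simp

text \<open>The integrand is continuous and nonnegative; integral 0 would force it to vanish
  everywhere, including the point where \<open>f\<close> does not.\<close>

lemma limit_information_pos:
  assumes "l < u" and f: "continuous_on {l..u} f" and y: "y \<in> {l..u}" "f y \<noteq> 0"
  shows "0 < limit_information f \<theta>0 \<sigma> l u"
proof -
  note w = continuous_on_speed_weight[OF f, of \<theta>0 \<sigma>]
  define k where "k y = (f y)\<^sup>2 * speed_weight f \<theta>0 \<sigma> l y" for y
  have k: "continuous_on {l..u} k"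
    unfolding k_def by (intro continuous_intros f w)
  have k0: "0 \<le> k y" for y
    by (simp add: k_def less_imp_le[OF speed_weight_pos])
  have eq: "(LINT y:{l..u}|lborel. k y) = integral {l..u} k"
    by (intro set_borel_integral_eq_integral(2) borel_integrable_atLeastAtMost' k)
  have "0 \<le> integral {l..u} k"
    by (rule Henstock_Kurzweil_Integration.integral_nonneg) (auto intro: integrable_continuous_interval k k0)
  moreover have "k y \<noteq> 0"
    using y speed_weight_pos[of f \<theta>0 \<sigma> l y] by (simp add: k_def)
  then have "integral {l..u} k \<noteq> 0"
    using integral_eq_0_iff[OF k \<open>l < u\<close>] k0 y by blast
  ultimately have "0 < limit_information f \<theta>0 \<sigma> l u * (LINT z:{l..u}|lborel. speed_weight f \<theta>0 \<sigma> l z)"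
    unfolding limit_information_eq[OF \<open>l < u\<close> f] eq[unfolded k_def] by (simp add: k_def[abs_def])
  then show ?thesis
    using integral_speed_weight_pos[OF \<open>l < u\<close> f, of \<theta>0 \<sigma>] by (simp add: zero_less_mult_iff)
qed

text \<open>The boundary condition at \<open>u\<close> can be met because the right-hand side is centred under the
  invariant density.\<close>

lemma reflected_poisson_equation:
  assumes lu: "l < u" and \<sigma>: "0 < \<sigma>" and f: "continuous_on {l..u} f"
  obtains g g1 g2 :: "real \<Rightarrow> real"
  where "\<And>y. (g has_real_derivative g1 y) (at y)" "\<And>y. (g1 has_real_derivative g2 y) (at y)"
    and "continuous_on UNIV g2" "g1 l = 0" "g1 u = 0"
    and "\<And>y. y \<in> {l..u} \<Longrightarrow>
      \<sigma>\<^sup>2 / 2 * g2 y + \<theta>0 * f y * g1 y = (f y)\<^sup>2 - limit_information f \<theta>0 \<sigma> l u"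
proof -
  \<comment> \<open>Extending \<open>f\<close> by constants makes the equation solvable on the whole
    line, so that \<open>g\<close> has two-sided derivatives at the barriers as well.\<close>
  define fc where "fc y = f (max l (min u y))" for y
  define I where "I = limit_information f \<theta>0 \<sigma> l u"
  have fc: "continuous_on UNIV fc"
    unfolding fc_def using lu by (intro continuous_on_compose2[OF f] continuous_intros) auto
  have fc_eq: "fc y = f y" if "y \<in> {l..u}" for y
    using that by (simp add: fc_def)
  obtain \<Phi> where \<Phi>: "\<And>y. (\<Phi> has_real_derivative fc y) (at y)"
    using antiderivative_exists[OF fc] by blast
  \<comment> \<open>The integrating factor: \<open>w\<close> agrees with the speed weight on
    \<open>{l..u}\<close> and turns the equation into
    \<open>(w * g1)' = 2 / \<sigma>\<^sup>2 * w * (f\<^sup>2 - I)\<close>.\<close>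
  define w where "w y = exp (2 * \<theta>0 / \<sigma>\<^sup>2 * (\<Phi> y - \<Phi> l))" for y
  have w': "(w has_real_derivative w y * (2 * \<theta>0 / \<sigma>\<^sup>2 * fc y)) (at y)" for y
    unfolding w_def by (rule derivative_eq_intros \<Phi> refl)+ (use \<sigma> in simp)
  then have cw: "continuous_on A w" for A
    by (meson DERIV_isCont continuous_at_imp_continuous_on)
  have w_eq: "speed_weight f \<theta>0 \<sigma> l y = w y" if "y \<in> {l..u}" for y
    unfolding speed_weight_def w_def using that
    by (subst set_lebesgue_integral_antiderivative[of l y f \<Phi>])
      (auto intro: continuous_on_subset[OF f] simp: fc_eq[symmetric] \<Phi>)
  have "continuous_on UNIV (\<lambda>y. w y * ((fc y)\<^sup>2 - I))"
    by (intro continuous_intros cw fc)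
  then obtain \<Psi>0 where \<Psi>0: "\<And>y. (\<Psi>0 has_real_derivative w y * ((fc y)\<^sup>2 - I)) (at y)"
    using antiderivative_exists by blast
  define \<Psi> where "\<Psi> y = \<Psi>0 y - \<Psi>0 l" for y
  have \<Psi>: "(\<Psi> has_real_derivative w y * ((fc y)\<^sup>2 - I)) (at y)" for y
    unfolding \<Psi>_def using \<Psi>0 by (auto intro!: derivative_eq_intros)
  have "\<Psi> u = 0"
  proof -
    have int: "set_integrable lborel {l..u} (\<lambda>y. (f y)\<^sup>2 * w y)" "set_integrable lborel {l..u} w"
      by (intro borel_integrable_atLeastAtMost' continuous_intros cw f)+
    have "\<Psi> u = (LINT y:{l..u}|lborel. w y * ((fc y)\<^sup>2 - I))"
      using lu set_lebesgue_integral_antiderivative[of l u "\<lambda>y. w y * ((fc y)\<^sup>2 - I)" \<Psi>]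
      by (simp add: \<Psi> \<Psi>_def continuous_on_mult[OF cw] continuous_on_diff continuous_on_power
          continuous_on_subset[OF fc])
    also have "\<dots> = (LINT y:{l..u}|lborel. (f y)\<^sup>2 * w y - I * w y)"
      by (intro set_lebesgue_integral_cong) (auto simp: fc_eq algebra_simps)
    also have "\<dots> = (LINT y:{l..u}|lborel. (f y)\<^sup>2 * w y) - I * (LINT y:{l..u}|lborel. w y)"
      using int by (simp add: set_integral_diff set_integrable_mult_right)
    also have "(LINT y:{l..u}|lborel. w y) = (LINT y:{l..u}|lborel. speed_weight f \<theta>0 \<sigma> l y)"
      by (intro set_lebesgue_integral_cong) (auto simp: w_eq)
    also have "(LINT y:{l..u}|lborel. (f y)\<^sup>2 * w y) = (LINT y:{l..u}|lborel. (f y)\<^sup>2 * speed_weight f \<theta>0 \<sigma> l y)"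
      by (intro set_lebesgue_integral_cong) (auto simp: w_eq)
    finally show ?thesis
      using limit_information_eq[OF lu f, of \<theta>0 \<sigma>] by (simp add: I_def)
  qed
  define g1 where "g1 y = 2 / \<sigma>\<^sup>2 * (\<Psi> y / w y)" for y
  define g2 where "g2 y = 2 / \<sigma>\<^sup>2 * ((fc y)\<^sup>2 - I - \<theta>0 * fc y * g1 y)" for y
  have w0: "w y \<noteq> 0" for y by (simp add: w_def)
  have g1: "(g1 has_real_derivative g2 y) (at y)" for y
  proof -
    have "(g1 has_real_derivative 2 / \<sigma>\<^sup>2 *
        ((w y * ((fc y)\<^sup>2 - I) * w y - \<Psi> y * (w y * (2 * \<theta>0 / \<sigma>\<^sup>2 * fc y))) / (w y * w y))) (at y)"
      unfolding g1_def by (intro DERIV_cmult DERIV_divide \<Psi> w' w0)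
    moreover have "2 / \<sigma>\<^sup>2 * ((w y * ((fc y)\<^sup>2 - I) * w y - \<Psi> y * (w y * (2 * \<theta>0 / \<sigma>\<^sup>2 * fc y))) / (w y * w y)) = g2 y"
      unfolding g2_def g1_def using w0[of y] \<sigma> by (simp add: divide_simps) (simp add: algebra_simps)
    ultimately show ?thesis by simp
  qed
  then have cg1: "continuous_on UNIV g1"
    by (meson DERIV_isCont continuous_at_imp_continuous_on)
  obtain g where g: "\<And>y. (g has_real_derivative g1 y) (at y)"
    using antiderivative_exists[OF cg1] by blast
  show thesis
  proof (rule that[OF g g1])
    show "continuous_on UNIV g2"
      unfolding g2_def by (intro continuous_intros fc cg1)
    show "g1 l = 0" "g1 u = 0"
      using \<open>\<Psi> u = 0\<close> by (auto simp: g1_def \<Psi>_def)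
    show "\<sigma>\<^sup>2 / 2 * g2 y + \<theta>0 * f y * g1 y = (f y)\<^sup>2 - limit_information f \<theta>0 \<sigma> l u"
      if "y \<in> {l..u}" for y
    proof -
      have "\<sigma>\<^sup>2 / 2 * g2 y = (f y)\<^sup>2 - I - \<theta>0 * f y * g1 y"
        using \<sigma> by (simp add: g2_def fc_eq[OF that])
      then show ?thesis unfolding I_def by linarith
    qed
  qed
qed

section \<open>The reflected diffusion\<close>

locale reflected_diffusion = brownian_filtration +
  fixes f :: "real \<Rightarrow> real" and X L R :: "real \<Rightarrow> 'a \<Rightarrow> real" and l u \<sigma> x \<theta>0 :: real
  assumes lu: "l < u" and \<sigma>: "0 < \<sigma>" and f: "continuous_on {l..u} f"
    and solution: "reflected_sde_solution M F W l u (\<lambda>y. \<theta>0 * f y) \<sigma> x X L R"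
begin

text \<open>\<open>X\<close> lies in \<open>[l, u]\<close> only almost surely, and \<open>f\<close> need not even be measurable elsewhere; after
  truncation \<open>f(X)\<close> is bounded and adapted on the whole space.\<close>

definition Xc :: "real \<Rightarrow> 'a \<Rightarrow> real"
  where "Xc t \<omega> = max l (min u (X t \<omega>))"

lemma Xc_range: "Xc t \<omega> \<in> {l..u}"
  using lu by (auto simp: Xc_def)

text \<open>One almost sure condition for all pathwise arguments. It is not claimed to be measurable
  and enters through \<open>AE\<close> and through a covering null set.\<close>

definition regular :: "'a \<Rightarrow> bool"
  where "regular \<omega> \<longleftrightarrow> continuous_on {0..} (\<lambda>t. W t \<omega>) \<and>
      continuous_on {0..} (\<lambda>t. X t \<omega>) \<and>
      (\<forall>t\<ge>0. X t \<omega> \<in> {l..u}) \<and>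
      (\<forall>t\<ge>0. X t \<omega> = x + (LINT s:{0..t}|lborel. \<theta>0 * f (X s \<omega>)) + \<sigma> * W t \<omega> + L t \<omega> - R t \<omega>) \<and>
      increasing_from_zero (\<lambda>t. L t \<omega>) \<and>
      increasing_from_zero (\<lambda>t. R t \<omega>) \<and>
      stieltjes_mass (\<lambda>t. L t \<omega>) {t. X t \<omega> > l} = 0 \<and>
      stieltjes_mass (\<lambda>t. R t \<omega>) {t. X t \<omega> < u} = 0"

lemma AE_regular: "AE \<omega> in M. regular \<omega>"
proof -
  have "AE \<omega> in M. W 0 \<omega> = 0 \<and> continuous_on {0..} (\<lambda>t. W t \<omega>)"
    using brownian unfolding standard_brownian_motion_def by blast
  moreover have "AE \<omega> in M.
      continuous_on {0..} (\<lambda>t. X t \<omega>) \<and>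
      (\<forall>t\<ge>0. X t \<omega> \<in> {l..u}) \<and>
      (\<forall>t\<ge>0. X t \<omega> = x + (LINT s:{0..t}|lborel. \<theta>0 * f (X s \<omega>)) + \<sigma> * W t \<omega> + L t \<omega> - R t \<omega>) \<and>
      increasing_from_zero (\<lambda>t. L t \<omega>) \<and>
      increasing_from_zero (\<lambda>t. R t \<omega>) \<and>
      stieltjes_mass (\<lambda>t. L t \<omega>) {t. X t \<omega> > l} = 0 \<and>
      stieltjes_mass (\<lambda>t. R t \<omega>) {t. X t \<omega> < u} = 0"
    using solution unfolding reflected_sde_solution_def by blast
  ultimately show ?thesis
    unfolding regular_def by eventually_elim blast
qed

lemma Xc_eq: "regular \<omega> \<Longrightarrow> 0 \<le> t \<Longrightarrow> Xc t \<omega> = X t \<omega>"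
  unfolding regular_def Xc_def by auto

lemma adapted_XLR:
  assumes "0 \<le> t"
  shows "X t \<in> borel_measurable (F t)" "L t \<in> borel_measurable (F t)" "R t \<in> borel_measurable (F t)"
  using assms solution unfolding reflected_sde_solution_def adapted_to_def by blast+

lemma continuous_Xc: "regular \<omega> \<Longrightarrow> continuous_on {0..} (\<lambda>t. Xc t \<omega>)"
  unfolding regular_def Xc_def by (intro continuous_intros) auto

text \<open>A relation rather than a function of \<open>T\<close>: the time integral is only almost
  surely equal to a measurable function, and any such version will do.\<close>

definition occupation :: "real \<Rightarrow> ('a \<Rightarrow> real) \<Rightarrow> bool"
  where "occupation T A \<longleftrightarrow> A \<in> borel_measurable M \<and>
    (AE \<omega> in M. A \<omega> = (LINT s:{0..T}|lborel. (f (Xc s \<omega>))\<^sup>2))"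

lemma occupationD:
  assumes "occupation T A"
  shows "A \<in> borel_measurable M" "AE \<omega> in M. A \<omega> = (LINT s:{0..T}|lborel. (f (Xc s \<omega>))\<^sup>2)"
  using assms by (auto simp: occupation_def)

text \<open>Clamping the argument makes \<open>k\<close> continuous on the whole line and therefore
  Borel, which yields adaptedness on the whole space.\<close>

lemma bounded_integrand_Xc:
  assumes k: "continuous_on {l..u} k" and C: "\<And>y. y \<in> {l..u} \<Longrightarrow> \<bar>k y\<bar> \<le> C"
  shows "bounded_integrand M F W (\<lambda>t \<omega>. k (Xc t \<omega>)) C"
proof
  fix t :: real assume t: "0 \<le> t"
  have "continuous_on UNIV (\<lambda>y. k (max l (min u y)))"
    using lu by (intro continuous_on_compose2[OF k] continuous_intros) auto
  then have "(\<lambda>y. k (max l (min u y))) \<in> borel_measurable borel"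
    by (rule borel_measurable_continuous_onI)
  from measurable_compose[OF adapted_XLR(1)[OF t] this]
  show "(\<lambda>\<omega>. k (Xc t \<omega>)) \<in> borel_measurable (F t)"
    unfolding Xc_def .
next
  show "\<bar>k (Xc t \<omega>)\<bar> \<le> C" for t \<omega> by (rule C[OF Xc_range])
next
  show "AE \<omega> in M. continuous_on {0..} (\<lambda>t. k (Xc t \<omega>))"
    using AE_regular
    by eventually_elim (intro continuous_on_compose2[OF k continuous_Xc], use Xc_range in auto)
qed

text \<open>Removing the noise and the pushing terms from the equation leaves the drift, an
  indefinite integral of a continuous function; it serves as the integrator \<open>V\<close> of the
  pathwise lemmas.\<close>

lemma drift_increment:
  assumes "regular \<omega>" and st: "0 \<le> s" "s \<le> t"
  shows "(X t \<omega> - L t \<omega> + R t \<omega> - \<sigma> * W t \<omega>) - (X s \<omega> - L s \<omega> + R s \<omega> - \<sigma> * W s \<omega>) =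
    integral {s..t} (\<lambda>r. \<theta>0 * f (Xc r \<omega>))"
proof -
  have c: "continuous_on {a..b} (\<lambda>r. \<theta>0 * f (Xc r \<omega>))" if "0 \<le> a" for a b
    using that Xc_range by (intro continuous_intros continuous_on_compose2[OF f]
      continuous_on_subset[OF continuous_Xc[OF assms(1)]]) auto
  have *: "X r \<omega> - L r \<omega> + R r \<omega> - \<sigma> * W r \<omega> = x + integral {0..r} (\<lambda>r. \<theta>0 * f (Xc r \<omega>))" if "0 \<le> r" for r
  proof -
    have "(LINT s:{0..r}|lborel. \<theta>0 * f (X s \<omega>)) = (LINT s:{0..r}|lborel. \<theta>0 * f (Xc s \<omega>))"
      by (intro set_lebesgue_integral_cong) (auto simp: Xc_eq[OF assms(1)])
    also have "\<dots> = integral {0..r} (\<lambda>r. \<theta>0 * f (Xc r \<omega>))"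
      by (intro set_borel_integral_eq_integral(2) borel_integrable_atLeastAtMost' c) simp
    finally have "integral {0..r} (\<lambda>r. \<theta>0 * f (Xc r \<omega>)) = (LINT s:{0..r}|lborel. \<theta>0 * f (X s \<omega>))" ..
    moreover have "X r \<omega> = x + (LINT s:{0..r}|lborel. \<theta>0 * f (X s \<omega>)) + \<sigma> * W r \<omega> + L r \<omega> - R r \<omega>"
      using assms(1) that unfolding regular_def by blast
    ultimately show ?thesis by linarith
  qed
  have "integral {0..s} (\<lambda>r. \<theta>0 * f (Xc r \<omega>)) + integral {s..t} (\<lambda>r. \<theta>0 * f (Xc r \<omega>)) =
      integral {0..t} (\<lambda>r. \<theta>0 * f (Xc r \<omega>))"
    using st by (intro Henstock_Kurzweil_Integration.integral_combine integrable_continuous_interval c) auto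
  then show ?thesis
    using *[of s] *[of t] st by simp
qed

text \<open>The pathwise formula with \<open>Q = T + 1\<close>: squared Brownian increments sum to
  \<open>T\<close> in the limit, so this bound is met eventually along a suitable sequence of
  grids.\<close>

lemma discrete_ito_along_grid:
  assumes reg: "regular \<omega>" and T: "0 < T" and \<epsilon>: "0 < \<epsilon>"
    and g: "\<And>y. (g has_real_derivative g1 y) (at y)" and g1: "\<And>y. (g1 has_real_derivative g2 y) (at y)"
    and g2: "continuous_on UNIV g2" and bc: "g1 l = 0" "g1 u = 0"
  shows "\<exists>\<delta>>0. \<forall>n t. grid T \<delta> n t \<and> (\<Sum>i<n. (dW (t i) (t (Suc i)) \<omega>)\<^sup>2) \<le> T + 1 \<longrightarrow>
    \<bar>g (Xc T \<omega>) - g (Xc 0 \<omega>) - (\<Sum>i<n. \<theta>0 * f (Xc (t i) \<omega>) * g1 (Xc (t i) \<omega>) * (t (Suc i) - t i))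
      - \<sigma> * (\<Sum>i<n. g1 (Xc (t i) \<omega>) * dW (t i) (t (Suc i)) \<omega>)
      - \<sigma>\<^sup>2 / 2 * (\<Sum>i<n. g2 (Xc (t i) \<omega>) * (dW (t i) (t (Suc i)) \<omega>)\<^sup>2)\<bar> \<le> \<epsilon>"
  unfolding dW_def
proof (rule pathwise_discrete_ito[where V="\<lambda>t. X t \<omega> - L t \<omega> + R t \<omega> - \<sigma> * W t \<omega>"
      and l=l and u=u and L="\<lambda>t. L t \<omega>" and R="\<lambda>t. R t \<omega>"])
  show "continuous_on {0..T} (\<lambda>s. Xc s \<omega>)" "continuous_on {0..T} (\<lambda>s. W s \<omega>)"
    using continuous_Xc[OF reg] reg unfolding regular_def by (auto intro: continuous_on_subset)
  show "continuous_on {l..u} (\<lambda>y. \<theta>0 * f y)" by (intro continuous_intros f)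
  show "X t \<omega> - L t \<omega> + R t \<omega> - \<sigma> * W t \<omega> - (X s \<omega> - L s \<omega> + R s \<omega> - \<sigma> * W s \<omega>) =
      integral {s..t} (\<lambda>r. \<theta>0 * f (Xc r \<omega>))" if "0 \<le> s" "s \<le> t" for s t
    by (rule drift_increment[OF reg that])
  show "Xc t \<omega> - Xc s \<omega> = X t \<omega> - L t \<omega> + R t \<omega> - \<sigma> * W t \<omega> - (X s \<omega> - L s \<omega> + R s \<omega> - \<sigma> * W s \<omega>)
      + \<sigma> * (W t \<omega> - W s \<omega>) + (L t \<omega> - L s \<omega>) - (R t \<omega> - R s \<omega>)" if "0 \<le> s" "s \<le> t" for s t
    using that by (simp add: Xc_eq[OF reg] algebra_simps)
  show "mono_on {0..T} (\<lambda>t. L t \<omega>)" "mono_on {0..T} (\<lambda>t. R t \<omega>)"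
    using reg unfolding regular_def increasing_from_zero_def by (auto intro: mono_on_subset)
  show "\<exists>r\<in>{s..t}. Xc r \<omega> = l" if "0 \<le> s" "s \<le> t" "L s \<omega> < L t \<omega>" for s t
  proof -
    have "increasing_from_zero (\<lambda>t. L t \<omega>)" "stieltjes_mass (\<lambda>t. L t \<omega>) {t. X t \<omega> > l} = 0"
      using reg unfolding regular_def by blast+
    from stieltjes_mass_zero_imp_touch[OF this that]
    obtain r where r: "r \<in> {s..t}" "\<not> (X r \<omega> > l)" by auto
    moreover have "Xc r \<omega> = X r \<omega>" using r that by (intro Xc_eq[OF reg]) auto
    ultimately show ?thesis
      using Xc_range[of r \<omega>] by (intro bexI[of _ r]) auto
  qed
  show "\<exists>r\<in>{s..t}. Xc r \<omega> = u" if "0 \<le> s" "s \<le> t" "R s \<omega> < R t \<omega>" for s t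
  proof -
    have "increasing_from_zero (\<lambda>t. R t \<omega>)" "stieltjes_mass (\<lambda>t. R t \<omega>) {t. X t \<omega> < u} = 0"
      using reg unfolding regular_def by blast+
    from stieltjes_mass_zero_imp_touch[OF this that]
    obtain r where r: "r \<in> {s..t}" "\<not> (X r \<omega> < u)" by auto
    moreover have "Xc r \<omega> = X r \<omega>" using r that by (intro Xc_eq[OF reg]) auto
    ultimately show ?thesis
      using Xc_range[of r \<omega>] by (intro bexI[of _ r]) auto
  qed
qed (use T \<epsilon> \<sigma> g g1 bc Xc_range continuous_on_subset[OF g2] in auto)

text \<open>Ergodicity with a rate: the solution of the Neumann problem turns the centred occupation
  integral into a bounded term minus a martingale whose second moment grows linearly.\<close>

lemma occupation_integral_L2:
  obtains c where "0 < c"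
    and "\<And>T A. 0 < T \<Longrightarrow> occupation T A \<Longrightarrow>
        integrable M (\<lambda>\<omega>. (A \<omega> / T - limit_information f \<theta>0 \<sigma> l u)\<^sup>2) \<and>
        expectation (\<lambda>\<omega>. (A \<omega> / T - limit_information f \<theta>0 \<sigma> l u)\<^sup>2) \<le> c * (1 / T + 1 / T\<^sup>2)"
proof -
  define J where "J = limit_information f \<theta>0 \<sigma> l u"
  obtain g g1 g2 :: "real \<Rightarrow> real"
    where g: "\<And>y. (g has_real_derivative g1 y) (at y)" and g1: "\<And>y. (g1 has_real_derivative g2 y) (at y)"
      and g2: "continuous_on UNIV g2" and bc: "g1 l = 0" "g1 u = 0"
      and poisson: "\<And>y. y \<in> {l..u} \<Longrightarrow> \<sigma>\<^sup>2 / 2 * g2 y + \<theta>0 * f y * g1 y = (f y)\<^sup>2 - J"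
    by (rule reflected_poisson_equation[OF lu \<sigma> f, of \<theta>0, folded J_def]) (rule that)
  have cg: "continuous_on {l..u} g" "continuous_on {l..u} g1" "continuous_on {l..u} g2"
    using g g1 continuous_on_subset[OF g2] by (meson DERIV_isCont continuous_at_imp_continuous_on top_greatest)+
  obtain K where K: "0 < K" "\<And>y. y \<in> {l..u} \<Longrightarrow> \<bar>g y\<bar> \<le> K" "\<And>y. y \<in> {l..u} \<Longrightarrow> \<bar>g1 y\<bar> \<le> K"
    "\<And>y. y \<in> {l..u} \<Longrightarrow> \<bar>g2 y\<bar> \<le> K" "\<And>y. y \<in> {l..u} \<Longrightarrow> \<bar>f y\<bar> \<le> K"
  proof -
    obtain K0 K1 K2 K3 where "0 < K0" "0 < K1" "0 < K2" "0 < K3" "\<forall>y\<in>{l..u}. \<bar>g y\<bar> \<le> K0"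
      "\<forall>y\<in>{l..u}. \<bar>g1 y\<bar> \<le> K1" "\<forall>y\<in>{l..u}. \<bar>g2 y\<bar> \<le> K2" "\<forall>y\<in>{l..u}. \<bar>f y\<bar> \<le> K3"
      using continuous_on_interval_bounded[OF cg(1)] continuous_on_interval_bounded[OF cg(2)]
        continuous_on_interval_bounded[OF cg(3)] continuous_on_interval_bounded[OF f] by metis
    then show ?thesis
      by (intro that[of "K0 + K1 + K2 + K3"]) (fastforce intro: add_pos_pos)+
  qed
  interpret G0: bounded_integrand M F W "\<lambda>t \<omega>. g (Xc t \<omega>)" K
    by (rule bounded_integrand_Xc[OF cg(1) K(2)])
  interpret G1: bounded_integrand M F W "\<lambda>t \<omega>. g1 (Xc t \<omega>)" K
    by (rule bounded_integrand_Xc[OF cg(2) K(3)])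
  interpret G2: bounded_integrand M F W "\<lambda>t \<omega>. g2 (Xc t \<omega>)" K
    by (rule bounded_integrand_Xc[OF cg(3) K(4)])
  interpret Hf: bounded_integrand M F W "\<lambda>t \<omega>. f (Xc t \<omega>)" K
    by (rule bounded_integrand_Xc[OF f K(5)])
  \<comment> \<open>For the constant integrand the quadratic variation error is the sum of squared
    increments minus \<open>T\<close>; it is used to verify the bound \<open>T + 1\<close> in the
    discrete Ito formula.\<close>
  interpret One: bounded_integrand M F W "\<lambda>t \<omega>. 1" 1
    by (rule bounded_integrand_Xc[of "\<lambda>_. 1" 1]) auto
  \<comment> \<open>\<open>8 * K\<^sup>2\<close> comes from the bounded term
    \<open>g (Xc T) - g (Xc 0)\<close> and \<open>2 * \<sigma>\<^sup>2 * K\<^sup>2\<close> from the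
    isometry bound on the martingale, each doubled by
    \<open>(G - D)\<^sup>2 \<le> 2 * G\<^sup>2 + 2 * D\<^sup>2\<close>.\<close>
  define c where "c = 8 * K\<^sup>2 + 2 * \<sigma>\<^sup>2 * K\<^sup>2"
  have "integrable M (\<lambda>\<omega>. (A \<omega> / T - J)\<^sup>2) \<and> expectation (\<lambda>\<omega>. (A \<omega> / T - J)\<^sup>2) \<le> c * (1 / T + 1 / T\<^sup>2)"
    if T: "0 < T" and A: "occupation T A" for T A
  proof -
    note A = occupationD[OF A]
    define v where "v n = uniform_grid T (Suc n)" for n
    have vg: "grid T (2 * T / real (Suc n)) (Suc n) (v n)" for n
      unfolding v_def by (rule grid_uniform_grid_Suc[OF T])
    have ev: "\<forall>\<^sub>F n in sequentially. grid T \<delta> (Suc n) (v n)" if "0 < \<delta>" for \<delta>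
      unfolding v_def by (rule eventually_grid_uniform_grid_Suc[OF T that])
    define h where "h n i = v n (Suc i) - v n i" for n i
    define w where "w n i = dW (v n i) (v n (Suc i))" for n i
    define Y1 where "Y1 n = G2.qv_error (Suc n) (v n)" for n
    define Y2 where "Y2 n = One.qv_error (Suc n) (v n)" for n
    have lim0: "(\<lambda>n. 2 * a * (2 * T / real (Suc n)) * T) \<longlonglongrightarrow> 0" for a
    proof -
      have "(\<lambda>n. (4 * a * T * T) * inverse (real (Suc n))) \<longlonglongrightarrow> (4 * a * T * T) * 0"
        by (intro tendsto_mult tendsto_const LIMSEQ_inverse_real_of_nat)
      then show ?thesis by (simp add: field_simps)
    qed
    have q1: "Y1 n \<in> borel_measurable M" "integrable M (\<lambda>\<omega>. (Y1 n \<omega>)\<^sup>2)"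
      "expectation (\<lambda>\<omega>. (Y1 n \<omega>)\<^sup>2) \<le> 2 * K\<^sup>2 * (2 * T / real (Suc n)) * T" for n
      unfolding Y1_def by (rule G2.quadratic_variation_L2[OF vg])+
    have q2: "Y2 n \<in> borel_measurable M" "integrable M (\<lambda>\<omega>. (Y2 n \<omega>)\<^sup>2)"
      "expectation (\<lambda>\<omega>. (Y2 n \<omega>)\<^sup>2) \<le> 2 * 1\<^sup>2 * (2 * T / real (Suc n)) * T" for n
      unfolding Y2_def by (rule One.quadratic_variation_L2[OF vg])+
    have "(\<lambda>n. expectation (\<lambda>\<omega>. (Y1 n \<omega>)\<^sup>2)) \<longlonglongrightarrow> 0"
      by (rule tendsto_sandwich[OF _ _ tendsto_const lim0[of "K\<^sup>2"]]) (use q1(3) in \<open>auto intro: always_eventually\<close>)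
    then obtain r1 where r1: "strict_mono r1" "AE \<omega> in M. (\<lambda>n. Y1 (r1 n) \<omega>) \<longlonglongrightarrow> 0"
      using L2_convergence_AE_subseq[of Y1, OF q1(1,2)] by blast
    have "(\<lambda>n. expectation (\<lambda>\<omega>. (Y2 n \<omega>)\<^sup>2)) \<longlonglongrightarrow> 0"
      by (rule tendsto_sandwich[OF _ _ tendsto_const lim0[of "1\<^sup>2"]]) (use q2(3) in \<open>auto intro: always_eventually\<close>)
    from LIMSEQ_subseq_LIMSEQ[OF this r1(1)]
    have "(\<lambda>n. expectation (\<lambda>\<omega>. (Y2 (r1 n) \<omega>)\<^sup>2)) \<longlonglongrightarrow> 0"
      by (simp add: comp_def)
    then obtain r2 where r2: "strict_mono r2" "AE \<omega> in M. (\<lambda>n. Y2 (r1 (r2 n)) \<omega>) \<longlonglongrightarrow> 0"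
      using L2_convergence_AE_subseq[of "\<lambda>n. Y2 (r1 n)", OF q2(1,2)] by blast
    \<comment> \<open>One subsequence along which both quadratic variation errors vanish almost
      surely.\<close>
    define r where "r = r1 \<circ> r2"
    have r: "strict_mono r" unfolding r_def using r1(1) r2(1) by (rule strict_mono_o)
    have y1: "AE \<omega> in M. (\<lambda>n. Y1 (r n) \<omega>) \<longlonglongrightarrow> 0"
      using r1(2)
    proof eventually_elim
      case (elim \<omega>)
      from LIMSEQ_subseq_LIMSEQ[OF this r2(1)] show ?case by (simp add: r_def comp_def)
    qed
    have y2: "AE \<omega> in M. (\<lambda>n. Y2 (r n) \<omega>) \<longlonglongrightarrow> 0"
      using r2(2) by (simp add: r_def)
    define q where "q n \<omega> = (\<Sum>i<Suc n. (f (Xc (v n i) \<omega>))\<^sup>2 * h n i)" for n \<omega>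
    have q: "AE \<omega> in M. (\<lambda>n. q n \<omega>) \<longlonglongrightarrow> A \<omega>"
    proof -
      have "continuous_on UNIV (\<lambda>y::real. y\<^sup>2)" by (intro continuous_intros)
      from Hf.riemann_sums_converge[OF T this] A(2) show ?thesis
        unfolding q_def v_def h_def by eventually_elim simp
    qed
    define N where "N n \<omega> = \<sigma> * G1.S (Suc n) (v n) \<omega>" for n \<omega>
    \<comment> \<open>\<open>D\<close> stands for \<open>\<sigma>\<close> times the integral of
      \<open>g1 (Xc)\<close> against \<open>W\<close>. Defining it as the value that Ito's formula
      prescribes avoids constructing that integral: the sums \<open>N\<close> tend to it pathwise,
      and Fatou transfers their second moment bound.\<close>
    define D where "D \<omega> = g (Xc T \<omega>) - g (Xc 0 \<omega>) - (A \<omega> - J * T)" for \<omega>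
    have lim: "AE \<omega> in M. (\<lambda>n. N (r n) \<omega>) \<longlonglongrightarrow> D \<omega>"
      using AE_regular y1 y2 q
    proof eventually_elim
      case (elim \<omega>)
      note reg = elim(1)
      \<comment> \<open>By the Neumann equation the drift sum and the second-order sum combine to
        \<open>q - J * T\<close> plus a multiple of \<open>Y1\<close>, so \<open>e\<close> is
        precisely the remainder in the discrete Ito formula.\<close>
      define e where "e n = g (Xc T \<omega>) - g (Xc 0 \<omega>) - (q n \<omega> - J * T) - \<sigma>\<^sup>2 / 2 * Y1 n \<omega> - N n \<omega>" for n
      have e_eq: "e n = g (Xc T \<omega>) - g (Xc 0 \<omega>)
          - (\<Sum>i<Suc n. \<theta>0 * f (Xc (v n i) \<omega>) * g1 (Xc (v n i) \<omega>) * h n i)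
          - \<sigma> * (\<Sum>i<Suc n. g1 (Xc (v n i) \<omega>) * w n i \<omega>)
          - \<sigma>\<^sup>2 / 2 * (\<Sum>i<Suc n. g2 (Xc (v n i) \<omega>) * (w n i \<omega>)\<^sup>2)" for n
      proof -
        have "q n \<omega> - J * T = (\<Sum>i<Suc n. ((f (Xc (v n i) \<omega>))\<^sup>2 - J) * h n i)"
          unfolding q_def left_diff_distrib sum_subtractf sum_distrib_left[symmetric]
          using grid_sum_increments[OF vg[of n]] by (simp only: h_def)
        also have "\<dots> = (\<Sum>i<Suc n. (\<sigma>\<^sup>2 / 2 * g2 (Xc (v n i) \<omega>) + \<theta>0 * f (Xc (v n i) \<omega>) * g1 (Xc (v n i) \<omega>)) * h n i)"
          by (simp only: poisson[OF Xc_range])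
        also have "\<dots> = \<sigma>\<^sup>2 / 2 * (\<Sum>i<Suc n. g2 (Xc (v n i) \<omega>) * h n i)
            + (\<Sum>i<Suc n. \<theta>0 * f (Xc (v n i) \<omega>) * g1 (Xc (v n i) \<omega>) * h n i)"
          by (simp only: distrib_right sum.distrib sum_distrib_left mult.assoc)
        finally have 1: "q n \<omega> - J * T = \<dots>" .
        have 2: "Y1 n \<omega> = (\<Sum>i<Suc n. g2 (Xc (v n i) \<omega>) * (w n i \<omega>)\<^sup>2) - (\<Sum>i<Suc n. g2 (Xc (v n i) \<omega>) * h n i)"
          by (simp only: Y1_def G2.qv_error_def w_def h_def right_diff_distrib sum_subtractf)
        have 3: "N n \<omega> = \<sigma> * (\<Sum>i<Suc n. g1 (Xc (v n i) \<omega>) * w n i \<omega>)"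
          by (simp only: N_def G1.S_eq w_def)
        show ?thesis unfolding e_def 1 2 3 by (simp only: right_diff_distrib)
      qed
      have "(\<lambda>n. e (r n)) \<longlonglongrightarrow> 0"
      proof (rule LIMSEQ_I)
        fix \<epsilon> :: real assume \<epsilon>: "0 < \<epsilon>"
        obtain \<delta> where "\<delta> > 0" and \<delta>: "\<And>n t. grid T \<delta> n t \<Longrightarrow> (\<Sum>i<n. (dW (t i) (t (Suc i)) \<omega>)\<^sup>2) \<le> T + 1 \<Longrightarrow>
            \<bar>g (Xc T \<omega>) - g (Xc 0 \<omega>) - (\<Sum>i<n. \<theta>0 * f (Xc (t i) \<omega>) * g1 (Xc (t i) \<omega>) * (t (Suc i) - t i))
              - \<sigma> * (\<Sum>i<n. g1 (Xc (t i) \<omega>) * dW (t i) (t (Suc i)) \<omega>)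
              - \<sigma>\<^sup>2 / 2 * (\<Sum>i<n. g2 (Xc (t i) \<omega>) * (dW (t i) (t (Suc i)) \<omega>)\<^sup>2)\<bar> \<le> \<epsilon> / 2"
          using discrete_ito_along_grid[OF reg T _ g g1 g2 bc, of "\<epsilon> / 2"] \<epsilon> by auto
        have "\<forall>\<^sub>F n in sequentially. Y2 (r n) \<omega> < 1"
          using elim(3) by (simp add: order_tendsto_iff)
        moreover have "\<forall>\<^sub>F n in sequentially. grid T \<delta> (Suc (r n)) (v (r n))"
          using eventually_subseq[OF r ev[OF \<open>\<delta> > 0\<close>]] .
        ultimately have "\<forall>\<^sub>F n in sequentially. norm (e (r n) - 0) < \<epsilon>"
        proof eventually_elim
          case (elim n)
          have "Y2 (r n) \<omega> = (\<Sum>i<Suc (r n). (w (r n) i \<omega>)\<^sup>2) - T"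
            unfolding Y2_def One.qv_error_def mult_1 sum_subtractf w_def using grid_sum_increments[OF vg[of "r n"], unfolded sum_subtractf] by (simp only:)
          then have "(\<Sum>i<Suc (r n). (w (r n) i \<omega>)\<^sup>2) \<le> T + 1" using elim(1) by linarith
          from \<delta>[OF elim(2) this[unfolded w_def]] have "\<bar>e (r n)\<bar> \<le> \<epsilon> / 2"
            unfolding e_eq w_def h_def .
          then show ?case using \<epsilon> by simp
        qed
        then show "\<exists>no. \<forall>n\<ge>no. norm (e (r n) - 0) < \<epsilon>"
          by (simp add: eventually_sequentially)
      qed
      moreover have "(\<lambda>n. q (r n) \<omega>) \<longlonglongrightarrow> A \<omega>"
        using LIMSEQ_subseq_LIMSEQ[OF elim(4) r] by (simp add: comp_def)
      ultimately have "(\<lambda>n. g (Xc T \<omega>) - g (Xc 0 \<omega>) - (q (r n) \<omega> - J * T) - \<sigma>\<^sup>2 / 2 * Y1 (r n) \<omega> - e (r n))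
          \<longlonglongrightarrow> g (Xc T \<omega>) - g (Xc 0 \<omega>) - (A \<omega> - J * T) - \<sigma>\<^sup>2 / 2 * 0 - 0"
        by (intro tendsto_intros elim(2))
      then show ?case by (simp add: e_def D_def)
    qed
    have Nm: "N n \<in> borel_measurable M" for n
      unfolding N_def using G1.S_measurable[OF vg] by measurable
    have N2: "integrable M (\<lambda>\<omega>. (N n \<omega>)\<^sup>2)" "expectation (\<lambda>\<omega>. (N n \<omega>)\<^sup>2) \<le> \<sigma>\<^sup>2 * (K\<^sup>2 * T)" for n
      using G1.S_square[OF vg] by (auto simp: N_def power_mult_distrib intro!: mult_left_mono)
    have Dm: "D \<in> borel_measurable M"
      unfolding D_def using A(1) G0.H_measurable T by simp
    have evN: "\<forall>\<^sub>F n in sequentially. expectation (\<lambda>\<omega>. (N (r n) \<omega>)\<^sup>2) \<le> \<sigma>\<^sup>2 * (K\<^sup>2 * T)"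
      by (intro always_eventually allI N2(2))
    have "integrable M (\<lambda>\<omega>. (D \<omega>)\<^sup>2)" "expectation (\<lambda>\<omega>. (D \<omega>)\<^sup>2) \<le> \<sigma>\<^sup>2 * (K\<^sup>2 * T)"
      by (rule L2_bound_of_AE_limit[of "\<lambda>n. N (r n)", OF Nm N2(1) Dm lim evN])+
    note D = this
    have bd: "(A \<omega> / T - J)\<^sup>2 \<le> (8 * K\<^sup>2 + 2 * (D \<omega>)\<^sup>2) / T\<^sup>2" for \<omega>
    proof -
      define G where "G = g (Xc T \<omega>) - g (Xc 0 \<omega>)"
      have "\<bar>G\<bar> \<le> \<bar>2 * K\<bar>"
        unfolding G_def using K(2)[OF Xc_range[of T \<omega>]] K(2)[OF Xc_range[of 0 \<omega>]] by linarith
      then have "G\<^sup>2 \<le> 4 * K\<^sup>2"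
        unfolding abs_le_square_iff by (simp add: power_mult_distrib)
      moreover have "(G - D \<omega>)\<^sup>2 \<le> 2 * G\<^sup>2 + 2 * (D \<omega>)\<^sup>2"
        using zero_le_power2[of "G + D \<omega>"] by (simp add: power2_eq_square algebra_simps)
      ultimately have "(G - D \<omega>)\<^sup>2 \<le> 8 * K\<^sup>2 + 2 * (D \<omega>)\<^sup>2" by linarith
      moreover have "A \<omega> / T - J = (G - D \<omega>) / T"
        unfolding D_def G_def using T by (simp add: field_simps)
      ultimately show ?thesis
        by (simp add: power_divide divide_right_mono)
    qed
    have int: "integrable M (\<lambda>\<omega>. (A \<omega> / T - J)\<^sup>2)"
      by (rule Bochner_Integration.integrable_bound[of _ "\<lambda>\<omega>. (8 * K\<^sup>2 + 2 * (D \<omega>)\<^sup>2) / T\<^sup>2"])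
        (use bd D A in auto)
    have "expectation (\<lambda>\<omega>. (A \<omega> / T - J)\<^sup>2) \<le> expectation (\<lambda>\<omega>. (8 * K\<^sup>2 + 2 * (D \<omega>)\<^sup>2) / T\<^sup>2)"
      using D int bd by (intro integral_mono) auto
    also have "\<dots> = (8 * K\<^sup>2 + 2 * expectation (\<lambda>\<omega>. (D \<omega>)\<^sup>2)) / T\<^sup>2"
      using D prob_space by simp
    also have "\<dots> \<le> (8 * K\<^sup>2 + 2 * (\<sigma>\<^sup>2 * (K\<^sup>2 * T))) / T\<^sup>2"
      using D by (intro divide_right_mono add_left_mono mult_left_mono) auto
    also have "\<dots> = 8 * K\<^sup>2 * (1 / T\<^sup>2) + 2 * \<sigma>\<^sup>2 * K\<^sup>2 * (1 / T)"
      using T by (simp add: field_simps power2_eq_square)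
    also have "\<dots> \<le> c * (1 / T\<^sup>2) + c * (1 / T)"
      unfolding c_def using T by (intro add_mono mult_right_mono) auto
    finally show ?thesis using int by (simp add: distrib_left add.commute)
  qed
  moreover have "0 < c" unfolding c_def using K(1) \<sigma> by (auto intro!: add_pos_nonneg)
  ultimately show thesis
    using that unfolding J_def by blast
qed

text \<open>The mesh found for a single path is random. Negating the claim gives grids with mesh
  tending to 0 and probabilities at least \<open>\<eta>\<close>, whereas pathwise convergence makes
  the indicators vanish eventually almost surely.\<close>

lemma drift_sums_in_probability:
  assumes T: "0 < T" and A: "occupation T A" and \<epsilon>: "0 < \<epsilon>" and \<eta>: "0 < \<eta>"
  defines "P \<equiv> \<lambda>n t \<omega>. grid_sum (\<lambda>t \<omega>. f (Xc t \<omega>)) (\<lambda>t \<omega>. X t \<omega> - L t \<omega> + R t \<omega> - \<sigma> * W t \<omega>) n t \<omega>"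
  shows "\<exists>\<delta>>0. \<forall>n t. grid T \<delta> n t \<longrightarrow> P n t \<in> borel_measurable M \<and> prob {\<omega> \<in> space M. \<epsilon> \<le> \<bar>P n t \<omega> - \<theta>0 * A \<omega>\<bar>} < \<eta>"
proof (rule ccontr)
  assume neg: "\<not> ?thesis"
  note A = occupationD[OF A]
  obtain K where K: "\<forall>y\<in>{l..u}. \<bar>f y\<bar> \<le> K"
    using continuous_on_interval_bounded[OF f] by blast
  interpret Hf: bounded_integrand M F W "\<lambda>t \<omega>. f (Xc t \<omega>)" K
    by (rule bounded_integrand_Xc[OF f]) (use K in auto)
  have [measurable]: "X t \<in> borel_measurable M" "L t \<in> borel_measurable M" "R t \<in> borel_measurable M"
    if "0 \<le> t" for t
    using adapted_XLR[OF that] filtration_measurable[OF that] by auto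
  have Pm: "P n t \<in> borel_measurable M" if "grid T \<delta> n t" for \<delta> n t
    unfolding P_def grid_sum_def using grid_range[OF that]
    by (intro borel_measurable_sum borel_measurable_times borel_measurable_diff borel_measurable_add) auto
  have "\<exists>n t. grid T (inverse (real (Suc k))) n t \<and> \<eta> \<le> prob {\<omega> \<in> space M. \<epsilon> \<le> \<bar>P n t \<omega> - \<theta>0 * A \<omega>\<bar>}" for k
  proof -
    have "0 < inverse (real (Suc k))" by simp
    with neg have "\<not> (\<forall>n t. grid T (inverse (real (Suc k))) n t \<longrightarrow> P n t \<in> borel_measurable M \<and>
        prob {\<omega> \<in> space M. \<epsilon> \<le> \<bar>P n t \<omega> - \<theta>0 * A \<omega>\<bar>} < \<eta>)"
      by blast
    then show ?thesis using Pm unfolding not_less[symmetric] by blast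
  qed
  then obtain n t where g: "\<And>k. grid T (inverse (real (Suc k))) (n k) (t k)"
    and big: "\<And>k. \<eta> \<le> prob {\<omega> \<in> space M. \<epsilon> \<le> \<bar>P (n k) (t k) \<omega> - \<theta>0 * A \<omega>\<bar>}"
    by metis
  note [measurable] = Pm[OF g] A(1)
  have "(\<lambda>k. expectation (indicator {\<omega> \<in> space M. \<epsilon> \<le> \<bar>P (n k) (t k) \<omega> - \<theta>0 * A \<omega>\<bar>} :: 'a \<Rightarrow> real)) \<longlonglongrightarrow> expectation (\<lambda>_. 0)"
  proof (rule integral_dominated_convergence[where w="\<lambda>_. 1"])
    show "AE \<omega> in M. (\<lambda>k. indicator {\<omega> \<in> space M. \<epsilon> \<le> \<bar>P (n k) (t k) \<omega> - \<theta>0 * A \<omega>\<bar>} \<omega> :: real) \<longlonglongrightarrow> 0"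
      using AE_regular A(2)
    proof eventually_elim
      case (elim \<omega>)
      have c: "continuous_on {0..T} (\<lambda>s. f (Xc s \<omega>))"
        using Xc_range by (intro continuous_on_compose2[OF f] continuous_on_subset[OF continuous_Xc[OF elim(1)]]) auto
      have c2: "continuous_on {0..T} (\<lambda>s. \<theta>0 * f (Xc s \<omega>))" by (intro continuous_intros c)
      have "A \<omega> = integral {0..T} (\<lambda>s. (f (Xc s \<omega>))\<^sup>2)"
        unfolding elim(2) by (intro set_borel_integral_eq_integral(2) borel_integrable_atLeastAtMost' continuous_intros c)
      then have A_eq: "integral {0..T} (\<lambda>s. f (Xc s \<omega>) * (\<theta>0 * f (Xc s \<omega>))) = \<theta>0 * A \<omega>"
        by (simp add: power2_eq_square mult.assoc mult.commute mult.left_commute flip: integral_mult_right)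
      obtain \<delta> where \<delta>: "\<delta> > 0" "\<And>n t. grid T \<delta> n t \<Longrightarrow> \<bar>P n t \<omega> - \<theta>0 * A \<omega>\<bar> \<le> \<epsilon> / 2"
        using grid_sum_tendsto_integral[OF c c2 drift_increment[OF elim(1)] T, of "\<epsilon> / 2"] \<epsilon>
        unfolding P_def grid_sum_def A_eq by auto
      have "\<forall>\<^sub>F k in sequentially. inverse (real (Suc k)) < \<delta>"
        using LIMSEQ_inverse_real_of_nat \<delta>(1) by (simp add: order_tendsto_iff)
      then have "\<forall>\<^sub>F k in sequentially. indicator {\<omega> \<in> space M. \<epsilon> \<le> \<bar>P (n k) (t k) \<omega> - \<theta>0 * A \<omega>\<bar>} \<omega> = (0::real)"
      proof eventually_elim
        case (elim k)
        have "grid T \<delta> (n k) (t k)"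
          using g[of k] elim unfolding grid_def by force
        from \<delta>(2)[OF this] show ?case using \<epsilon> by (auto simp: indicator_def)
      qed
      then show ?case by (rule tendsto_eventually)
    qed
  qed (auto simp: indicator_def)
  then have "(\<lambda>k. prob {\<omega> \<in> space M. \<epsilon> \<le> \<bar>P (n k) (t k) \<omega> - \<theta>0 * A \<omega>\<bar>}) \<longlonglongrightarrow> 0"
    by simp
  then have "\<forall>\<^sub>F k in sequentially. prob {\<omega> \<in> space M. \<epsilon> \<le> \<bar>P (n k) (t k) \<omega> - \<theta>0 * A \<omega>\<bar>} < \<eta>"
    using \<eta> by (simp add: order_tendsto_iff)
  then show False
    using big by (auto simp: eventually_sequentially not_less[symmetric])
qed

end

section \<open>Identification of the stochastic integral\<close>

lemma grid_of_time_partition: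
  assumes "time_partition T ts" "mesh_less \<delta> ts"
  shows "grid T \<delta> (length ts - 1) (\<lambda>i. ts ! i)"
  using assms unfolding grid_def time_partition_def mesh_less_def
  by (auto simp: hd_conv_nth last_conv_nth intro: sorted_nth_mono)

lemma left_sum_eq_grid_sum: "left_sum H Y ts = grid_sum H Y (length ts - 1) (\<lambda>i. ts ! i)"
  by (rule ext) (simp add: left_sum_def grid_sum_def)

text \<open>Without fine partitions the condition in \<open>has_stoch_integral\<close> would be
  vacuous; uniqueness of the integral rests on this.\<close>

lemma fine_time_partition_exists:
  assumes "0 < T" "0 < \<delta>"
  shows "\<exists>ts. time_partition T ts \<and> mesh_less \<delta> ts"
proof -
  obtain n where g: "grid T \<delta> n (uniform_grid T n)"
    using eventually_grid_uniform_grid[OF assms] by (auto simp: eventually_sequentially)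
  define ts where "ts = map (uniform_grid T n) [0..<Suc n]"
  have len: "length ts = Suc n" by (simp add: ts_def)
  have nth: "ts ! i = uniform_grid T n i" if "i \<le> n" for i
    unfolding ts_def using that by (subst nth_map) (auto simp del: upt_Suc)
  have "ts \<noteq> []" using len by auto
  moreover have "sorted ts"
    unfolding sorted_iff_nth_mono len using grid_mono[OF g] by (auto simp: nth)
  moreover have "hd ts = 0" "last ts = T"
    using \<open>ts \<noteq> []\<close> g by (simp_all add: hd_conv_nth last_conv_nth len nth grid_def)
  moreover have "mesh_less \<delta> ts"
    using grid_step(2)[OF g] by (simp add: mesh_less_def len nth)
  ultimately show ?thesis
    unfolding time_partition_def by blast
qed

context prob_space
begin

text \<open>One fine partition serves both integrals, and where \<open>J1\<close> and
  \<open>J2\<close> are far apart one of them is away from the sum. The sums need not be measurable,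
  so the exceptional sets are first covered by events of the same outer measure.\<close>

lemma has_stoch_integral_unique:
  assumes T: "0 < T" and J1: "has_stoch_integral M H Y T J1" and J2: "has_stoch_integral M H Y T J2"
  shows "AE \<omega> in M. J1 \<omega> = J2 \<omega>"
proof -
  have [measurable]: "J1 \<in> borel_measurable M" "J2 \<in> borel_measurable M"
    using J1 J2 unfolding has_stoch_integral_def by auto
  let ?D = "\<lambda>e. {\<omega> \<in> space M. 2 * e \<le> \<bar>J1 \<omega> - J2 \<omega>\<bar>}"
  have small: "emeasure M (?D e) \<le> ennreal (2 * \<eta>)" if e: "0 < e" and \<eta>: "0 < \<eta>" for e \<eta>
  proof -
    obtain \<delta>1 where \<delta>1: "\<delta>1 > 0" "\<And>ts. time_partition T ts \<and> mesh_less \<delta>1 ts \<Longrightarrow>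
        outer_measure_of M {\<omega> \<in> space M. e \<le> \<bar>left_sum H Y ts \<omega> - J1 \<omega>\<bar>} < ennreal \<eta>"
      using J1 e \<eta> unfolding has_stoch_integral_def by blast
    obtain \<delta>2 where \<delta>2: "\<delta>2 > 0" "\<And>ts. time_partition T ts \<and> mesh_less \<delta>2 ts \<Longrightarrow>
        outer_measure_of M {\<omega> \<in> space M. e \<le> \<bar>left_sum H Y ts \<omega> - J2 \<omega>\<bar>} < ennreal \<eta>"
      using J2 e \<eta> unfolding has_stoch_integral_def by blast
    obtain ts where "time_partition T ts" "mesh_less (min \<delta>1 \<delta>2) ts"
      using fine_time_partition_exists[OF T, of "min \<delta>1 \<delta>2"] \<delta>1 \<delta>2 by auto
    then have ts: "time_partition T ts \<and> mesh_less \<delta>1 ts" "time_partition T ts \<and> mesh_less \<delta>2 ts"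
      by (auto simp: mesh_less_def)
    let ?Q1 = "{\<omega> \<in> space M. e \<le> \<bar>left_sum H Y ts \<omega> - J1 \<omega>\<bar>}"
    obtain E1 where E1: "E1 \<in> sets M" "?Q1 \<subseteq> E1"
      "emeasure M E1 < ennreal \<eta>"
      using outer_measure_of_attain[of "?Q1" M] \<delta>1(2)[OF ts(1)] by auto
    let ?Q2 = "{\<omega> \<in> space M. e \<le> \<bar>left_sum H Y ts \<omega> - J2 \<omega>\<bar>}"
    obtain E2 where E2: "E2 \<in> sets M" "?Q2 \<subseteq> E2"
      "emeasure M E2 < ennreal \<eta>"
      using outer_measure_of_attain[of "?Q2" M] \<delta>2(2)[OF ts(2)] by auto
    have "?D e \<subseteq> E1 \<union> E2"
    proof
      fix \<omega> assume \<omega>: "\<omega> \<in> ?D e"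
      then have "e \<le> \<bar>left_sum H Y ts \<omega> - J1 \<omega>\<bar> \<or> e \<le> \<bar>left_sum H Y ts \<omega> - J2 \<omega>\<bar>"
        by auto
      then show "\<omega> \<in> E1 \<union> E2" using \<omega> E1(2) E2(2) by auto
    qed
    then have "emeasure M (?D e) \<le> emeasure M (E1 \<union> E2)"
      using E1 E2 by (intro emeasure_mono) auto
    also have "\<dots> \<le> emeasure M E1 + emeasure M E2"
      using E1 E2 by (intro emeasure_subadditive)
    also have "\<dots> \<le> ennreal \<eta> + ennreal \<eta>"
      using E1 E2 by (intro add_mono) (auto intro: less_imp_le)
    also have "\<dots> = ennreal (2 * \<eta>)" using \<eta> by (simp flip: ennreal_plus)
    finally show ?thesis .
  qed
  have "AE \<omega> in M. \<not> 2 * e \<le> \<bar>J1 \<omega> - J2 \<omega>\<bar>" if e: "0 < e" for e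
  proof -
    have "emeasure M (?D e) \<le> 0"
    proof (rule ennreal_le_epsilon)
      fix \<eta> :: real assume "0 < \<eta>"
      with small[OF e, of "\<eta> / 2"] show "emeasure M (?D e) \<le> 0 + ennreal \<eta>"
        by simp
    qed
    then show ?thesis
      by (subst AE_iff_measurable[OF _ refl]) auto
  qed
  then have "AE \<omega> in M. \<forall>k. \<not> 2 * inverse (real (Suc k)) \<le> \<bar>J1 \<omega> - J2 \<omega>\<bar>"
    unfolding AE_all_countable by simp
  then show ?thesis
  proof eventually_elim
    case (elim \<omega>)
    show ?case
    proof (rule ccontr)
      assume "J1 \<omega> \<noteq> J2 \<omega>"
      then obtain k where "inverse (real (Suc k)) < \<bar>J1 \<omega> - J2 \<omega>\<bar> / 2"
        using reals_Archimedean[of "\<bar>J1 \<omega> - J2 \<omega>\<bar> / 2"] by auto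
      then have "2 * inverse (real (Suc k)) \<le> \<bar>J1 \<omega> - J2 \<omega>\<bar>"
        by (simp only: less_divide_eq_numeral1 mult.commute less_imp_le)
      moreover have "\<not> 2 * inverse (real (Suc k)) \<le> \<bar>J1 \<omega> - J2 \<omega>\<bar>"
        using elim by blast
      ultimately show False by blast
    qed
  qed
qed

end

context reflected_diffusion
begin

text \<open>On a regular path the integrator splits into the drift part and
  \<open>\<sigma> * W\<close>. The drift sums converge in probability, the noise sums in mean square
  and so in probability by Chebyshev. Since an integral exists, \<open>SOME\<close> picks one, and
  uniqueness identifies it with the one computed here.\<close>

lemma stoch_integral_eq:
  assumes T: "0 < T" and A: "occupation T A"
    and I: "mean_square_integral M (\<lambda>t \<omega>. f (Xc t \<omega>)) W T I"
  shows "AE \<omega> in M. stoch_integral M (\<lambda>t \<omega>. f (X t \<omega>)) (\<lambda>t \<omega>. X t \<omega> - L t \<omega> + R t \<omega>) T \<omega> = \<theta>0 * A \<omega> + \<sigma> * I \<omega>"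
proof -
  note conv = mean_square_integralD(2)[OF I] and I = mean_square_integralD(1)[OF I]
  let ?H = "\<lambda>t \<omega>. f (Xc t \<omega>)"
  let ?V = "\<lambda>t \<omega>. X t \<omega> - L t \<omega> + R t \<omega> - \<sigma> * W t \<omega>"
  let ?Y = "\<lambda>t \<omega>. X t \<omega> - L t \<omega> + R t \<omega>"
  obtain K where K: "\<forall>y\<in>{l..u}. \<bar>f y\<bar> \<le> K"
    using continuous_on_interval_bounded[OF f] by blast
  interpret Hf: bounded_integrand M F W ?H K
    by (rule bounded_integrand_Xc[OF f]) (use K in auto)
  obtain N0 where N0: "N0 \<in> null_sets M" "{\<omega> \<in> space M. \<not> regular \<omega>} \<subseteq> N0"
    using AE_regular unfolding eventually_ae_filter by blast
  have "has_stoch_integral M (\<lambda>t \<omega>. f (X t \<omega>)) ?Y T (\<lambda>\<omega>. \<theta>0 * A \<omega> + \<sigma> * I \<omega>)"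
    unfolding has_stoch_integral_def
  proof (intro conjI allI impI)
    show "(\<lambda>\<omega>. \<theta>0 * A \<omega> + \<sigma> * I \<omega>) \<in> borel_measurable M" using occupationD[OF A] I by simp
    fix \<epsilon> \<eta> :: real assume \<epsilon>: "0 < \<epsilon>" and \<eta>: "0 < \<eta>"
    obtain \<delta>1 where \<delta>1: "\<delta>1 > 0" "\<And>n t. grid T \<delta>1 n t \<Longrightarrow> grid_sum ?H ?V n t \<in> borel_measurable M"
      "\<And>n t. grid T \<delta>1 n t \<Longrightarrow> prob {\<omega> \<in> space M. \<epsilon> / 2 \<le> \<bar>grid_sum ?H ?V n t \<omega> - \<theta>0 * A \<omega>\<bar>} < \<eta> / 2"
      using drift_sums_in_probability[OF T A, of "\<epsilon> / 2" "\<eta> / 2"] \<epsilon> \<eta> by auto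
    \<comment> \<open>Chosen so that Chebyshev's inequality at level
      \<open>\<epsilon> / (2 * \<sigma>)\<close> gives \<open>\<eta> / 4\<close>; with less than
      \<open>\<eta> / 2\<close> for the drift the total stays below \<open>\<eta>\<close>.\<close>
    define \<beta> where "\<beta> = \<eta> / 4 * (\<epsilon> / (2 * \<sigma>))\<^sup>2"
    have "0 < \<beta>" unfolding \<beta>_def using \<eta> \<epsilon> \<sigma> by simp
    from conv[OF this] obtain \<delta>2 where \<delta>2: "\<delta>2 > 0"
      "\<forall>n t. grid T \<delta>2 n t \<longrightarrow> integrable M (\<lambda>\<omega>. (grid_sum ?H W n t \<omega> - I \<omega>)\<^sup>2) \<and>
        expectation (\<lambda>\<omega>. (grid_sum ?H W n t \<omega> - I \<omega>)\<^sup>2) \<le> \<beta>"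
      by blast
    show "\<exists>\<delta>>0. \<forall>ts. time_partition T ts \<and> mesh_less \<delta> ts \<longrightarrow>
      outer_measure_of M {\<omega> \<in> space M. \<epsilon> \<le> \<bar>left_sum (\<lambda>t \<omega>. f (X t \<omega>)) ?Y ts \<omega> - (\<theta>0 * A \<omega> + \<sigma> * I \<omega>)\<bar>} < ennreal \<eta>"
    proof (intro exI[of _ "min \<delta>1 \<delta>2"] conjI allI impI)
      show "0 < min \<delta>1 \<delta>2" using \<delta>1 \<delta>2 by simp
      fix ts assume ts: "time_partition T ts \<and> mesh_less (min \<delta>1 \<delta>2) ts"
      let ?B = "{\<omega> \<in> space M. \<epsilon> \<le> \<bar>left_sum (\<lambda>t \<omega>. f (X t \<omega>)) ?Y ts \<omega> - (\<theta>0 * A \<omega> + \<sigma> * I \<omega>)\<bar>}"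
      define n t where "n = length ts - 1" and "t = (\<lambda>i. ts ! i)"
      have "grid T (min \<delta>1 \<delta>2) n t"
        unfolding n_def t_def using ts grid_of_time_partition by blast
      then have g: "grid T \<delta>1 n t" "grid T \<delta>2 n t"
        by (auto simp: grid_def)
      have L2: "integrable M (\<lambda>\<omega>. (grid_sum ?H W n t \<omega> - I \<omega>)\<^sup>2)"
        "expectation (\<lambda>\<omega>. (grid_sum ?H W n t \<omega> - I \<omega>)\<^sup>2) \<le> \<beta>"
        using \<delta>2(2) g(2) by blast+
      define E1 where "E1 = {\<omega> \<in> space M. \<epsilon> / 2 \<le> \<bar>grid_sum ?H ?V n t \<omega> - \<theta>0 * A \<omega>\<bar>}"
      define E2 where "E2 = {\<omega> \<in> space M. \<epsilon> / (2 * \<sigma>) \<le> \<bar>grid_sum ?H W n t \<omega> - I \<omega>\<bar>}"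
      have E [measurable]: "E1 \<in> sets M" "E2 \<in> sets M"
        unfolding E1_def E2_def using \<delta>1(2)[OF g(1)] Hf.S_measurable[OF g(2)] occupationD(1)[OF A] I by measurable
      have "prob E2 \<le> expectation (\<lambda>\<omega>. (grid_sum ?H W n t \<omega> - I \<omega>)\<^sup>2) / (\<epsilon> / (2 * \<sigma>))\<^sup>2"
        unfolding E2_def using L2(1) Hf.S_measurable[OF g(2)] I \<epsilon> \<sigma>
        by (intro second_moment_method) auto
      also have "\<dots> \<le> \<beta> / (\<epsilon> / (2 * \<sigma>))\<^sup>2"
        using L2(2) by (intro divide_right_mono) auto
      also have "\<dots> = \<eta> / 4" unfolding \<beta>_def using \<epsilon> \<sigma> by simp
      finally have P2: "prob E2 \<le> \<eta> / 4" .
      \<comment> \<open>Outside \<open>regular\<close> nothing is known about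
        \<open>f (X t \<omega>)\<close>, so \<open>?B\<close> may fail to be measurable; the null
        set \<open>N0\<close> absorbs these paths.\<close>
      have sub: "?B \<subseteq> (E1 \<union> E2) \<union> N0"
      proof
        fix \<omega> assume \<omega>: "\<omega> \<in> ?B"
        show "\<omega> \<in> (E1 \<union> E2) \<union> N0"
        proof (cases "regular \<omega>")
          case False
          then show ?thesis using \<omega> N0 by auto
        next
          case True
          have "left_sum (\<lambda>t \<omega>. f (X t \<omega>)) ?Y ts \<omega> = grid_sum ?H ?V n t \<omega> + \<sigma> * grid_sum ?H W n t \<omega>"
            unfolding left_sum_eq_grid_sum grid_sum_def n_def[symmetric] sum_distrib_left sum.distrib[symmetric]
            using grid_range(1)[OF g(1)] by (intro sum.cong refl) (simp add: Xc_eq[OF True] t_def algebra_simps)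
          then have "\<epsilon> \<le> \<bar>(grid_sum ?H ?V n t \<omega> - \<theta>0 * A \<omega>) + \<sigma> * (grid_sum ?H W n t \<omega> - I \<omega>)\<bar>"
            using \<omega> by (simp add: algebra_simps)
          also have "\<dots> \<le> \<bar>grid_sum ?H ?V n t \<omega> - \<theta>0 * A \<omega>\<bar> + \<sigma> * \<bar>grid_sum ?H W n t \<omega> - I \<omega>\<bar>"
            using \<sigma> by (intro order_trans[OF abs_triangle_ineq]) (simp add: abs_mult)
          finally have *: "\<epsilon> \<le> \<dots>" .
          show ?thesis
          proof (cases "\<omega> \<in> E1")
            case False
            then have "\<bar>grid_sum ?H ?V n t \<omega> - \<theta>0 * A \<omega>\<bar> < \<epsilon> / 2" using \<omega> by (auto simp: E1_def)
            with * have "\<epsilon> / 2 \<le> \<sigma> * \<bar>grid_sum ?H W n t \<omega> - I \<omega>\<bar>" by linarith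
            then have "\<omega> \<in> E2" using \<sigma> \<omega> by (simp add: E2_def field_simps)
            then show ?thesis by simp
          qed simp
        qed
      qed
      have "outer_measure_of M ?B
          \<le> outer_measure_of M ((E1 \<union> E2) \<union> N0)"
        by (rule outer_measure_of_mono[OF sub])
      also have "\<dots> = emeasure M (E1 \<union> E2)"
        using N0 E by (subst outer_measure_of_eq) (auto intro: emeasure_Un_null_set)
      also have "\<dots> \<le> emeasure M E1 + emeasure M E2"
        by (intro emeasure_subadditive) auto
      also have "\<dots> = ennreal (prob E1 + prob E2)"
        by (simp add: emeasure_eq_measure)
      also have "\<dots> < ennreal \<eta>"
        using P2 \<delta>1(3)[OF g(1), folded E1_def] \<eta> by (intro ennreal_lessI) auto
      finally show "outer_measure_of M ?B < ennreal \<eta>" .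
    qed
  qed
  note J = this
  have "has_stoch_integral M (\<lambda>t \<omega>. f (X t \<omega>)) ?Y T (stoch_integral M (\<lambda>t \<omega>. f (X t \<omega>)) ?Y T)"
    unfolding stoch_integral_def by (rule someI[of "has_stoch_integral M (\<lambda>t \<omega>. f (X t \<omega>)) ?Y T", OF J])
  from has_stoch_integral_unique[OF T this J] show ?thesis .
qed

end

section \<open>The maximum likelihood estimator\<close>

lemma abs_exp_diff_le:
  fixes x y m :: real
  assumes "x \<le> m" "y \<le> m"
  shows "\<bar>exp x - exp y\<bar> \<le> exp m * \<bar>x - y\<bar>"
proof -
  have *: "exp b - exp a \<le> exp m * (b - a)" if "a \<le> b" "b \<le> m" for a b :: real
  proof -
    have "1 - exp (a - b) \<le> b - a"
      using exp_ge_add_one_self[of "a - b"] by linarith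
    then have "exp b * (1 - exp (a - b)) \<le> exp m * (b - a)"
      using that by (intro mult_mono) auto
    then show ?thesis
      by (simp add: right_diff_distrib exp_diff)
  qed
  show ?thesis
    using *[of x y] *[of y x] assms by (cases "x \<le> y") auto
qed

text \<open>The price of replacing a random normalisation by a deterministic one, with
  \<open>a\<close> the information rate and \<open>b\<close> its limit: the phase is Lipschitz, and
  so is the exponential weight on values below \<open>K\<close>.\<close>

lemma cmod_iexp_exp_diff_le:
  fixes p s a b K :: real
  assumes s: "0 \<le> s" and K: "a \<le> K" "b \<le> K"
  shows "cmod (iexp (- (p * (a - b))) * of_real (exp (s * b)) - of_real (exp (s * a)))
    \<le> (\<bar>p\<bar> + s) * exp (s * K) * \<bar>a - b\<bar>"
proof -
  have sK: "s * a \<le> s * K" "s * b \<le> s * K" using s K by (auto intro: mult_left_mono)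
  have "iexp (- (p * (a - b))) * of_real (exp (s * b)) - of_real (exp (s * a)) =
      (iexp (- (p * (a - b))) - 1) * of_real (exp (s * b)) + of_real (exp (s * b) - exp (s * a))"
    by (simp add: algebra_simps)
  then have "cmod (iexp (- (p * (a - b))) * of_real (exp (s * b)) - of_real (exp (s * a))) \<le>
      cmod (iexp (- (p * (a - b))) - 1) * exp (s * b) + \<bar>exp (s * b) - exp (s * a)\<bar>"
    by (simp only:) (rule order_trans[OF norm_triangle_ineq], simp add: norm_mult del: of_real_diff of_real_exp)
  also have "\<dots> \<le> \<bar>p * (a - b)\<bar> * exp (s * K) + exp (s * K) * \<bar>s * b - s * a\<bar>"
  proof (rule add_mono[OF mult_mono abs_exp_diff_le[OF sK(2,1)]])
    show "cmod (iexp (- (p * (a - b))) - 1) \<le> \<bar>p * (a - b)\<bar>"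
      using iexp_approx1[of "- (p * (a - b))" 0] by simp
  qed (use sK in auto)
  also have "\<dots> = (\<bar>p\<bar> + s) * exp (s * K) * \<bar>a - b\<bar>"
    using s unfolding right_diff_distrib[symmetric] abs_mult
    by (simp add: abs_minus_commute[of b a] algebra_simps)
  finally show ?thesis .
qed

text \<open>\<open>d\<close> is the point of \<open>[-\<rho>, \<rho>]\<close> nearest to
  \<open>\<mu>\<close>, and this projection moves no point across an interior level
  \<open>c\<close>. At \<open>c = \<rho>\<close> the left side would always hold, which explains the
  strict bound.\<close>

lemma argmin_interval_le_iff:
  fixes d \<mu> \<rho> c :: real
  assumes d: "\<bar>d\<bar> \<le> \<rho>" and c: "\<bar>c\<bar> < \<rho>" and min: "\<And>e. \<bar>e\<bar> \<le> \<rho> \<Longrightarrow> (d - \<mu>)\<^sup>2 \<le> (e - \<mu>)\<^sup>2"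
  shows "d \<le> c \<longleftrightarrow> \<mu> \<le> c"
proof -
  have min': "\<bar>d - \<mu>\<bar> \<le> \<bar>e - \<mu>\<bar>" if "\<bar>e\<bar> \<le> \<rho>" for e
    using min[OF that] by (simp add: abs_le_square_iff)
  show ?thesis
  proof
    assume "d \<le> c"
    show "\<mu> \<le> c"
    proof (rule ccontr)
      assume "\<not> \<mu> \<le> c"
      \<comment> \<open>The competitor \<open>min \<mu> \<rho>\<close> is feasible and strictly
        nearer to \<open>\<mu>\<close> than any \<open>d \<le> c\<close>.\<close>
      moreover from this have "\<bar>min \<mu> \<rho>\<bar> \<le> \<rho>" using c by (auto simp: abs_le_iff min_def)
      ultimately show False
        using min'[of "min \<mu> \<rho>"] \<open>d \<le> c\<close> c by (auto simp: abs_if min_def split: if_splits)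
    qed
  next
    assume "\<mu> \<le> c"
    then show "d \<le> c" using min'[of c] c by (auto simp: abs_if split: if_splits)
  qed
qed

text \<open>The comparison family \<open>Q z\<close> may change with the point at which the
  distribution functions are evaluated; this is what allows a pivot depending on
  \<open>z\<close>.\<close>

lemma weak_conv_filter_at_topI:
  assumes "\<And>z. isCont (cdf N) z \<Longrightarrow> ((\<lambda>T. cdf (Q z T) z) \<longlongrightarrow> cdf N z) at_top"
    and "\<And>z. ((\<lambda>T. cdf (P T) z - cdf (Q z T) z) \<longlongrightarrow> 0) at_top"
  shows "weak_conv_filter P N at_top"
  unfolding weak_conv_filter_def
proof (intro allI impI)
  fix z assume "isCont (cdf N) z"
  from tendsto_add[OF assms(2)[of z] assms(1)[OF this]]
  show "((\<lambda>T. cdf (P T) z) \<longlongrightarrow> cdf N z) at_top" by simp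
qed

context reflected_diffusion
begin

section \<open>Measurable versions of the score and the information\<close>

abbreviation J :: real where "J \<equiv> limit_information f \<theta>0 \<sigma> l u"

text \<open>The two variables form a pair so that one choice fixes both and the identities linking
  them survive. Measurability is stated for every \<open>T\<close>, so that it carries no side
  condition.\<close>

definition score_information :: "real \<Rightarrow> ('a \<Rightarrow> real) \<times> ('a \<Rightarrow> real) \<Rightarrow> bool"
  where "score_information T p \<longleftrightarrow> fst p \<in> borel_measurable M \<and> snd p \<in> borel_measurable M \<and>
    (0 < T \<longrightarrow> occupation T (snd p) \<and>
      (\<forall>\<kappa>. expectation (\<lambda>\<omega>. exp (\<i> * of_real (\<kappa> * fst p \<omega>) + of_real (\<kappa>\<^sup>2 / 2 * snd p \<omega>))) = 1) \<and>
      (AE \<omega> in M. stoch_integral M (\<lambda>t \<omega>. f (X t \<omega>)) (\<lambda>t \<omega>. X t \<omega> - L t \<omega> + R t \<omega>) T \<omega>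
        = \<theta>0 * snd p \<omega> + \<sigma> * fst p \<omega>))"

lemma score_information_exists: "\<exists>p. score_information T p"
proof (cases "0 < T")
  case False
  then show ?thesis by (intro exI[of _ "(\<lambda>_. 0, \<lambda>_. 0)"]) (auto simp: score_information_def)
next
  case T: True
  obtain K where K: "\<forall>y\<in>{l..u}. \<bar>f y\<bar> \<le> K"
    using continuous_on_interval_bounded[OF f] by blast
  interpret Hf: bounded_integrand M F W "\<lambda>t \<omega>. f (Xc t \<omega>)" K
    by (rule bounded_integrand_Xc[OF f]) (use K in auto)
  have "continuous_on UNIV (\<lambda>y::real. y\<^sup>2)" by (intro continuous_intros)
  then obtain A where A: "A \<in> borel_measurable M" "AE \<omega> in M. A \<omega> = (LINT s:{0..T}|lborel. (f (Xc s \<omega>))\<^sup>2)"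
    by (rule Hf.time_integral_measurable_version[OF T])
  then have occ: "occupation T A" by (simp add: occupation_def)
  obtain I where I: "mean_square_integral M (\<lambda>t \<omega>. f (Xc t \<omega>)) W T I"
    by (rule Hf.mean_square_integral_exists[OF T])
  have "score_information T (I, A)"
    unfolding score_information_def fst_conv snd_conv
    using mean_square_integralD(1)[OF I] A(1) occ Hf.exponential_martingale[OF T I A] stoch_integral_eq[OF T occ I]
    by blast
  then show ?thesis by blast
qed

text \<open>The bound on \<open>f\<close> along the path gives a deterministic \<open>K\<close>; it
  is raised to at least \<open>J\<close> because the exponential estimate takes one bound for the
  rate and its limit.\<close>

lemma information_bounded:
  obtains K where "J \<le> K"
    and "\<And>T A. 0 < T \<Longrightarrow> occupation T A \<Longrightarrow> AE \<omega> in M. A \<omega> / T \<le> K"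
proof -
  obtain C where C: "\<forall>y\<in>{l..u}. \<bar>f y\<bar> \<le> C"
    using continuous_on_interval_bounded[OF f] by blast
  have "AE \<omega> in M. A \<omega> / T \<le> max J (C\<^sup>2)"
    if T: "0 < T" and A: "occupation T A" for T A
    using occupationD(2)[OF A] AE_regular
  proof eventually_elim
    case (elim \<omega>)
    have c: "continuous_on {0..T} (\<lambda>s. (f (Xc s \<omega>))\<^sup>2)"
      using Xc_range by (intro continuous_intros continuous_on_compose2[OF f]
        continuous_on_subset[OF continuous_Xc[OF elim(2)]]) auto
    have "A \<omega> = integral {0..T} (\<lambda>s. (f (Xc s \<omega>))\<^sup>2)"
      unfolding elim(1) by (intro set_borel_integral_eq_integral(2) borel_integrable_atLeastAtMost' c)
    also have "\<dots> \<le> C\<^sup>2 * (T - 0)"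
    proof -
      have "(f (Xc s \<omega>))\<^sup>2 \<le> C\<^sup>2" for s
      proof -
        have "\<bar>f (Xc s \<omega>)\<bar> \<le> C" using C Xc_range by blast
        then have "\<bar>f (Xc s \<omega>)\<bar>\<^sup>2 \<le> C\<^sup>2" by (intro power_mono) auto
        then show ?thesis by simp
      qed
      then have "norm (integral {0..T} (\<lambda>s. (f (Xc s \<omega>))\<^sup>2)) \<le> C\<^sup>2 * (T - 0)"
        using T by (intro integral_bound c) auto
      then show ?thesis by simp
    qed
    finally show ?case using T by (simp add: divide_le_eq le_max_iff_disj)
  qed
  then show thesis using that[of "max J (C\<^sup>2)"] by simp
qed

end

locale mle_setting = reflected_diffusion +
  fixes \<rho> :: real and \<theta>hat :: "real \<Rightarrow> 'a \<Rightarrow> real"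
  assumes \<rho>: "0 < \<rho>" and J_pos: "0 < limit_information f \<theta>0 \<sigma> l u"
    and \<theta>hat_measurable: "\<And>T. 0 < T \<Longrightarrow> \<theta>hat T \<in> borel_measurable M"
    and \<theta>hat_arg_max: "\<And>T. 0 < T \<Longrightarrow> AE \<omega> in M.
           is_arg_max (log_likelihood_rate M f \<sigma> X L R T \<omega>) (\<lambda>\<theta>. \<bar>\<theta> - \<theta>0\<bar> \<le> \<rho>) (\<theta>hat T \<omega>)"
begin

definition score :: "real \<Rightarrow> 'a \<Rightarrow> real"
  where "score T = fst (SOME p. score_information T p)"

definition information :: "real \<Rightarrow> 'a \<Rightarrow> real"
  where "information T = snd (SOME p. score_information T p)"

lemma
  shows score_measurable [measurable]: "score T \<in> borel_measurable M"
    and information_measurable [measurable]: "information T \<in> borel_measurable M"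
    and occupation_information: "0 < T \<Longrightarrow> occupation T (information T)"
    and exp_score: "0 < T \<Longrightarrow> expectation (\<lambda>\<omega>. exp (\<i> * of_real (\<kappa> * score T \<omega>) + of_real (\<kappa>\<^sup>2 / 2 * information T \<omega>))) = 1"
    and stoch_integral_score: "0 < T \<Longrightarrow> AE \<omega> in M. stoch_integral M (\<lambda>t \<omega>. f (X t \<omega>)) (\<lambda>t \<omega>. X t \<omega> - L t \<omega> + R t \<omega>) T \<omega>
      = \<theta>0 * information T \<omega> + \<sigma> * score T \<omega>"
  using someI_ex[OF score_information_exists[of T]]
  unfolding score_information_def[of T "Eps _"] score_def[symmetric] information_def[symmetric] by blast+

text \<open>The dependence on \<open>z\<close> absorbs the random denominator: where the information is positive,
  \<open>sqrt T * (\<theta>hat T - \<theta>0) \<le> z\<close> means \<open>pivot z T \<le> z\<close>.\<close>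

definition pivot :: "real \<Rightarrow> real \<Rightarrow> 'a \<Rightarrow> real"
  where "pivot z T \<omega> = (\<sigma> * score T \<omega> / sqrt T - z * (information T \<omega> / T - J)) / J"

lemma pivot_measurable [measurable]: "pivot z T \<in> borel_measurable M"
  unfolding pivot_def by measurable

text \<open>The second moment bound of order \<open>1 / T\<close> gives convergence in mean of order
  \<open>1 / sqrt T\<close>, the form used both for the characteristic functions and in Markov's
  inequality.\<close>

lemma information_L1_tendsto:
  "((\<lambda>T. expectation (\<lambda>\<omega>. \<bar>information T \<omega> / T - J\<bar>)) \<longlongrightarrow> 0) at_top"
  and information_L1_integrable: "0 < T \<Longrightarrow> integrable M (\<lambda>\<omega>. \<bar>information T \<omega> / T - J\<bar>)"
proof -
  obtain c where c: "0 < c" and L2: "\<And>T A. 0 < T \<Longrightarrow> occupation T A \<Longrightarrow>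
        integrable M (\<lambda>\<omega>. (A \<omega> / T - J)\<^sup>2) \<and> expectation (\<lambda>\<omega>. (A \<omega> / T - J)\<^sup>2) \<le> c * (1 / T + 1 / T\<^sup>2)"
    using occupation_integral_L2 by blast
  have *: "integrable M (\<lambda>\<omega>. information T \<omega> / T - J)"
    "expectation (\<lambda>\<omega>. \<bar>information T \<omega> / T - J\<bar>) \<le> sqrt (c * (1 / T + 1 / T\<^sup>2))" if T: "0 < T" for T
  proof -
    have pos: "0 < c * (1 / T + 1 / T\<^sup>2)" using c T by (intro mult_pos_pos add_pos_pos) auto
    have m: "(\<lambda>\<omega>. information T \<omega> / T - J) \<in> borel_measurable M" by measurable
    have i: "integrable M (\<lambda>\<omega>. (information T \<omega> / T - J)\<^sup>2)"
      and e: "expectation (\<lambda>\<omega>. (information T \<omega> / T - J)\<^sup>2) \<le> (sqrt (c * (1 / T + 1 / T\<^sup>2)))\<^sup>2"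
      using L2[OF T occupation_information[OF T]] pos by simp_all
    have "0 < sqrt (c * (1 / T + 1 / T\<^sup>2))" using pos by simp
    from L1_le_L2[OF m i e this] show "integrable M (\<lambda>\<omega>. information T \<omega> / T - J)"
      "expectation (\<lambda>\<omega>. \<bar>information T \<omega> / T - J\<bar>) \<le> sqrt (c * (1 / T + 1 / T\<^sup>2))" .
  qed
  show "integrable M (\<lambda>\<omega>. \<bar>information T \<omega> / T - J\<bar>)" if "0 < T"
    using *(1)[OF that] by simp
  show "((\<lambda>T. expectation (\<lambda>\<omega>. \<bar>information T \<omega> / T - J\<bar>)) \<longlongrightarrow> 0) at_top"
  proof (rule tendsto_sandwich[of "\<lambda>_. 0"])
    show "\<forall>\<^sub>F T in at_top. expectation (\<lambda>\<omega>. \<bar>information T \<omega> / T - J\<bar>) \<le> sqrt (c * (1 / T + 1 / T\<^sup>2))"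
      using eventually_gt_at_top[of 0] by eventually_elim (rule *(2))
    have "((\<lambda>T::real. 1 / T) \<longlongrightarrow> 0) at_top"
      using tendsto_inverse_0_at_top[OF filterlim_ident] by (simp add: inverse_eq_divide)
    then have "((\<lambda>T. sqrt (c * (1 / T + (1 / T)\<^sup>2))) \<longlongrightarrow> sqrt (c * (0 + 0\<^sup>2))) at_top"
      by (intro tendsto_intros)
    then show "((\<lambda>T. sqrt (c * (1 / T + 1 / T\<^sup>2))) \<longlongrightarrow> 0) at_top"
      by (simp add: power_divide)
  qed auto
qed

text \<open>Since \<open>information T / T\<close> is almost constant, the normalisation of the exponential martingale
  is almost deterministic, which gives the martingale central limit theorem and Slutsky's lemma in one
  step.\<close>

lemma char_pivot_tendsto:
  "((\<lambda>T. char (distr M borel (pivot z T)) \<kappa>) \<longlongrightarrow> char (normal_distribution 0 (\<sigma>\<^sup>2 * inverse J)) \<kappa>) at_top"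
proof -
  obtain K where JK: "J \<le> K" and "\<And>T A. 0 < T \<Longrightarrow> occupation T A \<Longrightarrow> AE \<omega> in M. A \<omega> / T \<le> K"
    by (rule information_bounded) (rule that)
  note K = this(2)[OF _ occupation_information]
  \<comment> \<open>The score enters the pivot at frequency
    \<open>\<nu> = \<kappa> * \<sigma> / (J * sqrt T)\<close>, for which
    \<open>\<nu>\<^sup>2 / 2 * information T\<close> is \<open>s\<close> times the information rate;
    \<open>- (s * J)\<close> is the exponent of the limiting Gaussian.\<close>
  define s where "s = \<kappa>\<^sup>2 * \<sigma>\<^sup>2 / (2 * J\<^sup>2)"
  define p where "p = \<kappa> * z / J"
  have s0: "0 \<le> s" by (simp add: s_def)
  define a where "a T \<omega> = information T \<omega> / T" for T \<omega>
  define c where "c = (\<bar>p\<bar> + s) * exp (s * K)"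
  have bound: "cmod (char (distr M borel (pivot z T)) \<kappa> * of_real (exp (s * J)) - 1) \<le> c * expectation (\<lambda>\<omega>. \<bar>a T \<omega> - J\<bar>)"
    if T: "0 < T" for T
  proof -
    define \<nu> where "\<nu> = \<kappa> * \<sigma> / (J * sqrt T)"
    define e where "e \<omega> = iexp (\<nu> * score T \<omega>)" for \<omega>
    have [measurable]: "e \<in> borel_measurable M" "a T \<in> borel_measurable M"
      unfolding e_def a_def by measurable
    have ne: "cmod (e \<omega>) = 1" for \<omega> by (simp add: e_def)
    have \<nu>2: "\<nu>\<^sup>2 / 2 * information T \<omega> = s * a T \<omega>" for \<omega>
      using T by (simp add: \<nu>_def s_def a_def power_mult_distrib power_divide)
    have AEa: "AE \<omega> in M. a T \<omega> \<le> K" using K[OF T T] by (simp add: a_def)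
    have one: "expectation (\<lambda>\<omega>. e \<omega> * of_real (exp (s * a T \<omega>))) = 1"
      using exp_score[OF T, of \<nu>] unfolding \<nu>2 by (simp add: e_def exp_add flip: exp_of_real)
    have "char (distr M borel (pivot z T)) \<kappa> = expectation (\<lambda>\<omega>. iexp (\<kappa> * pivot z T \<omega>))"
      unfolding char_def by (subst integral_distr) auto
    also have "(\<lambda>\<omega>. iexp (\<kappa> * pivot z T \<omega>)) = (\<lambda>\<omega>. e \<omega> * iexp (- (p * (a T \<omega> - J))))"
    proof
      fix \<omega>
      have "\<kappa> * pivot z T \<omega> = \<nu> * score T \<omega> + - (p * (a T \<omega> - J))"
        using J_pos T by (simp add: pivot_def \<nu>_def p_def a_def field_simps)
      then show "iexp (\<kappa> * pivot z T \<omega>) = e \<omega> * iexp (- (p * (a T \<omega> - J)))"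
        by (simp only: e_def of_real_add distrib_left exp_add)
    qed
    finally have ch: "char (distr M borel (pivot z T)) \<kappa> = expectation (\<lambda>\<omega>. e \<omega> * iexp (- (p * (a T \<omega> - J))))" .
    have i1: "integrable M (\<lambda>\<omega>. e \<omega> * iexp (- (p * (a T \<omega> - J))))"
      by (rule integrable_const_bound[of _ 1]) (auto simp: norm_mult ne)
    have i2: "integrable M (\<lambda>\<omega>. e \<omega> * of_real (exp (s * a T \<omega>)))"
    proof (rule integrable_const_bound[of _ "exp (s * K)"])
      show "AE \<omega> in M. cmod (e \<omega> * of_real (exp (s * a T \<omega>))) \<le> exp (s * K)"
        using AEa by eventually_elim (use s0 in \<open>auto simp: norm_mult ne intro: mult_left_mono\<close>)
    qed measurable
    \<comment> \<open>The subtracted 1 is written as the mean of the exponential martingale, so the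
      factor \<open>e\<close> of modulus 1 comes out and the remaining factor only compares the rate
      with \<open>J\<close>.\<close>
    have eq: "char (distr M borel (pivot z T)) \<kappa> * of_real (exp (s * J)) - 1 =
        expectation (\<lambda>\<omega>. e \<omega> * (iexp (- (p * (a T \<omega> - J))) * of_real (exp (s * J)) - of_real (exp (s * a T \<omega>))))"
    proof -
      have "expectation (\<lambda>\<omega>. e \<omega> * (iexp (- (p * (a T \<omega> - J))) * of_real (exp (s * J)) - of_real (exp (s * a T \<omega>)))) =
          expectation (\<lambda>\<omega>. e \<omega> * iexp (- (p * (a T \<omega> - J))) * of_real (exp (s * J)) - e \<omega> * of_real (exp (s * a T \<omega>)))"
        by (simp only: right_diff_distrib mult.assoc)
      also have "\<dots> = expectation (\<lambda>\<omega>. e \<omega> * iexp (- (p * (a T \<omega> - J)))) * of_real (exp (s * J)) - 1"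
        using i1 i2 one by (subst Bochner_Integration.integral_diff) (auto simp only: integral_mult_left_zero integrable_mult_left)
      finally show ?thesis unfolding ch by simp
    qed
    have ia: "integrable M (\<lambda>\<omega>. c * \<bar>a T \<omega> - J\<bar>)"
      using information_L1_integrable[OF T] by (simp add: a_def)
    have le: "AE \<omega> in M. cmod (e \<omega> * (iexp (- (p * (a T \<omega> - J))) * of_real (exp (s * J)) - of_real (exp (s * a T \<omega>))))
        \<le> c * \<bar>a T \<omega> - J\<bar>"
      using AEa
    proof eventually_elim
      case (elim \<omega>)
      from cmod_iexp_exp_diff_le[OF s0 elim JK] show ?case
        unfolding c_def norm_mult ne mult_1 .
    qed
    have "cmod (char (distr M borel (pivot z T)) \<kappa> * of_real (exp (s * J)) - 1) \<le> expectation (\<lambda>\<omega>. c * \<bar>a T \<omega> - J\<bar>)"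
      unfolding eq
    proof (rule order_trans[OF integral_norm_bound integral_mono_AE[OF _ ia le]])
      show "integrable M (\<lambda>\<omega>. cmod (e \<omega> * (iexp (- (p * (a T \<omega> - J))) * of_real (exp (s * J)) - of_real (exp (s * a T \<omega>)))))"
        by (rule Bochner_Integration.integrable_bound[OF ia]) (use le in \<open>auto intro: order_trans[OF _ abs_ge_self]\<close>)
    qed
    then show ?thesis by simp
  qed
  have "((\<lambda>T. char (distr M borel (pivot z T)) \<kappa> * of_real (exp (s * J)) - 1) \<longlongrightarrow> 0) at_top"
  proof (rule Lim_null_comparison)
    show "\<forall>\<^sub>F T in at_top. norm (char (distr M borel (pivot z T)) \<kappa> * of_real (exp (s * J)) - 1) \<le> c * expectation (\<lambda>\<omega>. \<bar>a T \<omega> - J\<bar>)"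
      using eventually_gt_at_top[of 0] by eventually_elim (rule bound)
    show "((\<lambda>T. c * expectation (\<lambda>\<omega>. \<bar>a T \<omega> - J\<bar>)) \<longlongrightarrow> 0) at_top"
      using tendsto_mult_left[OF information_L1_tendsto, of c] by (simp add: a_def)
  qed
  then have lim: "((\<lambda>T. (char (distr M borel (pivot z T)) \<kappa> * of_real (exp (s * J)) - 1 + 1) * of_real (exp (- (s * J))))
      \<longlongrightarrow> (0 + 1) * of_real (exp (- (s * J)))) at_top"
    by (intro tendsto_intros)
  have "complex_of_real (exp (s * J)) * of_real (exp (- (s * J))) = of_real (exp (s * J) * exp (- (s * J)))"
    by (rule of_real_mult[symmetric])
  also have "exp (s * J) * exp (- (s * J)) = 1"
    by (simp add: exp_minus)
  finally have "complex_of_real (exp (s * J)) * of_real (exp (- (s * J))) = 1" by simp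
  then have "((\<lambda>T. char (distr M borel (pivot z T)) \<kappa>) \<longlongrightarrow> of_real (exp (- (s * J)))) at_top"
    using lim by (simp only: diff_add_cancel mult.assoc mult_1_right add_0 mult_1_left)
  moreover have "complex_of_real (exp (- (s * J))) = char (normal_distribution 0 (\<sigma>\<^sup>2 * inverse J)) \<kappa>"
  proof -
    have "s * J = \<kappa>\<^sup>2 * (\<sigma>\<^sup>2 * inverse J) / 2"
      using J_pos by (simp add: s_def field_simps power2_eq_square)
    then show ?thesis
      using J_pos \<sigma> by (subst char_normal_distribution) (auto simp: exp_of_real)
  qed
  ultimately show ?thesis by (simp only:)
qed

text \<open>Levy's continuity theorem is applied along an arbitrary sequence of horizons tending to
  infinity, which determines the limit at \<open>at_top\<close>.\<close>

lemma cdf_pivot_tendsto: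
  assumes "isCont (cdf (normal_distribution 0 (\<sigma>\<^sup>2 * inverse J))) z"
  shows "((\<lambda>T. cdf (distr M borel (pivot z T)) z) \<longlongrightarrow> cdf (normal_distribution 0 (\<sigma>\<^sup>2 * inverse J)) z) at_top"
proof (rule tendsto_at_topI_sequentially)
  fix T :: "nat \<Rightarrow> real" assume T: "filterlim T at_top sequentially"
  have "weak_conv_m (\<lambda>n. distr M borel (pivot z (T n))) (normal_distribution 0 (\<sigma>\<^sup>2 * inverse J))"
  proof (rule levy_continuity)
    show "real_distribution (distr M borel (pivot z (T n)))" for n
      by (rule real_distribution_distr) simp
    show "real_distribution (normal_distribution 0 (\<sigma>\<^sup>2 * inverse J))"
      using J_pos \<sigma> by (intro real_distribution_normal_distribution) simp
    show "(\<lambda>n. char (distr M borel (pivot z (T n))) t) \<longlonglongrightarrow> char (normal_distribution 0 (\<sigma>\<^sup>2 * inverse J)) t" for t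
      by (rule filterlim_compose[OF char_pivot_tendsto T])
  qed
  then show "(\<lambda>n. cdf (distr M borel (pivot z (T n))) z) \<longlonglongrightarrow> cdf (normal_distribution 0 (\<sigma>\<^sup>2 * inverse J)) z"
    using assms unfolding weak_conv_m_def weak_conv_def by blast
qed

text \<open>Completing the square shows that the constrained maximiser minus
  \<open>\<theta>0\<close> is the point of \<open>[-\<rho>, \<rho>]\<close> nearest to
  \<open>\<mu> = \<sigma> * score T / information T\<close>. The level \<open>z / sqrt T\<close> is
  interior, so the comparison may be made with \<open>\<mu>\<close> instead, and clearing the
  positive denominator gives the pivot.\<close>

lemma \<theta>hat_le_iff_pivot_le:
  assumes T: "0 < T" and z: "\<bar>z\<bar> < \<rho> * sqrt T"
  shows "AE \<omega> in M. 0 < information T \<omega> \<longrightarrow> (sqrt T * (\<theta>hat T \<omega> - \<theta>0) \<le> z \<longleftrightarrow> pivot z T \<omega> \<le> z)"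
  using \<theta>hat_arg_max[OF T] occupationD(2)[OF occupation_information[OF T]] stoch_integral_score[OF T] AE_regular
proof eventually_elim
  case (elim \<omega>)
  show ?case
  proof
    assume pos: "0 < information T \<omega>"
    define i where "i = information T \<omega>"
    define \<mu> where "\<mu> = \<sigma> * score T \<omega> / i"
    define d where "d = \<theta>hat T \<omega> - \<theta>0"
    have i: "0 < i" using pos by (simp add: i_def)
    have "(LINT s:{0..T}|lborel. (f (X s \<omega>))\<^sup>2) = i"
      unfolding i_def elim(2) by (intro set_lebesgue_integral_cong) (auto simp: Xc_eq[OF elim(4)])
    then have ll: "log_likelihood_rate M f \<sigma> X L R T \<omega> \<theta> =
        i / (2 * \<sigma>\<^sup>2 * T) * ((\<mu> + \<theta>0)\<^sup>2 - (\<theta> - \<theta>0 - \<mu>)\<^sup>2)" for \<theta>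
    proof -
      have "\<theta>0 * i + \<sigma> * score T \<omega> = i * (\<theta>0 + \<mu>)" using i by (simp add: \<mu>_def field_simps)
      then have "log_likelihood_rate M f \<sigma> X L R T \<omega> \<theta> = 1 / T * (\<theta> / \<sigma>\<^sup>2 * (i * (\<theta>0 + \<mu>)) - \<theta>\<^sup>2 / (2 * \<sigma>\<^sup>2) * i)"
        unfolding log_likelihood_rate_def elim(3) i_def[symmetric]
        using \<open>(LINT s:{0..T}|lborel. (f (X s \<omega>))\<^sup>2) = i\<close> by simp
      also have "\<dots> = i / (2 * \<sigma>\<^sup>2 * T) * ((\<mu> + \<theta>0)\<^sup>2 - (\<theta> - \<theta>0 - \<mu>)\<^sup>2)"
        using T \<sigma> by (simp add: field_simps power2_eq_square)
      finally show ?thesis .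
    qed
    have k: "0 < i / (2 * \<sigma>\<^sup>2 * T)" using i T \<sigma> by simp
    have "\<bar>d\<bar> \<le> \<rho>"
      using elim(1) by (simp add: is_arg_max_def d_def)
    moreover have "(d - \<mu>)\<^sup>2 \<le> (e - \<mu>)\<^sup>2" if "\<bar>e\<bar> \<le> \<rho>" for e
    proof -
      have "\<not> log_likelihood_rate M f \<sigma> X L R T \<omega> (\<theta>0 + e) > log_likelihood_rate M f \<sigma> X L R T \<omega> (\<theta>hat T \<omega>)"
        using elim(1) that unfolding is_arg_max_def by auto
      then show ?thesis
        unfolding ll mult_less_cancel_left_pos[OF k] by (simp add: d_def)
    qed
    moreover have "\<bar>z / sqrt T\<bar> < \<rho>"
      using z T by (simp add: divide_less_eq)
    ultimately have "d \<le> z / sqrt T \<longleftrightarrow> \<mu> \<le> z / sqrt T"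
      by (intro argmin_interval_le_iff)
    moreover have "sqrt T * d \<le> z \<longleftrightarrow> d \<le> z / sqrt T"
      using T by (simp add: field_simps)
    moreover have "\<mu> \<le> z / sqrt T \<longleftrightarrow> pivot z T \<omega> \<le> z"
    proof -
      have sq: "sqrt T * sqrt T = T" "0 < sqrt T" using T by auto
      have "pivot z T \<omega> \<le> z \<longleftrightarrow> \<sigma> * score T \<omega> / sqrt T - z * (i / T - J) \<le> z * J"
        unfolding pivot_def i_def using J_pos by (simp add: divide_le_eq)
      also have "\<dots> \<longleftrightarrow> \<sigma> * score T \<omega> / sqrt T \<le> z * (i / T)"
        by (simp add: right_diff_distrib)
      also have "\<dots> \<longleftrightarrow> \<sigma> * score T \<omega> \<le> z * (i / T) * sqrt T"
        using sq by (simp add: divide_le_eq)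
      also have "z * (i / T) * sqrt T = z / sqrt T * i"
        using sq by (subst sq(1)[symmetric]) (simp add: field_simps del: real_sqrt_mult_self)
      also have "\<sigma> * score T \<omega> \<le> z / sqrt T * i \<longleftrightarrow> \<mu> \<le> z / sqrt T"
        unfolding \<mu>_def using i by (simp add: divide_le_eq)
      finally show ?thesis ..
    qed
    ultimately show "sqrt T * (\<theta>hat T \<omega> - \<theta>0) \<le> z \<longleftrightarrow> pivot z T \<omega> \<le> z"
      by (simp add: d_def)
  qed
qed

text \<open>Up to a null set the two events can differ only where the information is not positive.
  There \<open>\<bar>information T / T - J\<bar>\<close> is at least \<open>J\<close>, an event
  whose probability Markov's inequality bounds.\<close>

lemma cdf_diff_tendsto:
  "((\<lambda>T. cdf (distr M borel (\<lambda>\<omega>. sqrt T * (\<theta>hat T \<omega> - \<theta>0))) z - cdf (distr M borel (pivot z T)) z) \<longlongrightarrow> 0) at_top"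
proof (rule Lim_null_comparison)
  show "\<forall>\<^sub>F T in at_top. norm (cdf (distr M borel (\<lambda>\<omega>. sqrt T * (\<theta>hat T \<omega> - \<theta>0))) z - cdf (distr M borel (pivot z T)) z)
      \<le> expectation (\<lambda>\<omega>. \<bar>information T \<omega> / T - J\<bar>) / J"
    \<comment> \<open>Beyond this horizon \<open>\<bar>z\<bar> < \<rho> * sqrt T\<close>, so the
      level is interior to the parameter interval.\<close>
    using eventually_gt_at_top[of "max 0 ((\<bar>z\<bar> / \<rho>)\<^sup>2)"]
  proof eventually_elim
    case (elim T)
    have T: "0 < T" using elim by (rule le_less_trans[OF max.cobounded1])
    have "sqrt ((\<bar>z\<bar> / \<rho>)\<^sup>2) < sqrt T"
      using elim by (intro real_sqrt_less_mono) simp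
    then have z: "\<bar>z\<bar> < \<rho> * sqrt T"
      using \<rho> by (simp add: divide_less_eq mult.commute)
    note [measurable] = \<theta>hat_measurable[OF T]
    define E1 where "E1 = {\<omega> \<in> space M. sqrt T * (\<theta>hat T \<omega> - \<theta>0) \<le> z}"
    define E2 where "E2 = {\<omega> \<in> space M. pivot z T \<omega> \<le> z}"
    define E3 where "E3 = {\<omega> \<in> space M. J \<le> \<bar>information T \<omega> / T - J\<bar>}"
    have [measurable]: "E1 \<in> sets M" "E2 \<in> sets M" "E3 \<in> sets M"
      unfolding E1_def E2_def E3_def by measurable
    have c: "cdf (distr M borel (\<lambda>\<omega>. sqrt T * (\<theta>hat T \<omega> - \<theta>0))) z = prob E1"
      "cdf (distr M borel (pivot z T)) z = prob E2"
      unfolding cdf_def E1_def E2_def by (subst measure_distr; auto intro!: arg_cong[of _ _ prob])+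
    have ae: "AE \<omega> in M. \<omega> \<notin> E3 \<longrightarrow> (\<omega> \<in> E1 \<longleftrightarrow> \<omega> \<in> E2)"
      using \<theta>hat_le_iff_pivot_le[OF T z] AE_space
    proof eventually_elim
      case (elim \<omega>)
      have "0 < information T \<omega>" if "\<omega> \<notin> E3"
      proof (rule ccontr)
        assume "\<not> 0 < information T \<omega>"
        then have "information T \<omega> / T \<le> 0" using T by (simp add: divide_le_0_iff)
        then show False using that elim(2) J_pos by (simp add: E3_def)
      qed
      then show ?case using elim by (auto simp: E1_def E2_def)
    qed
    have "prob E1 \<le> prob (E2 \<union> E3)" "prob E2 \<le> prob (E1 \<union> E3)"
      using ae by (auto intro!: finite_measure_mono_AE elim!: eventually_mono)
    moreover have "prob (E2 \<union> E3) \<le> prob E2 + prob E3" "prob (E1 \<union> E3) \<le> prob E1 + prob E3"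
      by (auto intro: measure_Un_le)
    ultimately have "\<bar>prob E1 - prob E2\<bar> \<le> prob E3" by linarith
    also have "\<dots> \<le> expectation (\<lambda>\<omega>. \<bar>information T \<omega> / T - J\<bar>) / J"
      unfolding E3_def using J_pos information_L1_integrable[OF T]
      by (intro integral_Markov_inequality_measure[of _ _ "{}"]) auto
    finally show ?case unfolding c real_norm_def .
  qed
  show "((\<lambda>T. expectation (\<lambda>\<omega>. \<bar>information T \<omega> / T - J\<bar>) / J) \<longlongrightarrow> 0) at_top"
    using tendsto_divide[OF information_L1_tendsto tendsto_const, of J] J_pos by simp
qed

lemma mle_asymptotically_normal:
  "weak_conv_filter (\<lambda>T. distr M borel (\<lambda>\<omega>. sqrt T * (\<theta>hat T \<omega> - \<theta>0)))
     (normal_distribution 0 (\<sigma>\<^sup>2 * inverse J)) at_top"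
  by (rule weak_conv_filter_at_topI[OF cdf_pivot_tendsto cdf_diff_tendsto])

end

theorem theorem4:
  fixes M :: "'a measure" and F :: "real \<Rightarrow> 'a measure"
    and W X L R :: "real \<Rightarrow> 'a \<Rightarrow> real"
    and l u \<sigma> x \<theta>0 \<rho> :: real and f :: "real \<Rightarrow> real"
    and \<theta>hat :: "real \<Rightarrow> 'a \<Rightarrow> real"
  assumes "prob_space M" and "filtration_on M F" and "standard_brownian_motion M F W"
    and "0 \<le> l" and "l < u" and "\<sigma> > 0" and "x \<in> {l..u}" and "\<rho> > 0"
    and "f \<in> borel_measurable (restrict_space borel {l..u})"
    and "\<exists>K>0. \<forall>x1\<in>{l..u}. \<forall>x2\<in>{l..u}. \<bar>f x1 - f x2\<bar> \<le> K * \<bar>x1 - x2\<bar>"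
    and "\<exists>y\<in>{l..u}. f y \<noteq> 0"
    and "reflected_sde_solution M F W l u (\<lambda>y. \<theta>0 * f y) \<sigma> x X L R"
    and "\<And>T. T > 0 \<Longrightarrow> \<theta>hat T \<in> borel_measurable M"
    and "\<And>T. T > 0 \<Longrightarrow> AE \<omega> in M.
           is_arg_max (log_likelihood_rate M f \<sigma> X L R T \<omega>) (\<lambda>\<theta>. \<bar>\<theta> - \<theta>0\<bar> \<le> \<rho>) (\<theta>hat T \<omega>)"
  shows "weak_conv_filter (\<lambda>T. distr M borel (\<lambda>\<omega>. sqrt T * (\<theta>hat T \<omega> - \<theta>0)))
           (normal_distribution 0 (\<sigma>\<^sup>2 * inverse (limit_information f \<theta>0 \<sigma> l u))) at_top"
proof -
  obtain K where "K > 0" and K: "\<And>x1 x2. x1 \<in> {l..u} \<Longrightarrow> x2 \<in> {l..u} \<Longrightarrow> \<bar>f x1 - f x2\<bar> \<le> K * \<bar>x1 - x2\<bar>"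
    using assms(10) by blast
  have "K-lipschitz_on {l..u} f"
    using K \<open>K > 0\<close> by (intro lipschitz_onI) (auto simp: dist_real_def)
  then have f: "continuous_on {l..u} f"
    by (rule lipschitz_on_continuous_on)
  obtain y where y: "y \<in> {l..u}" "f y \<noteq> 0"
    using assms(11) by blast
  interpret prob_space M by fact
  interpret mle_setting M F W f X L R l u \<sigma> x \<theta>0 \<rho> \<theta>hat
    by unfold_locales (use assms f limit_information_pos[OF assms(5) f y] in auto)
  show ?thesis by (rule mle_asymptotically_normal)
qed

end
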